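(* For any root of unity quantum seed $(M,\widetilde B)$ and any $\mathrm{inv}\subseteq[1,N]\setminus\mathrm{ex}$, one has $\mathcal A_\varepsilon(M,\widetilde B,\mathrm{inv})\subseteq\mathcal U_\varepsilon(M,\widetilde B,\mathrm{inv})$.
   Context: Let $\ell$ be a positive integer, $\mathbb Z_\ell=\mathbb Z/\ell\mathbb Z$, $\varepsilon^{1/2}\in\mathbb C$ a primitive $\ell$-th root of unity, $\mathcal A^{1/2}_\varepsilon=\mathbb Z[\varepsilon^{1/2}]$, $\varepsilon^{a/2}=(\varepsilon^{1/2})^a$ for $a\in\mathbb Z_\ell$; $\overline C$ is the reduction mod $\ell$ of an integer matrix $C$; $e_1,\dots,e_N$ is the standard basis of $\mathbb Z^N$. For a skew-symmetric bilinear form $\Lambda:\mathbb Z^N\times\mathbb Z^N\to\mathbb Z_\ell$ with matrix $(\lambda_{ij})$, $\mathcal T_\varepsilon(\Lambda)$ is the $\mathcal A^{1/2}_\varepsilon$-algebra with basis $\{X^f\}_{f\in\mathbb Z^N}$ and $X^fX^g=\varepsilon^{\Lambda(f,g)/2}X^{f+g}$. A root of unity toric frame of a division algebra $\mathcal F$ over $\mathbb Q(\varepsilon^{1/2})$ is a map $M:\mathbb Z^N\to\mathcal F$ such that for some (unique) skew-symmetric $\Lambda=:\Lambda_M$ there is an injective $\mathcal A^{1/2}_\varepsilon$-algebra map $\phi:\mathcal T_\varepsilon(\Lambda)\to\mathcal F$, $\phi(X^f)=M(f)$, with $\mathcal F$ the skew field of fractions of its image. Fix $\mathrm{ex}\subseteq[1,N]$.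 An exchange matrix $\widetilde B=(b_{ij})$ is an integer matrix with rows indexed by $[1,N]$, columns by $\mathrm{ex}$, principal part $B$, $k$-th column $b^k$. $(\Lambda,\widetilde B)$ is $\ell$-compatible if there is $D=\mathrm{diag}(d_j)_{j\in\mathrm{ex}}$, $d_j\in\mathbb Z_{>0}$, with $DB$ skew-symmetric and $\sum_k\overline b_{kj}\lambda_{ki}=\delta_{ij}\overline d_j$ in $\mathbb Z_\ell$ for all $i\in[1,N]$, $j\in\mathrm{ex}$. A root of unity quantum seed is $(M,\widetilde B)$ with $(\Lambda_M,\widetilde B)$ $\ell$-compatible. For $b\in\mathbb Z^N$, $[b]_\pm$ keeps the entries $b_i$ with $\pm b_i\ge0$ and sets the others to $0$. Mutation in direction $k\in\mathrm{ex}$: $\mu_k(\widetilde B)=(b'_{ij})$, $b'_{ij}=-b_{ij}$ if $i=k$ or $j=k$, otherwise $b'_{ij}=b_{ij}+(|b_{ik}|b_{kj}+b_{ik}|b_{kj}|)/2$; $\mu_k(M)$ is the root of unity toric frame with matrix $\overline E^\top\Lambda_M\overline E$ ($E$: $e_{ij}=\delta_{ij}$ for $j\neq k$, $e_{kk}=-1$, $e_{ik}=\max(0,-b_{ik})$ for $i\ne k$) and $\mu_k(M)(e_j)=M(e_j)$ ($j\ne k$), $\mu_k(M)(e_k)=M(-e_k+[b^k]_+)+M(-e_k-[b^k]_-)$. $\mathcal A_\varepsilon(M,\widetilde B,\mathrm{inv})$ is the $\mathcal A^{1/2}_\varepsilon$-subalgebra of $\mathcal F$ generated by all $M'(e_i)$,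 $i\in[1,N]$, over all seeds $(M',\widetilde B')$ mutation-equivalent to $(M,\widetilde B)$, and by $M(e_j)^{-1}$, $j\in\mathrm{inv}$. $\mathcal U_\varepsilon(M,\widetilde B,\mathrm{inv})$ is the intersection over all seeds $(M',\widetilde B')$ mutation-equivalent to $(M,\widetilde B)$ of the subalgebras $\mathcal A^{1/2}_\varepsilon\langle M'(e_i),M'(e_j)^{-1}: i\in[1,N],\ j\in\mathrm{ex}\sqcup\mathrm{inv}\rangle$ of $\mathcal F$. *)

theory Defs
  imports "HOL-Computational_Algebra.Polynomial" "HOL-Library.Function_Algebras"
begin

text \<open>Indices: [1,N] of the paper is rendered as {0..<N}. Vectors of Z^N are
  functions nat => int vanishing outside {0..<N}.\<close>

definition Zvec :: "nat \<Rightarrow> (nat \<Rightarrow> int) set" where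
  "Zvec N = {f. \<forall>i\<ge>N. f i = 0}"

definition uvec :: "nat \<Rightarrow> nat \<Rightarrow> int" where
  "uvec i = (\<lambda>j. if j = i then 1 else 0)"

definition Qfield :: "complex \<Rightarrow> complex set" where
  "Qfield z = {poly p z | p. \<forall>i. coeff p i \<in> \<rat>}"

definition Aring :: "complex \<Rightarrow> complex set" where
  "Aring z = {poly p z | p. \<forall>i. coeff p i \<in> \<int>}"

definition primitive_root :: "nat \<Rightarrow> complex \<Rightarrow> bool" where
  "primitive_root l z \<longleftrightarrow> l > 0 \<and> z ^ l = 1 \<and> (\<forall>m. 0 < m \<and> m < l \<longrightarrow> z ^ m \<noteq> 1)"

definition division_algebra_over :: "complex \<Rightarrow> (complex \<Rightarrow> 'f::division_ring) \<Rightarrow> bool" where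
  "division_algebra_over z \<iota> \<longleftrightarrow>
     \<iota> 1 = 1 \<and>
     (\<forall>a\<in>Qfield z. \<forall>b\<in>Qfield z. \<iota> (a + b) = \<iota> a + \<iota> b \<and> \<iota> (a * b) = \<iota> a * \<iota> b) \<and>
     inj_on \<iota> (Qfield z) \<and>
     (\<forall>a\<in>Qfield z. \<forall>x. \<iota> a * x = x * \<iota> a)"

text \<open>Bilinear form with integer matrix lam (entries read mod l).\<close>
definition bil :: "nat \<Rightarrow> (nat \<Rightarrow> nat \<Rightarrow> int) \<Rightarrow> (nat \<Rightarrow> int) \<Rightarrow> (nat \<Rightarrow> int) \<Rightarrow> int" where
  "bil N lam f g = (\<Sum>i<N. \<Sum>j<N. f i * lam i j * g j)"

definition skew_mod :: "nat \<Rightarrow> nat \<Rightarrow> (nat \<Rightarrow> nat \<Rightarrow> int) \<Rightarrow> bool" where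
  "skew_mod l N lam \<longleftrightarrow> (\<forall>i<N. \<forall>j<N. (lam i j + lam j i) mod int l = 0)"

definition gen_alg :: "complex \<Rightarrow> (complex \<Rightarrow> 'f::division_ring) \<Rightarrow> 'f set \<Rightarrow> 'f set" where
  "gen_alg z \<iota> S = \<Inter>{R. \<iota> ` Aring z \<subseteq> R \<and> S \<subseteq> R \<and>
       (\<forall>x\<in>R. \<forall>y\<in>R. x + y \<in> R \<and> x * y \<in> R \<and> - x \<in> R)}"

definition div_closure :: "'f::division_ring set \<Rightarrow> 'f set" where
  "div_closure S = \<Inter>{R. S \<subseteq> R \<and> 0 \<in> R \<and> 1 \<in> R \<and>
       (\<forall>x\<in>R. \<forall>y\<in>R. x + y \<in> R \<and> x * y \<in> R \<and> - x \<in> R \<and> inverse x \<in> R)}"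

definition toric_frame ::
  "nat \<Rightarrow> complex \<Rightarrow> (complex \<Rightarrow> 'f::division_ring) \<Rightarrow> nat \<Rightarrow> (nat \<Rightarrow> nat \<Rightarrow> int)
     \<Rightarrow> ((nat \<Rightarrow> int) \<Rightarrow> 'f) \<Rightarrow> bool" where
  "toric_frame l z \<iota> N lam M \<longleftrightarrow>
     skew_mod l N lam \<and>
     M 0 = 1 \<and>
     (\<forall>f\<in>Zvec N. \<forall>g\<in>Zvec N. M f * M g = \<iota> (z powi bil N lam f g) * M (f + g)) \<and>
     (\<forall>c :: (nat \<Rightarrow> int) \<Rightarrow> complex.
        finite {f\<in>Zvec N. c f \<noteq> 0} \<and> (\<forall>f. c f \<in> Aring z) \<and>
        (\<Sum>f\<in>{f\<in>Zvec N. c f \<noteq> 0}. \<iota> (c f) * M f) = 0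
        \<longrightarrow> (\<forall>f\<in>Zvec N. c f = 0)) \<and>
     div_closure (\<iota> ` Aring z \<union> M ` Zvec N) = UNIV"

definition l_compatible ::
  "nat \<Rightarrow> nat \<Rightarrow> nat set \<Rightarrow> (nat \<Rightarrow> nat \<Rightarrow> int) \<Rightarrow> (nat \<Rightarrow> nat \<Rightarrow> int) \<Rightarrow> bool" where
  "l_compatible l N ex lam B \<longleftrightarrow>
     (\<exists>d :: nat \<Rightarrow> int. (\<forall>j\<in>ex. d j > 0) \<and>
        (\<forall>i\<in>ex. \<forall>j\<in>ex. d i * B i j = - (d j * B j i)) \<and>
        (\<forall>i<N. \<forall>j\<in>ex. ((\<Sum>k<N. B k j * lam k i) - (if i = j then d j else 0)) mod int l = 0))"

definition quantum_seed ::
  "nat \<Rightarrow> complex \<Rightarrow> (complex \<Rightarrow> 'f::division_ring) \<Rightarrow> nat \<Rightarrow> nat set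
     \<Rightarrow> ((nat \<Rightarrow> int) \<Rightarrow> 'f) \<Rightarrow> (nat \<Rightarrow> nat \<Rightarrow> int) \<Rightarrow> bool" where
  "quantum_seed l z \<iota> N ex M B \<longleftrightarrow>
     (\<exists>lam. toric_frame l z \<iota> N lam M \<and> l_compatible l N ex lam B)"

definition mutB :: "(nat \<Rightarrow> nat \<Rightarrow> int) \<Rightarrow> nat \<Rightarrow> nat \<Rightarrow> nat \<Rightarrow> int" where
  "mutB B k = (\<lambda>i j. if i = k \<or> j = k then - B i j
                      else B i j + (\<bar>B i k\<bar> * B k j + B i k * \<bar>B k j\<bar>) div 2)"

definition mutE :: "(nat \<Rightarrow> nat \<Rightarrow> int) \<Rightarrow> nat \<Rightarrow> nat \<Rightarrow> nat \<Rightarrow> int" where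
  "mutE B k = (\<lambda>a i. if i = k then (if a = k then -1 else max 0 (- B a k))
                     else (if a = i then 1 else 0))"

definition mutLam :: "nat \<Rightarrow> (nat \<Rightarrow> nat \<Rightarrow> int) \<Rightarrow> nat \<Rightarrow> (nat \<Rightarrow> nat \<Rightarrow> int) \<Rightarrow> nat \<Rightarrow> nat \<Rightarrow> int" where
  "mutLam N B k lam = (\<lambda>i j. \<Sum>a<N. \<Sum>c<N. mutE B k a i * lam a c * mutE B k c j)"

definition colv :: "nat \<Rightarrow> (nat \<Rightarrow> nat \<Rightarrow> int) \<Rightarrow> nat \<Rightarrow> nat \<Rightarrow> int" where
  "colv N B k = (\<lambda>i. if i < N then B i k else 0)"

definition posp :: "(nat \<Rightarrow> int) \<Rightarrow> nat \<Rightarrow> int" where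
  "posp b = (\<lambda>i. if b i \<ge> 0 then b i else 0)"

definition negp :: "(nat \<Rightarrow> int) \<Rightarrow> nat \<Rightarrow> int" where
  "negp b = (\<lambda>i. if b i \<le> 0 then b i else 0)"

text \<open>One mutation step (M1,B1) -> (M2,B2) in some direction k in ex: M2 is the
  (unique) toric frame with matrix E^T Lambda_{M1} E and the prescribed values on
  the standard basis.\<close>
definition mut_step ::
  "nat \<Rightarrow> complex \<Rightarrow> (complex \<Rightarrow> 'f::division_ring) \<Rightarrow> nat \<Rightarrow> nat set
     \<Rightarrow> ((nat \<Rightarrow> int) \<Rightarrow> 'f) \<times> (nat \<Rightarrow> nat \<Rightarrow> int)
     \<Rightarrow> ((nat \<Rightarrow> int) \<Rightarrow> 'f) \<times> (nat \<Rightarrow> nat \<Rightarrow> int) \<Rightarrow> bool" where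
  "mut_step l z \<iota> N ex S1 S2 \<longleftrightarrow>
     (\<exists>k\<in>ex. snd S2 = mutB (snd S1) k \<and>
        (\<exists>lam. toric_frame l z \<iota> N lam (fst S1) \<and>
               toric_frame l z \<iota> N (mutLam N (snd S1) k lam) (fst S2)) \<and>
        (\<forall>j<N. j \<noteq> k \<longrightarrow> fst S2 (uvec j) = fst S1 (uvec j)) \<and>
        fst S2 (uvec k) =
          fst S1 (- uvec k + posp (colv N (snd S1) k))
          + fst S1 (- uvec k - negp (colv N (snd S1) k)))"

definition mut_equiv where
  "mut_equiv l z \<iota> N ex = (mut_step l z \<iota> N ex)\<^sup>*\<^sup>*"

definition cluster_alg ::
  "nat \<Rightarrow> complex \<Rightarrow> (complex \<Rightarrow> 'f::division_ring) \<Rightarrow> nat \<Rightarrow> nat set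
     \<Rightarrow> ((nat \<Rightarrow> int) \<Rightarrow> 'f) \<Rightarrow> (nat \<Rightarrow> nat \<Rightarrow> int) \<Rightarrow> nat set \<Rightarrow> 'f set" where
  "cluster_alg l z \<iota> N ex M B invs = gen_alg z \<iota>
     ({fst S (uvec i) | S i. mut_equiv l z \<iota> N ex (M, B) S \<and> i < N}
      \<union> {inverse (M (uvec j)) | j. j \<in> invs})"

definition upper_alg ::
  "nat \<Rightarrow> complex \<Rightarrow> (complex \<Rightarrow> 'f::division_ring) \<Rightarrow> nat \<Rightarrow> nat set
     \<Rightarrow> ((nat \<Rightarrow> int) \<Rightarrow> 'f) \<Rightarrow> (nat \<Rightarrow> nat \<Rightarrow> int) \<Rightarrow> nat set \<Rightarrow> 'f set" where
  "upper_alg l z \<iota> N ex M B invs =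
     (\<Inter>S\<in>{S. mut_equiv l z \<iota> N ex (M, B) S}.
        gen_alg z \<iota> ({fst S (uvec i) | i. i < N} \<union> {inverse (fst S (uvec j)) | j. j \<in> ex \<union> invs}))"

end

theory Submission
  imports Defs "HOL-Number_Theory.Cong" "HOL-Computational_Algebra.Primes" "HOL-Library.Infinite_Set"
begin

text \<open>
  The scalars include a root of unity, so the \<open>l\<close>-th power \<open>u\<close> of a new cluster variable is central in
  the quantum torus \<open>T\<close> of the old seed. Consider four seeds joined by mutations in directions
  \<open>i\<close>, \<open>j\<close>, \<open>i\<close>. An element of the tori of the second and the fourth seed becomes an
  element of the first torus \<open>T\<close> after multiplication by a power of \<open>u\<close>, and also after multiplication
  by a monomial \<open>v\<close> in the two new variables of the third and fourth seed. If \<open>v\<close> is regular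
  modulo \<open>u T\<close>, the element already lies in \<open>T\<close>, and the Laurent phenomenon follows by induction on
  the length of the mutation path. Regularity holds because, for a suitable grading of \<open>T\<close>, the element
  \<open>u\<close> is homogeneous while the two variables have a unit as leading term. If \<open>b i j \<noteq> 0\<close> the grading is
  the exponent of the \<open>i\<close>-th variable; if \<open>b i j = 0\<close> one needs a grading that separates the columns
  \<open>i\<close> and \<open>j\<close>, which exists if the exchange matrix has full rank.

  Full rank is achieved by adding principal coefficients: central frozen variables, realised as powers
  \<open>t\<^sup>r\<close> with rationally independent real \<open>r\<close> inside a division ring of series with real exponents over
  the given division ring. The result is then specialised along \<open>t = 1\<close>.

  That the exponents of noninverted frozen variables stay nonnegative is seen by comparing lowest terms:
  an exchange binomial is not divisible by a frozen variable.
\<close>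

section \<open>Vectors, scalars and quantum tori\<close>

text \<open>Two obstacles shape the details. The fourth seed does not lie on the given mutation
  path, so its frame has to be constructed and its monomials shown to be independent. Independence
  comes from a leading term of the new variable, which needs a nonzero column: this is a further use
  of full rank. Reversing the last mutation gives a path from the fourth seed that is one step
  shorter than the original, as is the path from the second seed; hence the induction on length.

  Setting \<open>t = 1\<close> makes sense only for series with finite support, and the inverse of
  such a series may have infinite support. So it is not automatic that a lifted cluster variable can
  be specialised. The Laurent theorem for full rank, applied in the lifted initial seed, supplies
  this finiteness. Its value is then found without evaluating an inverse: the exchange relation is
  multiplied by the old variable, evaluated, and the old variable is cancelled.

  The real exponents are logarithms of primes, independent by unique factorisation. Forms are
  integer valued throughout and compared only mod \<open>l\<close>.\<close>

definition svec :: "int \<Rightarrow> nat \<Rightarrow> nat \<Rightarrow> int" where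
  "svec m k = (\<lambda>i. if i = k then m else 0)"

lemma uvec_svec: "uvec k = svec 1 k"
  by (simp add: uvec_def svec_def)

lemma svec_Suc: "svec (int (Suc m)) k = svec (int m) k + uvec k"
  by (auto simp: svec_def uvec_def fun_eq_iff)

lemma svec_0 [simp]: "svec 0 k = 0"
  by (auto simp: svec_def fun_eq_iff)

lemma svec_uminus: "svec (- a) k = - svec a k"
  by (auto simp: svec_def fun_eq_iff)

lemma svec_same [simp]: "svec m k k = m"
  and svec_other [simp]: "i \<noteq> k \<Longrightarrow> svec m k i = 0"
  by (simp_all add: svec_def)

lemma uvec_same [simp]: "uvec k k = 1"
  and uvec_other [simp]: "i \<noteq> k \<Longrightarrow> uvec k i = 0"
  by (simp_all add: uvec_def)

lemma fun_upd_split: "f = f(k := 0) + svec (f k) k" for f :: "nat \<Rightarrow> int"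
  by (auto simp: svec_def fun_eq_iff)

lemma fun_upd_zero_add: "(f + g)(k := 0) = f(k := 0) + g(k := 0)" for f g :: "nat \<Rightarrow> int"
  by (auto simp: fun_eq_iff)

lemma Zvec_zero [simp]: "0 \<in> Zvec n"
  by (simp add: Zvec_def)

lemma Zvec_add [simp]: "f \<in> Zvec n \<Longrightarrow> g \<in> Zvec n \<Longrightarrow> f + g \<in> Zvec n"
  by (simp add: Zvec_def)

lemma Zvec_uminus [simp]: "f \<in> Zvec n \<Longrightarrow> - f \<in> Zvec n"
  by (simp add: Zvec_def)

lemma Zvec_diff [simp]: "f \<in> Zvec n \<Longrightarrow> g \<in> Zvec n \<Longrightarrow> f - g \<in> Zvec n"
  by (simp add: Zvec_def)

lemma Zvec_svec [simp]: "k < n \<Longrightarrow> svec m k \<in> Zvec n"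
  by (simp add: Zvec_def)

lemma Zvec_uvec [simp]: "k < n \<Longrightarrow> uvec k \<in> Zvec n"
  by (simp add: Zvec_def)

lemma Zvec_upd [simp]: "f \<in> Zvec n \<Longrightarrow> f(k := 0) \<in> Zvec n"
  by (simp add: Zvec_def)

lemma Zvec_colv [simp]: "colv n B k \<in> Zvec n"
  by (simp add: Zvec_def colv_def)

lemma Zvec_posp [simp]: "f \<in> Zvec n \<Longrightarrow> posp f \<in> Zvec n"
  by (simp add: Zvec_def posp_def)

lemma negp_posp: "- negp b = posp (- b)"
  by (auto simp: posp_def negp_def fun_eq_iff)

lemma posp_apply: "posp b i = max 0 (b i)"
  by (auto simp: posp_def)

lemma colv_apply [simp]: "i < n \<Longrightarrow> colv n B k i = B i k"
  by (simp add: colv_def)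

text \<open>The vectors supported on \<open>I\<close> form the free abelian group on the
  \<open>uvec i\<close>. Induction along the group operations suits frames, because
  \<open>M f\<close> and \<open>M g\<close> determine \<open>M (f + g)\<close> and
  \<open>M (- f)\<close> up to powers of \<open>q\<close>.\<close>

lemma support_induct [consumes 2, case_names zero add uminus gen]:
  fixes f :: "nat \<Rightarrow> int"
  assumes "finite I" "\<forall>i. i \<notin> I \<longrightarrow> f i = 0"
    and zero: "P 0"
    and add: "\<And>f g. \<lbrakk>\<forall>i. i \<notin> I \<longrightarrow> f i = 0; \<forall>i. i \<notin> I \<longrightarrow> g i = 0; P f; P g\<rbrakk> \<Longrightarrow> P (f + g)"
    and uminus: "\<And>f. \<lbrakk>\<forall>i. i \<notin> I \<longrightarrow> f i = 0; P f\<rbrakk> \<Longrightarrow> P (- f)"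
    and gen: "\<And>i. i \<in> I \<Longrightarrow> P (uvec i)"
  shows "P f"
proof -
  have nat: "P (svec (int m) k)" if "k \<in> I" for k m
  proof (induction m)
    case (Suc m)
    show ?case
      unfolding svec_Suc using add[of "svec (int m) k" "uvec k"] Suc gen that
      by (metis svec_other uvec_other)
  qed (simp only: zero of_nat_0 svec_0)
  have sv: "P (svec m k)" if "k \<in> I" for k m
  proof (cases "m \<ge> 0")
    case True
    then show ?thesis using nat[OF that, of "nat m"] by simp
  next
    case False
    then have "svec m k = - svec (int (nat (- m))) k"
      by (simp flip: svec_uminus)
    then show ?thesis
      using uminus[of "svec (int (nat (- m))) k"] nat[OF that, of "nat (-m)"] that
      by (metis svec_other)
  qed
  have "J \<subseteq> I \<Longrightarrow> (\<And>i. i \<notin> J \<Longrightarrow> f i = 0) \<Longrightarrow> P f" if "finite J" for J f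
    using that
  proof (induction J arbitrary: f rule: finite_induct)
    case empty
    then have "f = 0" by (auto simp: fun_eq_iff)
    then show ?case using zero by metis
  next
    case (insert k J)
    have "P (f(k := 0))" using insert by auto
    moreover have "P (svec (f k) k)" using sv insert by auto
    ultimately show ?case
      using add[of "f(k := 0)" "svec (f k) k"] insert.prems fun_upd_split[of f k]
      by (metis fun_upd_other fun_upd_same insertCI subset_iff svec_other)
  qed
  then show ?thesis using assms(1,2) by blast
qed

section \<open>Biadditive forms and gradings on exponent vectors\<close>

definition biadd :: "((nat \<Rightarrow> int) \<Rightarrow> (nat \<Rightarrow> int) \<Rightarrow> int) \<Rightarrow> bool" where
  "biadd L \<longleftrightarrow> (\<forall>f g h. L (f + g) h = L f h + L g h \<and> L h (f + g) = L h f + L h g)"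

lemma biaddD:
  assumes "biadd L"
  shows "L (f + g) h = L f h + L g h" "L h (f + g) = L h f + L h g"
    "L 0 h = 0" "L h 0 = 0" "L (- f) h = - L f h" "L h (- f) = - L h f"
    "L (f - g) h = L f h - L g h" "L h (f - g) = L h f - L h g"
proof -
  show *: "L (f + g) h = L f h + L g h" "L h (f + g) = L h f + L h g" for f g h
    using assms by (auto simp: biadd_def)
  show **: "L 0 h = 0" "L h 0 = 0" for h
    using *[of 0 0] *(2)[of h 0 0] by simp_all
  show ***: "L (- f) h = - L f h" "L h (- f) = - L h f" for f
    using *(1)[of f "-f" h] *(2)[of h f "-f"] **[of h] by simp_all
  show "L (f - g) h = L f h - L g h" "L h (f - g) = L h f - L h g"
    using *(1)[of f "- g" h] *(2)[of h f "- g"] ***[of g] by simp_all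
qed

lemma zlinear_svec:
  fixes \<phi> :: "(nat \<Rightarrow> int) \<Rightarrow> int"
  assumes "\<And>f g. \<phi> (f + g) = \<phi> f + \<phi> g"
  shows "\<phi> (svec m k) = m * \<phi> (uvec k)"
proof -
  have 0: "\<phi> 0 = 0" using assms[of 0 0] by simp
  have nat: "\<phi> (svec (int m) k) = int m * \<phi> (uvec k)" for m
  proof (induction m)
    case (Suc m)
    show ?case
      by (simp only: svec_Suc assms Suc) (simp add: algebra_simps)
  qed (simp only: 0 of_nat_0 svec_0 mult_zero_left)
  show ?thesis
  proof (cases "m \<ge> 0")
    case True
    then show ?thesis using nat[of "nat m"] by simp
  next
    case False
    have "\<phi> (svec m k) + \<phi> (svec (- m) k) = 0"
      using assms[of "svec m k" "svec (- m) k"] 0 by (simp add: svec_uminus)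
    then show ?thesis using nat[of "nat (- m)"] False by simp
  qed
qed

lemma biadd_svec:
  assumes "biadd L"
  shows "L (svec m k) h = m * L (uvec k) h" "L h (svec m k) = m * L h (uvec k)"
  using zlinear_svec[of "\<lambda>f. L f h" m k] zlinear_svec[of "L h" m k] assms
  by (auto simp: biadd_def)

lemma cong_int_iff_ex: "[a = b] (mod m) \<longleftrightarrow> (\<exists>k. a = b + m * k)" for a b m :: int
  by (auto simp: cong_iff_dvd_diff dvd_def algebra_simps)

text \<open>These functionals serve as gradings of a quantum torus: the monomial \<open>M f\<close>
  has degree \<open>\<delta> f\<close>.\<close>

definition zlinear :: "((nat \<Rightarrow> int) \<Rightarrow> int) \<Rightarrow> bool" where
  "zlinear \<delta> \<longleftrightarrow> (\<forall>f g. \<delta> (f + g) = \<delta> f + \<delta> g)"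

lemma zlinearD:
  assumes "zlinear \<delta>"
  shows "\<delta> (f + g) = \<delta> f + \<delta> g" "\<delta> 0 = 0" "\<delta> (- f) = - \<delta> f" "\<delta> (f - g) = \<delta> f - \<delta> g"
    "\<delta> (svec m k) = m * \<delta> (uvec k)"
proof -
  show *: "\<delta> (f + g) = \<delta> f + \<delta> g" for f g using assms by (auto simp: zlinear_def)
  show **: "\<delta> 0 = 0" using *[of 0 0] by simp
  show ***: "\<delta> (- f) = - \<delta> f" for f using *[of f "-f"] ** by simp
  show "\<delta> (f - g) = \<delta> f - \<delta> g" using *[of f "-g"] *** by simp
  show "\<delta> (svec m k) = m * \<delta> (uvec k)" using zlinear_svec[of \<delta>] * by blast
qed

lemma zlinear_coord [simp]: "zlinear (\<lambda>f. f i)"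
  by (simp add: zlinear_def)

text \<open>The scalars are a central subset of a division ring, so that one theory covers both the
  image of \<open>Aring z\<close> in the given division ring and its copy inside the series ring.
  That \<open>l\<close> is the exact order of the root of unity enters only later, in
  \<open>qp_inj\<close>.\<close>

locale central_scalars =
  fixes A :: "'k::division_ring set" and q :: 'k and l :: nat
  assumes A_comm: "a \<in> A \<Longrightarrow> a * x = x * a"
    and A_zero [simp]: "0 \<in> A" and A_one [simp]: "1 \<in> A"
    and A_add [simp]: "a \<in> A \<Longrightarrow> b \<in> A \<Longrightarrow> a + b \<in> A"
    and A_mult [simp]: "a \<in> A \<Longrightarrow> b \<in> A \<Longrightarrow> a * b \<in> A"
    and A_uminus [simp]: "a \<in> A \<Longrightarrow> - a \<in> A"
    and q_in [simp]: "q \<in> A" and l_pos: "l > 0" and q_pow: "q ^ l = 1"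
begin

definition qp :: "int \<Rightarrow> 'k" where "qp e = q powi e"

lemma q_nz [simp]: "q \<noteq> 0"
  using q_pow l_pos by (metis power_0_left not_gr_zero zero_neq_one)

lemma qp_0 [simp]: "qp 0 = 1"
  by (simp add: qp_def)

lemma qp_add: "qp (a + b) = qp a * qp b"
  by (simp add: qp_def power_int_add)

lemma qp_nz [simp]: "qp a \<noteq> 0"
  by (simp add: qp_def)

lemma qp_uminus: "qp (- a) = inverse (qp a)"
  by (simp add: qp_def power_int_minus)

lemma qp_l: "qp (int l * k) = 1"
proof -
  have "qp (int l * k) = (q powi int l) powi k"
    by (simp only: qp_def power_int_mult)
  then show ?thesis by (simp add: q_pow)
qed

lemma qp_cong: "[a = b] (mod int l) \<Longrightarrow> qp a = qp b"
  by (auto simp: cong_int_iff_ex qp_add qp_l)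

lemma A_pow [simp]: "a \<in> A \<Longrightarrow> a ^ m \<in> A"
  by (induction m) auto

lemma qp_in [simp]: "qp a \<in> A"
proof -
  \<comment> \<open>\<open>A\<close> need not be closed under inverses; \<open>q ^ l = 1\<close>
    trades a negative exponent for a nonnegative one.\<close>
  have "qp a = qp (a mod int l)"
    by (rule qp_cong) (simp add: cong_def)
  also have "\<dots> = q ^ nat (a mod int l)"
    using l_pos by (simp add: qp_def power_int_nonneg_exp)
  finally show ?thesis by simp
qed

lemma qp_comm: "x * qp a = qp a * x"
  using A_comm[OF qp_in] by simp

lemma qp_left_comm: "x * (qp a * y) = qp a * (x * y)"
  by (simp add: qp_comm flip: mult.assoc)

lemma qp_merge: "qp a * (qp b * x) = qp (a + b) * x"
  by (simp add: qp_add mult.assoc)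

text \<open>The guards keep the simplifier from swapping two powers of \<open>q\<close> forever;
  with \<open>qp_simps\<close> all powers of \<open>q\<close> move to the front and merge.\<close>

lemma qp_comm_NO_MATCH: "NO_MATCH (qp e) x \<Longrightarrow> x * qp a = qp a * x"
  by (rule qp_comm)

lemma qp_left_comm_NO_MATCH: "NO_MATCH (qp e) x \<Longrightarrow> x * (qp a * y) = qp a * (x * y)"
  by (rule qp_left_comm)

lemmas qp_simps = qp_comm_NO_MATCH qp_left_comm_NO_MATCH qp_merge qp_add[symmetric] mult.assoc

section \<open>Spans of monomials over the scalars, and independence\<close>

definition aspan :: "((nat \<Rightarrow> int) \<Rightarrow> 'k) \<Rightarrow> (nat \<Rightarrow> int) set \<Rightarrow> 'k set" where
  "aspan M X = {\<Sum>f\<in>S. c f * M f | S c. finite S \<and> S \<subseteq> X \<and> (\<forall>f\<in>S. c f \<in> A)}"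

lemma aspanI: "finite S \<Longrightarrow> S \<subseteq> X \<Longrightarrow> (\<And>f. f \<in> S \<Longrightarrow> c f \<in> A) \<Longrightarrow> (\<Sum>f\<in>S. c f * M f) \<in> aspan M X"
  by (auto simp: aspan_def)

lemma aspanE:
  assumes "y \<in> aspan M X"
  obtains S c where "finite S" "S \<subseteq> X" "\<And>f. f \<in> S \<Longrightarrow> c f \<in> A" "y = (\<Sum>f\<in>S. c f * M f)"
  using assms by (auto simp: aspan_def)

lemma aspan_mono: "X \<subseteq> Y \<Longrightarrow> y \<in> aspan M X \<Longrightarrow> y \<in> aspan M Y"
  by (fastforce simp: aspan_def)

lemma aspan_0 [simp]: "0 \<in> aspan M X"
  using aspanI[of "{}" X "\<lambda>_. 0" M] by simp

lemma aspan_term: "f \<in> X \<Longrightarrow> a \<in> A \<Longrightarrow> a * M f \<in> aspan M X"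
  using aspanI[of "{f}" X "\<lambda>_. a" M] by simp

lemma aspan_qterm: "f \<in> X \<Longrightarrow> qp s * M f \<in> aspan M X"
  by (rule aspan_term) auto

lemma aspan_base: "f \<in> X \<Longrightarrow> M f \<in> aspan M X"
  using aspan_term[of f X 1 M] by simp

lemma aspan_add: 
  assumes "x \<in> aspan M X" "y \<in> aspan M X"
  shows "x + y \<in> aspan M X"
proof -
  obtain S c where S: "finite S" "S \<subseteq> X" "\<And>f. f \<in> S \<Longrightarrow> c f \<in> A" "x = (\<Sum>f\<in>S. c f * M f)"
    using assms(1) by (rule aspanE) blast
  obtain S' c' where S': "finite S'" "S' \<subseteq> X" "\<And>f. f \<in> S' \<Longrightarrow> c' f \<in> A" "y = (\<Sum>f\<in>S'. c' f * M f)"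
    using assms(2) by (rule aspanE) blast
  define e where "e f = (if f \<in> S then c f else 0) + (if f \<in> S' then c' f else 0)" for f
  have "(\<Sum>f\<in>S \<union> S'. e f * M f) = (\<Sum>f\<in>S \<union> S'. (if f \<in> S then c f else 0) * M f) + (\<Sum>f\<in>S \<union> S'. (if f \<in> S' then c' f else 0) * M f)"
    by (simp add: e_def distrib_right sum.distrib)
  also have "(\<Sum>f\<in>S \<union> S'. (if f \<in> S then c f else 0) * M f) = x"
    unfolding S(4) using S(1) S'(1) by (intro sum.mono_neutral_cong_right) auto
  also have "(\<Sum>f\<in>S \<union> S'. (if f \<in> S' then c' f else 0) * M f) = y"
    unfolding S'(4) using S(1) S'(1) by (intro sum.mono_neutral_cong_right) auto
  finally have "x + y = (\<Sum>f\<in>S \<union> S'. e f * M f)" by simp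
  also have "\<dots> \<in> aspan M X"
    using S S' by (intro aspanI) (auto simp: e_def)
  finally show ?thesis .
qed

lemma aspan_sum: "(\<And>i. i \<in> I \<Longrightarrow> g i \<in> aspan M X) \<Longrightarrow> sum g I \<in> aspan M X"
  by (induction I rule: infinite_finite_induct) (auto intro: aspan_add)

lemma aspan_scale: "a \<in> A \<Longrightarrow> x \<in> aspan M X \<Longrightarrow> a * x \<in> aspan M X"
  by (elim aspanE) (auto simp: sum_distrib_left intro!: aspan_sum simp flip: mult.assoc intro: aspan_term)

lemma aspan_uminus: "x \<in> aspan M X \<Longrightarrow> - x \<in> aspan M X"
  using aspan_scale[of "-1" x M X] by simp

lemma aspan_diff: "x \<in> aspan M X \<Longrightarrow> y \<in> aspan M X \<Longrightarrow> x - y \<in> aspan M X"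
  using aspan_add[of x M X "- y"] aspan_uminus[of y M X] by simp

lemma aspan_subset:
  assumes "y \<in> aspan M X" "\<And>f. f \<in> X \<Longrightarrow> M f \<in> aspan M' X'"
  shows "y \<in> aspan M' X'"
  using assms(1) by (elim aspanE) (auto intro!: aspan_sum aspan_scale assms(2))

lemma aspan_mult_gen:
  assumes "x \<in> aspan M X" "y \<in> aspan M' Y" "\<And>f g. f \<in> X \<Longrightarrow> g \<in> Y \<Longrightarrow> M f * M' g \<in> aspan M'' Z"
  shows "x * y \<in> aspan M'' Z"
proof -
  obtain S c where S: "finite S" "S \<subseteq> X" "\<And>f. f \<in> S \<Longrightarrow> c f \<in> A" "x = (\<Sum>f\<in>S. c f * M f)"
    using assms(1) by (rule aspanE) blast
  obtain S' c' where S': "finite S'" "S' \<subseteq> Y" "\<And>f. f \<in> S' \<Longrightarrow> c' f \<in> A" "y = (\<Sum>f\<in>S'. c' f * M' f)"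
    using assms(2) by (rule aspanE) blast
  have "c f * M f * (c' g * M' g) \<in> aspan M'' Z" if "f \<in> S" "g \<in> S'" for f g
  proof -
    have "c f * M f * (c' g * M' g) = c f * (c' g * (M f * M' g))"
      using A_comm[OF S'(3)[OF that(2)], of "M f"] by (metis mult.assoc)
    moreover have "M f * M' g \<in> aspan M'' Z" using S(2) S'(2) that assms(3) by blast
    ultimately show ?thesis using S(3) S'(3) that by (simp add: aspan_scale)
  qed
  then show ?thesis
    unfolding S(4) S'(4) by (auto simp: sum_product intro!: aspan_sum)
qed

lemma aspan_union:
  assumes "y \<in> aspan M X"
  obtains y1 y2 where "y = y1 + y2" "y1 \<in> aspan M (X \<inter> {f. P f})" "y2 \<in> aspan M (X \<inter> {f. \<not> P f})"
proof -
  obtain S c where S: "finite S" "S \<subseteq> X" "\<And>f. f \<in> S \<Longrightarrow> c f \<in> A" "y = (\<Sum>f\<in>S. c f * M f)"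
    using assms(1) by (rule aspanE) blast
  have "y = (\<Sum>f\<in>S \<inter> {f. P f}. c f * M f) + (\<Sum>f\<in>S \<inter> - {f. P f}. c f * M f)"
    unfolding S(4) using sum.Int_Diff[OF S(1), of "\<lambda>f. c f * M f" "{f. P f}"] by (simp add: Diff_eq)
  moreover have "(\<Sum>f\<in>S \<inter> {f. P f}. c f * M f) \<in> aspan M (X \<inter> {f. P f})"
    using S by (intro aspanI) auto
  moreover have "(\<Sum>f\<in>S \<inter> - {f. P f}. c f * M f) \<in> aspan M (X \<inter> {f. \<not> P f})"
    using S by (intro aspanI) auto
  ultimately show thesis using that by blast
qed

definition free_on :: "((nat \<Rightarrow> int) \<Rightarrow> 'k) \<Rightarrow> (nat \<Rightarrow> int) set \<Rightarrow> bool" where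
  "free_on M X \<longleftrightarrow> (\<forall>S c. finite S \<longrightarrow> S \<subseteq> X \<longrightarrow> (\<forall>f\<in>S. c f \<in> A) \<longrightarrow> (\<Sum>f\<in>S. c f * M f) = 0 \<longrightarrow> (\<forall>f\<in>S. c f = 0))"

lemma free_onD: "free_on M X \<Longrightarrow> finite S \<Longrightarrow> S \<subseteq> X \<Longrightarrow> (\<And>f. f \<in> S \<Longrightarrow> c f \<in> A) \<Longrightarrow> (\<Sum>f\<in>S. c f * M f) = 0 \<Longrightarrow> f \<in> S \<Longrightarrow> c f = 0"
  unfolding free_on_def by blast

text \<open>Homogeneous components are compared through this: two expressions for one element are
  placed in spans over disjoint exponent sets, typically \<open>\<delta> f = E\<close> and
  \<open>\<delta> f \<noteq> E\<close>.\<close>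

lemma free_on_disjoint:
  assumes "free_on M X" "Y \<subseteq> X" "Z \<subseteq> X" "Y \<inter> Z = {}" "y \<in> aspan M Y" "y \<in> aspan M Z"
  shows "y = 0"
proof -
  obtain S c where S: "finite S" "S \<subseteq> Y" "\<And>f. f \<in> S \<Longrightarrow> c f \<in> A" "y = (\<Sum>f\<in>S. c f * M f)"
    using assms(5) by (rule aspanE) blast
  obtain S' c' where S': "finite S'" "S' \<subseteq> Z" "\<And>f. f \<in> S' \<Longrightarrow> c' f \<in> A" "y = (\<Sum>f\<in>S'. c' f * M f)"
    using assms(6) by (rule aspanE) blast
  define e where "e f = (if f \<in> S then c f else - c' f)" for f
  have disj: "S \<inter> S' = {}" using S(2) S'(2) assms(4) by blast
  have "(\<Sum>f\<in>S \<union> S'. e f * M f) = (\<Sum>f\<in>S. e f * M f) + (\<Sum>f\<in>S'. e f * M f)"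
    using S S' disj by (intro sum.union_disjoint) auto
  also have "(\<Sum>f\<in>S. e f * M f) = y" unfolding S(4) by (intro sum.cong) (auto simp: e_def)
  also have "(\<Sum>f\<in>S'. e f * M f) = - y" unfolding S'(4) sum_negf[symmetric]
    using disj by (intro sum.cong) (auto simp: e_def)
  finally have "(\<Sum>f\<in>S \<union> S'. e f * M f) = 0" by simp
  moreover have "e f \<in> A" if "f \<in> S \<union> S'" for f using that S(3) S'(3) by (auto simp: e_def)
  moreover have "S \<union> S' \<subseteq> X" using S(2) S'(2) assms(2,3) by blast
  ultimately have "e f = 0" if "f \<in> S" for f
    using free_onD[OF assms(1), of "S \<union> S'" e f] S(1) S'(1) that by blast
  then have "c f = 0" if "f \<in> S" for f using that by (auto simp: e_def dest: spec)
  then show ?thesis by (simp add: S(4))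
qed

text \<open>Multiplication rules alone, without the independence that \<open>frame\<close> adds, are
  needed for maps such as a mutated frame still under construction.\<close>

definition pframe :: "nat \<Rightarrow> ((nat \<Rightarrow> int) \<Rightarrow> (nat \<Rightarrow> int) \<Rightarrow> int) \<Rightarrow> ((nat \<Rightarrow> int) \<Rightarrow> 'k) \<Rightarrow> bool" where
  "pframe n L M \<longleftrightarrow> biadd L \<and> M 0 = 1 \<and> (\<forall>f\<in>Zvec n. \<forall>g\<in>Zvec n. M f * M g = qp (L f g) * M (f + g))"

definition frame :: "nat \<Rightarrow> ((nat \<Rightarrow> int) \<Rightarrow> (nat \<Rightarrow> int) \<Rightarrow> int) \<Rightarrow> ((nat \<Rightarrow> int) \<Rightarrow> 'k) \<Rightarrow> bool" where
  "frame n L M \<longleftrightarrow> pframe n L M \<and> (\<forall>f\<in>Zvec n. \<forall>g\<in>Zvec n. [L f g = - L g f] (mod int l)) \<and> free_on M (Zvec n)"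

lemma pframe_mult: "pframe n L M \<Longrightarrow> f \<in> Zvec n \<Longrightarrow> g \<in> Zvec n \<Longrightarrow> M f * M g = qp (L f g) * M (f + g)"
  by (simp add: pframe_def)

lemma pframe_0: "pframe n L M \<Longrightarrow> M 0 = 1"
  by (simp add: pframe_def)

lemma pframe_biadd: "pframe n L M \<Longrightarrow> biadd L"
  by (simp add: pframe_def)

lemma pframe_add: "pframe n L M \<Longrightarrow> f \<in> Zvec n \<Longrightarrow> g \<in> Zvec n \<Longrightarrow> M (f + g) = qp (- L f g) * (M f * M g)"
  by (simp add: pframe_mult qp_merge)

lemma pframe_uminus: 
  assumes "pframe n L M" "f \<in> Zvec n"
  shows "M (- f) * M f = qp (- L f f)" "M f * M (- f) = qp (- L f f)"
  using pframe_mult[OF assms(1), of "- f" f] pframe_mult[OF assms(1), of f "- f"] assms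
  by (simp_all add: pframe_0 biaddD[OF pframe_biadd[OF assms(1)]])

lemma pframe_nz: "pframe n L M \<Longrightarrow> f \<in> Zvec n \<Longrightarrow> M f \<noteq> 0"
  using pframe_uminus(2)[of n L M f] by (metis mult_zero_left qp_nz)

lemma pframe_uminus': 
  assumes "pframe n L M" "f \<in> Zvec n"
  shows "M (- f) = qp (- L f f) * inverse (M f)"
  using pframe_uminus(1)[OF assms] pframe_nz[OF assms]
  by (metis mult.assoc mult.right_neutral right_inverse)

text \<open>The correction exponent relating \<open>M (f + m e)\<close> to \<open>M f * M e ^ m\<close>; its value modulo
  \<open>l\<close> depends only on \<open>L f e\<close> and \<open>L e e\<close>.\<close>
definition corr :: "((nat \<Rightarrow> int) \<Rightarrow> (nat \<Rightarrow> int) \<Rightarrow> int) \<Rightarrow> (nat \<Rightarrow> int) \<Rightarrow> nat \<Rightarrow> int \<Rightarrow> int" where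
  "corr L f k m = - m * L f (uvec k) - m * (m - 1) div 2 * L (uvec k) (uvec k)"

lemma half_step: "(m + 1) * m div 2 = m * (m - 1) div 2 + m" for m :: int
proof -
  have "(m + 1) * m = m * (m - 1) + 2 * m" by (simp add: algebra_simps)
  then show ?thesis by simp
qed

lemma pframe_split:
  assumes "pframe n L M" "f \<in> Zvec n" "k < n"
  shows "M (f + svec (int m) k) = qp (corr L f k (int m)) * (M f * M (uvec k) ^ m)"
proof (induction m)
  case (Suc m)
  have "f + svec (int (Suc m)) k = (f + svec (int m) k) + uvec k"
    by (simp only: svec_Suc add.assoc)
  then have "M (f + svec (int (Suc m)) k) = qp (- L (f + svec (int m) k) (uvec k)) * (M (f + svec (int m) k) * M (uvec k))"
    using assms by (simp only: pframe_add Zvec_add Zvec_uvec Zvec_svec)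
  also have "\<dots> = qp (- L (f + svec (int m) k) (uvec k) + corr L f k (int m)) * (M f * M (uvec k) ^ Suc m)"
    by (simp add: Suc qp_simps power_commutes)
  also have "- L (f + svec (int m) k) (uvec k) + corr L f k (int m) = corr L f k (int (Suc m))"
    using half_step[of "int m"]
    by (simp add: corr_def biaddD[OF pframe_biadd[OF assms(1)]] biadd_svec[OF pframe_biadd[OF assms(1)]] algebra_simps)
  finally show ?case .
qed (simp add: corr_def)

lemma frame_pframe: "frame n L M \<Longrightarrow> pframe n L M"
  by (simp add: frame_def)

lemma frame_free: "frame n L M \<Longrightarrow> free_on M (Zvec n)"
  by (simp add: frame_def)

lemma frame_skew: "frame n L M \<Longrightarrow> f \<in> Zvec n \<Longrightarrow> g \<in> Zvec n \<Longrightarrow> [L f g = - L g f] (mod int l)"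
  by (simp add: frame_def)

text \<open>Skewness mod \<open>l\<close> turns the commutation factor
  \<open>qp (L f g - L g f)\<close> into \<open>qp (2 * L f g)\<close>.\<close>

lemma frame_comm:
  assumes "frame n L M" "f \<in> Zvec n" "g \<in> Zvec n"
  shows "M f * M g = qp (2 * L f g) * (M g * M f)"
proof -
  obtain k where "L f g = - L g f + int l * k"
    using frame_skew[OF assms] by (auto simp: cong_int_iff_ex)
  then have "[L f g = 2 * L f g + L g f] (mod int l)"
    unfolding cong_int_iff_ex by (intro exI[of _ "- k"]) simp
  then show ?thesis
    using assms by (simp add: pframe_mult[OF frame_pframe[OF assms(1)]] qp_merge add.commute[of g f] qp_cong)
qed

lemma qcomm_pow_left: "x * y = qp s * (y * x) \<Longrightarrow> x ^ m * y = qp (int m * s) * (y * x ^ m)"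
proof (induction m)
  case (Suc m)
  have "x ^ Suc m * y = x ^ m * (x * y)" by (simp add: mult.assoc power_Suc2 del: power_Suc)
  also have "\<dots> = qp s * (x ^ m * y * x)" using Suc.prems by (simp add: qp_simps)
  also have "\<dots> = qp s * (qp (int m * s) * (y * (x ^ m * x)))" using Suc by (simp add: mult.assoc)
  finally show ?case by (simp add: qp_merge algebra_simps power_commutes)
qed simp

lemma frame_pow_l_comm:
  assumes "frame n L M" "f \<in> Zvec n" "g \<in> Zvec n"
  shows "M f ^ l * M g = M g * M f ^ l"
  using qcomm_pow_left[OF frame_comm[OF assms], of l] by (simp add: qp_l)

lemma aspan_mult:
  assumes "pframe n L M" "x \<in> aspan M X" "y \<in> aspan M Y" "X \<subseteq> Zvec n" "Y \<subseteq> Zvec n"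
    "\<And>f g. f \<in> X \<Longrightarrow> g \<in> Y \<Longrightarrow> f + g \<in> Z"
  shows "x * y \<in> aspan M Z"
  using assms(2,3)
proof (rule aspan_mult_gen)
  fix f g assume "f \<in> X" "g \<in> Y"
  then show "M f * M g \<in> aspan M Z"
    using assms(4-6) by (subst pframe_mult[OF assms(1)]) (blast intro: aspan_qterm)+
qed

text \<open>The values on basis vectors and the form mod \<open>l\<close> determine a frame.
  Restricting to coordinates in \<open>I\<close> allows a seed to be compared with its mutation away
  from the mutated index.\<close>

lemma pframe_agree:
  assumes "pframe n L M" "pframe n L' M'" "I \<subseteq> {..<n}"
    and L: "\<And>f g. \<forall>i. i \<notin> I \<longrightarrow> f i = 0 \<Longrightarrow> \<forall>i. i \<notin> I \<longrightarrow> g i = 0 \<Longrightarrow> [L f g = L' f g] (mod int l)"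
    and M: "\<And>i. i \<in> I \<Longrightarrow> M (uvec i) = M' (uvec i)"
    and f: "\<forall>i. i \<notin> I \<longrightarrow> f i = 0"
  shows "M f = M' f"
proof -
  have fin: "finite I" using assms(3) finite_subset by blast
  have Z: "g \<in> Zvec n" if "\<forall>i. i \<notin> I \<longrightarrow> g i = 0" for g
    using that assms(3) by (fastforce simp: Zvec_def)
  show ?thesis using fin f
  proof (induction f rule: support_induct)
    case zero
    show ?case by (simp only: pframe_0[OF assms(1)] pframe_0[OF assms(2)])
  next
    case (add f g)
    have "qp (- L f g) = qp (- L' f g)"
      using L[OF add(1,2)] by (intro qp_cong) (simp only: cong_minus_minus_iff)
    then show ?case
      by (simp only: pframe_add[OF assms(1) Z[OF add(1)] Z[OF add(2)]] pframe_add[OF assms(2) Z[OF add(1)] Z[OF add(2)]] add(3,4))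
  next
    case (uminus f)
    have "qp (- L f f) = qp (- L' f f)"
      using L[OF uminus(1,1)] by (intro qp_cong) (simp only: cong_minus_minus_iff)
    then show ?case
      by (simp only: pframe_uminus'[OF assms(1) Z[OF uminus(1)]] pframe_uminus'[OF assms(2) Z[OF uminus(1)]] uminus(2))
  next
    case (gen i)
    then show ?case using M by simp
  qed
qed

end

section \<open>Seeds and their mutations\<close>

definition smul :: "int \<Rightarrow> (nat \<Rightarrow> int) \<Rightarrow> nat \<Rightarrow> int" where
  "smul c f = (\<lambda>i. c * f i)"

lemma smul_apply [simp]: "smul c f i = c * f i"
  by (simp add: smul_def)

lemma zlinear_smul:
  fixes \<phi> :: "(nat \<Rightarrow> int) \<Rightarrow> int"
  assumes "zlinear \<phi>"
  shows "\<phi> (smul c f) = c * \<phi> f"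
proof -
  have 1: "\<phi> (smul (int m) f) = int m * \<phi> f" for m
  proof (induction m)
    case 0
    have "smul 0 f = 0" by (auto simp: fun_eq_iff)
    then show ?case by (simp only: zlinearD(2)[OF assms] of_nat_0 mult_zero_left)
  next
    case (Suc m)
    have "smul (int (Suc m)) f = smul (int m) f + f" by (auto simp: fun_eq_iff algebra_simps)
    then show ?case by (simp only: Suc zlinearD(1)[OF assms]) (simp add: algebra_simps)
  qed
  show ?thesis
  proof (cases "c \<ge> 0")
    case True
    then show ?thesis using 1[of "nat c"] by simp
  next
    case False
    have "smul c f = - smul (- c) f" by (auto simp: fun_eq_iff)
    then show ?thesis using 1[of "nat (- c)"] False zlinearD(3)[OF assms, of "smul (- c) f"] by simp
  qed
qed

lemma biadd_smul:
  assumes "biadd L"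
  shows "L (smul c f) g = c * L f g" "L g (smul c f) = c * L g f"
proof -
  have "zlinear (\<lambda>f. L f g)" "zlinear (L g)"
    using assms by (simp_all add: zlinear_def biaddD)
  from this[THEN zlinear_smul, of c f] show "L (smul c f) g = c * L f g" "L g (smul c f) = c * L g f"
    by simp_all
qed

text \<open>For \<open>v = posp (- colv n B k)\<close> this is multiplication by the matrix
  \<open>mutE B k\<close>; \<open>v = posp (colv n B k)\<close> is the opposite sign choice.\<close>

definition reflect :: "(nat \<Rightarrow> int) \<Rightarrow> nat \<Rightarrow> (nat \<Rightarrow> int) \<Rightarrow> nat \<Rightarrow> int" where
  "reflect v k f = (\<lambda>i. (if i = k then - f i else f i) + f k * v i)"

lemma reflect_apply: "reflect v k f i = (if i = k then - f i else f i) + f k * v i"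
  by (simp add: reflect_def)

lemma reflect_add: "reflect v k (f + g) = reflect v k f + reflect v k g"
  by (auto simp: fun_eq_iff reflect_apply algebra_simps)

lemma reflect_0: "reflect v k 0 = 0"
  by (auto simp: fun_eq_iff reflect_apply)

lemma reflect_diff: "reflect v k (f - g) = reflect v k f - reflect v k g"
  by (auto simp: fun_eq_iff reflect_apply algebra_simps)

lemma reflect_uminus: "reflect v k (- f) = - reflect v k f"
  by (auto simp: fun_eq_iff reflect_apply algebra_simps)

lemma Zvec_reflect [simp]: "f \<in> Zvec n \<Longrightarrow> v \<in> Zvec n \<Longrightarrow> k < n \<Longrightarrow> reflect v k f \<in> Zvec n"
  by (simp add: Zvec_def reflect_apply)

lemma reflect_fix: "f k = 0 \<Longrightarrow> reflect v k f = f"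
  by (auto simp: fun_eq_iff reflect_apply)

lemma reflect_uvec: "reflect v k (uvec k) = - uvec k + v"
  by (auto simp: fun_eq_iff reflect_apply uvec_def)

lemma reflect_reflect: "v k = 0 \<Longrightarrow> reflect v k (reflect v k f) = f"
  by (auto simp: fun_eq_iff reflect_apply)

lemma biadd_reflect: "biadd L \<Longrightarrow> biadd (\<lambda>f g. L (reflect v k f) (reflect v k g))"
  unfolding biadd_def reflect_add by blast

text \<open>Hence the two exponents of an exchange binomial differ by the column
  \<open>b\<close>.\<close>

lemma posp_split: "posp b = posp (- b) + b"
  by (auto simp: fun_eq_iff posp_apply)

text \<open>\<open>d\<close> is fixed once for all seeds, since mutation preserves the
  symmetrizer.\<close>

locale cluster = central_scalars A q l for A :: "'k::division_ring set" and q and l +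
  fixes n :: nat and ex :: "nat set" and d :: "nat \<Rightarrow> int"
  assumes ex_sub: "ex \<subseteq> {..<n}" and d_pos: "j \<in> ex \<Longrightarrow> d j > 0"
begin

lemma ex_less [simp]: "k \<in> ex \<Longrightarrow> k < n"
  using ex_sub by auto

abbreviation col :: "(nat \<Rightarrow> nat \<Rightarrow> int) \<Rightarrow> nat \<Rightarrow> nat \<Rightarrow> int" where
  "col B k \<equiv> colv n B k"

definition dskew :: "(nat \<Rightarrow> nat \<Rightarrow> int) \<Rightarrow> bool" where
  "dskew B \<longleftrightarrow> (\<forall>i\<in>ex. \<forall>j\<in>ex. d i * B i j = - (d j * B j i))"

definition compat :: "((nat \<Rightarrow> int) \<Rightarrow> (nat \<Rightarrow> int) \<Rightarrow> int) \<Rightarrow> (nat \<Rightarrow> nat \<Rightarrow> int) \<Rightarrow> bool" where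
  "compat L B \<longleftrightarrow> (\<forall>j\<in>ex. \<forall>g\<in>Zvec n. [L (col B j) g = d j * g j] (mod int l))"

definition seed where
  "seed M L B \<longleftrightarrow> frame n L M \<and> dskew B \<and> compat L B"

text \<open>A relation and not a function, because the existence of \<open>M'\<close> is a theorem
  (\<open>mutates_exists\<close>). \<open>L'\<close> is an integer lift of a form mod
  \<open>l\<close>, hence prescribed only up to congruence; this freedom is what makes the relation
  symmetric.\<close>

definition mutates where
  "mutates k M L B M' L' B' \<longleftrightarrow> B' = mutB B k \<and>
    (\<forall>f\<in>Zvec n. \<forall>g\<in>Zvec n.
      [L' f g = L (reflect (posp (- col B k)) k f) (reflect (posp (- col B k)) k g)] (mod int l)) \<and>
    (\<forall>j<n. j \<noteq> k \<longrightarrow> M' (uvec j) = M (uvec j)) \<and>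
    M' (uvec k) = M (- uvec k + posp (col B k)) + M (- uvec k + posp (- col B k))"

lemma mutates_B: "mutates k M L B M' L' B' \<Longrightarrow> B' = mutB B k"
  unfolding mutates_def by blast

lemma mutates_cong:
  "mutates k M L B M' L' B' \<Longrightarrow> f \<in> Zvec n \<Longrightarrow> g \<in> Zvec n \<Longrightarrow>
    [L' f g = L (reflect (posp (- col B k)) k f) (reflect (posp (- col B k)) k g)] (mod int l)"
  unfolding mutates_def by blast

lemma mutates_other: "mutates k M L B M' L' B' \<Longrightarrow> j < n \<Longrightarrow> j \<noteq> k \<Longrightarrow> M' (uvec j) = M (uvec j)"
  unfolding mutates_def by blast

lemma mutates_exchange: "mutates k M L B M' L' B' \<Longrightarrow>
    M' (uvec k) = M (- uvec k + posp (col B k)) + M (- uvec k + posp (- col B k))"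
  unfolding mutates_def by blast

lemma dskewD: "dskew B \<Longrightarrow> i \<in> ex \<Longrightarrow> j \<in> ex \<Longrightarrow> d i * B i j = - (d j * B j i)"
  unfolding dskew_def by blast

lemma dskew_diag: 
  assumes "dskew B" "k \<in> ex"
  shows "B k k = 0"
proof -
  have "d k * B k k = 0" using dskewD[OF assms(1,2,2)] by linarith
  then show ?thesis using d_pos[OF assms(2)] by simp
qed

lemma dskew_pos_iff:
  assumes "dskew B" "i \<in> ex" "j \<in> ex"
  shows "B i j > 0 \<longleftrightarrow> B j i < 0"
proof -
  have "B i j > 0 \<longleftrightarrow> d i * B i j > 0" using d_pos[OF assms(2)] by (simp add: zero_less_mult_iff)
  also have "\<dots> \<longleftrightarrow> d j * B j i < 0" using dskewD[OF assms] by linarith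
  also have "\<dots> \<longleftrightarrow> B j i < 0" using d_pos[OF assms(3)] by (simp add: mult_less_0_iff)
  finally show ?thesis .
qed

lemma compatD: "compat L B \<Longrightarrow> j \<in> ex \<Longrightarrow> g \<in> Zvec n \<Longrightarrow> [L (col B j) g = d j * g j] (mod int l)"
  by (simp add: compat_def)

lemma seed_frame: "seed M L B \<Longrightarrow> frame n L M"
  and seed_dskew: "seed M L B \<Longrightarrow> dskew B"
  and seed_compat: "seed M L B \<Longrightarrow> compat L B"
  and seed_pframe: "seed M L B \<Longrightarrow> pframe n L M"
  and seed_biadd: "seed M L B \<Longrightarrow> biadd L"
  by (auto simp: seed_def frame_def pframe_def)

section \<open>Mutation of exchange matrices\<close>

lemma mutB_half: "(\<bar>x\<bar> * y + x * \<bar>y\<bar>) div 2 = x * max 0 y + max 0 (- x) * y"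
  "(\<bar>x\<bar> * y + x * \<bar>y\<bar>) div 2 = x * max 0 (- y) + max 0 x * y"
  "(- (\<bar>x\<bar> * y) - x * \<bar>y\<bar>) div 2 = - (x * max 0 y + max 0 (- x) * y)" for x y :: int
proof -
  \<comment> \<open>The numerator is even; its half can be written with either of the two sign
    choices, and both are used.\<close>
  have "- (\<bar>x\<bar> * y) - x * \<bar>y\<bar> = 2 * - (x * max 0 y + max 0 (- x) * y)"
    by (auto simp: abs_if max_def algebra_simps)
  then show "(- (\<bar>x\<bar> * y) - x * \<bar>y\<bar>) div 2 = - (x * max 0 y + max 0 (- x) * y)" by (simp only: nonzero_mult_div_cancel_left)
  have "\<bar>x\<bar> * y + x * \<bar>y\<bar> = 2 * (x * max 0 y + max 0 (- x) * y)"
    "\<bar>x\<bar> * y + x * \<bar>y\<bar> = 2 * (x * max 0 (- y) + max 0 x * y)"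
    by (auto simp: abs_if max_def algebra_simps)
  then show "(\<bar>x\<bar> * y + x * \<bar>y\<bar>) div 2 = x * max 0 y + max 0 (- x) * y"
    "(\<bar>x\<bar> * y + x * \<bar>y\<bar>) div 2 = x * max 0 (- y) + max 0 x * y" by simp_all
qed

lemma col_mutB_same: "dskew B \<Longrightarrow> k \<in> ex \<Longrightarrow> col (mutB B k) k = - col B k"
  using dskew_diag[of B k] by (auto simp: colv_def mutB_def fun_eq_iff)

text \<open>Matrix mutation as a reflection of columns. For each sign of \<open>B k j\<close> one of
  the two forms has correction coefficient 0; \<open>connected_leads\<close> picks that one.\<close>

lemma col_mutB:
  assumes "dskew B" "k \<in> ex" "j \<noteq> k"
  shows "col (mutB B k) j = reflect (posp (- col B k)) k (col B j + smul (max 0 (B k j)) (col B k))"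
    "col (mutB B k) j = reflect (posp (col B k)) k (col B j + smul (max 0 (- B k j)) (col B k))"
proof -
  have *: "col (mutB B k) j i = reflect (posp (- col B k)) k (col B j + smul (max 0 (B k j)) (col B k)) i \<and>
    col (mutB B k) j i = reflect (posp (col B k)) k (col B j + smul (max 0 (- B k j)) (col B k)) i" for i
  proof (cases "i < n \<and> i \<noteq> k")
    case True
    have "col (mutB B k) j i = B i j + (\<bar>B i k\<bar> * B k j + B i k * \<bar>B k j\<bar>) div 2"
      using True assms by (simp add: mutB_def)
    moreover have "max 0 (B k j) * B i k + B k j * max 0 (- B i k) = (\<bar>B i k\<bar> * B k j + B i k * \<bar>B k j\<bar>) div 2"
      "max 0 (- B k j) * B i k + B k j * max 0 (B i k) = (\<bar>B i k\<bar> * B k j + B i k * \<bar>B k j\<bar>) div 2"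
      using mutB_half(1)[of "B i k" "B k j"] mutB_half(2)[of "B i k" "B k j"] by (simp_all only: mult.commute add.commute)
    ultimately show ?thesis
      using True assms dskew_diag[OF assms(1,2)] by (simp add: reflect_apply posp_apply)
  next
    case False
    then consider "i \<ge> n" | "i = k" "i < n" by linarith
    then show ?thesis
    proof cases
      case 1
      then have "i \<noteq> k" "col (mutB B k) j i = 0" "col B j i = 0" "col B k i = 0"
        using ex_less[OF assms(2)] by (auto simp: colv_def)
      then show ?thesis by (simp add: reflect_apply posp_apply)
    next
      case 2
      then have "col (mutB B k) j i = - B k j" "col B j k = B k j" "col B k k = 0"
        using dskew_diag[OF assms(1,2)] by (simp_all add: mutB_def)
      then show ?thesis using 2 by (simp add: reflect_apply posp_apply)
    qed
  qed
  show "col (mutB B k) j = reflect (posp (- col B k)) k (col B j + smul (max 0 (B k j)) (col B k))"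
    by (rule ext) (rule *[THEN conjunct1])
  show "col (mutB B k) j = reflect (posp (col B k)) k (col B j + smul (max 0 (- B k j)) (col B k))"
    by (rule ext) (rule *[THEN conjunct2])
qed

lemma mutB_mutB:
  assumes "dskew B" "k \<in> ex"
  shows "mutB (mutB B k) k = B"
  using dskew_diag[OF assms] by (auto simp: mutB_def fun_eq_iff mutB_half(1,3))

lemma mult_max_zero: "a > 0 \<Longrightarrow> a * max 0 b = max 0 (a * b)" for a b :: int
  by (auto simp: max_def zero_le_mult_iff mult_le_0_iff)

lemma dskew_mutB:
  assumes B: "dskew B" "k \<in> ex"
  shows "dskew (mutB B k)"
  unfolding dskew_def
proof (intro ballI)
  fix i j assume ij: "i \<in> ex" "j \<in> ex"
  \<comment> \<open>Transposing an entry exchanges positive and negative parts, up to the positive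
    factors from \<open>d\<close>.\<close>
  have posn: "d i * max 0 (- B i k) = d k * max 0 (B k i)" "d j * max 0 (B j k) = d k * max 0 (- B k j)"
    using d_pos ij B(2) dskewD[OF B(1) ij(1) B(2)] dskewD[OF B(1) ij(2) B(2)]
    by (simp_all only: mult_max_zero mult_minus_right minus_minus)
  show "d i * mutB B k i j = - (d j * mutB B k j i)"
  proof (cases "i = k \<or> j = k")
    case True
    then have "mutB B k i j = - B i j" "mutB B k j i = - B j i" by (auto simp: mutB_def)
    then show ?thesis using dskewD[OF B(1) ij] by (simp only: mult_minus_right)
  next
    case False
    \<comment> \<open>Opposite sign choices for the two entries, so that \<open>posn\<close> makes
      the terms cancel in pairs.\<close>
    have "mutB B k i j = B i j + (B i k * max 0 (B k j) + max 0 (- B i k) * B k j)"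
      "mutB B k j i = B j i + (B j k * max 0 (- B k i) + max 0 (B j k) * B k i)"
      using False mutB_half(1)[of "B i k" "B k j"] mutB_half(2)[of "B j k" "B k i"] by (auto simp: mutB_def)
    then have "d i * mutB B k i j + d j * mutB B k j i
      = (d i * B i j + d j * B j i) + (d i * B i k) * max 0 (B k j) + (d i * max 0 (- B i k)) * B k j
        + (d j * B j k) * max 0 (- B k i) + (d j * max 0 (B j k)) * B k i"
      by (simp add: algebra_simps)
    also have "\<dots> = (- (d j * B j i) + d j * B j i) + - (d k * B k i) * max 0 (B k j) + (d k * max 0 (B k i)) * B k j
        + - (d k * B k j) * max 0 (- B k i) + (d k * max 0 (- B k j)) * B k i"
      by (simp only: dskewD[OF B(1) ij] dskewD[OF B(1) ij(1) B(2)] dskewD[OF B(1) ij(2) B(2)] posn)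
    also have "\<dots> = 0" by (auto simp: max_def algebra_simps)
    finally show ?thesis by simp
  qed
qed

text \<open>By compatibility the column pairs with \<open>g\<close> to \<open>d k * g k\<close> mod
  \<open>l\<close>, and so with itself to 0, as \<open>B k k = 0\<close>. Expanding the form leaves
  only the two displayed corrections.\<close>

lemma shift_col:
  assumes "frame n L M" "dskew B" "compat L B" "k \<in> ex" "f \<in> Zvec n" "g \<in> Zvec n"
  shows "[L (f + smul c (col B k)) (g + smul c' (col B k)) = L f g + c * d k * g k - c' * d k * f k] (mod int l)"
proof -
  let ?b = "col B k"
  note bi = pframe_biadd[OF frame_pframe[OF assms(1)]]
  obtain u where u: "L ?b g = d k * g k + int l * u"
    using compatD[OF assms(3,4,6)] unfolding cong_int_iff_ex by blast
  obtain v where v: "L ?b f = d k * f k + int l * v"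
    using compatD[OF assms(3,4,5)] unfolding cong_int_iff_ex by blast
  obtain w where w: "L f ?b = - L ?b f + int l * w"
    using frame_skew[OF assms(1) assms(5) Zvec_colv[of n B k]] unfolding cong_int_iff_ex by blast
  have "?b k = 0" using dskew_diag[OF assms(2,4)] assms(4) by simp
  then obtain x where x: "L ?b ?b = int l * x"
    using compatD[OF assms(3,4) Zvec_colv[of n B k]] unfolding cong_int_iff_ex by (metis add_0 mult_zero_right)
  show ?thesis
    unfolding cong_int_iff_ex
    by (rule exI[of _ "c * u - c' * v + c' * w + c * c' * x"])
      (simp only: biaddD[OF bi] biadd_smul[OF bi] u v w x, simp add: algebra_simps)
qed

lemma reflect_shift: "reflect (posp (col B k)) k f = reflect (posp (- col B k)) k f + smul (f k) (col B k)"
proof -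
  have "posp (col B k) = posp (- col B k) + col B k" by (rule posp_split)
  then have "posp (col B k) i = posp (- col B k) i + col B k i" for i
    by (metis plus_fun_apply)
  then show ?thesis by (simp add: fun_eq_iff reflect_apply algebra_simps)
qed

lemma reflect_col_coord: "dskew B \<Longrightarrow> k \<in> ex \<Longrightarrow> reflect (posp (- col B k)) k f k = - f k"
  "dskew B \<Longrightarrow> k \<in> ex \<Longrightarrow> reflect (posp (col B k)) k f k = - f k"
  using dskew_diag[of B k] by (simp_all add: reflect_apply posp_apply)

text \<open>Both sign choices give the same form: the reflections differ by multiples of the column,
  and since each reflection negates coordinate \<open>k\<close> the two corrections in
  \<open>shift_col\<close> cancel.\<close>

lemma mutates_cong':
  assumes "seed M L B" "k \<in> ex" "mutates k M L B M' L' B'" "f \<in> Zvec n" "g \<in> Zvec n"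
  shows "[L' f g = L (reflect (posp (col B k)) k f) (reflect (posp (col B k)) k g)] (mod int l)"
proof -
  have "[L (reflect (posp (col B k)) k f) (reflect (posp (col B k)) k g) = L (reflect (posp (- col B k)) k f) (reflect (posp (- col B k)) k g)] (mod int l)"
    unfolding reflect_shift
    using shift_col[OF seed_frame[OF assms(1)] seed_dskew[OF assms(1)] seed_compat[OF assms(1)] assms(2),
        of "reflect (posp (- col B k)) k f" "reflect (posp (- col B k)) k g" "f k" "g k"] assms
    by (simp add: reflect_col_coord[OF seed_dskew[OF assms(1)] assms(2)])
  then show ?thesis using mutates_cong[OF assms(3-5)] by (meson cong_sym cong_trans)
qed

lemma compat_mutates:
  assumes S: "seed M L B" and k: "k \<in> ex" and m: "mutates k M L B M' L' B'"
  shows "compat L' B'"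
  unfolding compat_def
proof (intro ballI)
  fix j g assume j: "j \<in> ex" and g: "g \<in> Zvec n"
  let ?v = "posp (- col B k)"
  note ds = seed_dskew[OF S] and dg = dskew_diag[OF seed_dskew[OF S] k] and bi = seed_biadd[OF S]
  have B': "B' = mutB B k" using m by (rule mutates_B)
  have v: "?v k = 0" using dg k by (simp add: posp_apply)
  have cg: "[L' (col B' j) g = L (reflect ?v k (col B' j)) (reflect ?v k g)] (mod int l)"
    by (rule mutates_cong[OF m]) (use g in auto)
  show "[L' (col B' j) g = d j * g j] (mod int l)"
  proof (cases "j = k")
    case True
    have "reflect ?v k (col B' j) = - col B k"
      using True B' ds dg k by (simp add: col_mutB_same reflect_uminus reflect_fix)
    moreover have "[L (- col B k) (reflect ?v k g) = - (d k * reflect ?v k g k)] (mod int l)"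
      using compatD[OF seed_compat[OF S] k, of "reflect ?v k g"] g k
      by (simp only: biaddD[OF bi] cong_minus_minus_iff ex_less Zvec_reflect Zvec_posp Zvec_uminus Zvec_colv)
    ultimately show ?thesis
      using cg True cong_trans by (fastforce simp: reflect_col_coord[OF ds k])
  next
    case False
    have 1: "reflect ?v k (col B' j) = col B j + smul (max 0 (B k j)) (col B k)"
      using col_mutB(1)[OF ds k False] B' reflect_reflect[of ?v k] v by simp
    have 2: "[L (col B j + smul (max 0 (B k j)) (col B k)) (reflect ?v k g + smul 0 (col B k))
        = L (col B j) (reflect ?v k g) + max 0 (B k j) * d k * reflect ?v k g k - 0 * d k * col B j k] (mod int l)"
      using shift_col[OF seed_frame[OF S] ds seed_compat[OF S] k, of "col B j" "reflect ?v k g" "max 0 (B k j)" 0] g k by simp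
    have 3: "reflect ?v k g + smul 0 (col B k) = reflect ?v k g"
      by (auto simp: fun_eq_iff)
    have 4: "[L (col B j) (reflect ?v k g) = d j * reflect ?v k g j] (mod int l)"
      using compatD[OF seed_compat[OF S] j] g k by simp
    \<comment> \<open>Reflecting \<open>g\<close> adds a multiple of \<open>g k\<close> to
      coordinate \<open>j\<close>; it cancels the correction term because
      \<open>d j * max 0 (- B j k) = d k * max 0 (B k j)\<close>.\<close>
    have 5: "d j * reflect ?v k g j + max 0 (B k j) * d k * reflect ?v k g k = d j * g j"
    proof -
      have "d j * max 0 (- B j k) = d k * max 0 (B k j)"
      proof -
        have "d j * max 0 (- B j k) = max 0 (d j * - B j k)" "d k * max 0 (B k j) = max 0 (d k * B k j)"
          using d_pos j k by (simp_all only: mult_max_zero)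
        then show ?thesis using dskewD[OF ds j k] by (simp only: mult_minus_right minus_minus)
      qed
      then show ?thesis using False j ds k
        by (simp add: reflect_col_coord[OF ds k]) (simp add: reflect_apply posp_apply algebra_simps)
    qed
    have "[L (reflect ?v k (col B' j)) (reflect ?v k g)
        = L (col B j) (reflect ?v k g) + max 0 (B k j) * d k * reflect ?v k g k] (mod int l)"
      using 2 by (simp only: 1 3 mult_zero_left diff_zero)
    then have "[L (reflect ?v k (col B' j)) (reflect ?v k g) = d j * g j] (mod int l)"
      using cong_add[OF 4 cong_refl, of "max 0 (B k j) * d k * reflect ?v k g k"] 
      unfolding 5 by (rule cong_trans)
    with cg show ?thesis by (rule cong_trans)
  qed
qed

lemma seed_mutates:
  assumes "seed M L B" "k \<in> ex" "mutates k M L B M' L' B'" "frame n L' M'"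
  shows "seed M' L' B'"
  using assms compat_mutates[OF assms(1-3)] dskew_mutB[of B k] mutates_B[OF assms(3)]
  unfolding seed_def by blast

lemma mutates_agree:
  assumes S: "seed M L B" and k: "k \<in> ex" and m: "mutates k M L B M' L' B'" and F: "pframe n L' M'"
    and f: "f \<in> Zvec n" "f k = 0"
  shows "M' f = M f"
proof (rule pframe_agree[OF F seed_pframe[OF S], of "{..<n} - {k}"])
  fix f g :: "nat \<Rightarrow> int"
  assume fg: "\<forall>i. i \<notin> {..<n} - {k} \<longrightarrow> f i = 0" "\<forall>i. i \<notin> {..<n} - {k} \<longrightarrow> g i = 0"
  then have "f \<in> Zvec n" "g \<in> Zvec n" "f k = 0" "g k = 0" by (auto simp: Zvec_def)
  then show "[L' f g = L f g] (mod int l)"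
    using mutates_cong[OF m, of f g] by (simp add: reflect_fix)
next
  show "\<forall>i. i \<notin> {..<n} - {k} \<longrightarrow> f i = 0" using f by (auto simp: Zvec_def)
qed (use mutates_other[OF m] in auto)

text \<open>Since the column changes sign, the way back uses the opposite reflection. The two
  compose to \<open>f + smul (f k) b\<close>, which leaves the form unchanged mod \<open>l\<close>
  by \<open>shift_col\<close>. The exchange relation is inverted by multiplying with the new
  variable on the left and cancelling it.\<close>

lemma mutates_sym:
  assumes S: "seed M L B" and k: "k \<in> ex" and m: "mutates k M L B M' L' B'" and S': "seed M' L' B'"
  shows "mutates k M' L' B' M L B"
proof -
  let ?b = "col B k" let ?e = "uvec k" let ?p = "posp ?b" let ?n = "posp (- ?b)"
  note ds = seed_dskew[OF S] and dg = dskew_diag[OF seed_dskew[OF S] k] and bi = seed_biadd[OF S] and pf = seed_pframe[OF S] and pf' = seed_pframe[OF S']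
  have B': "B' = mutB B k" using m by (rule mutates_B)
  have cb: "col B' k = - ?b" using B' ds k col_mutB_same by simp
  have zk: "?p k = 0" "?n k = 0" "?b k = 0" using dg k by (simp_all add: posp_apply)
  have Z: "?b \<in> Zvec n" "?e \<in> Zvec n" "?p \<in> Zvec n" "?n \<in> Zvec n" using k by auto
  have pn: "?p = ?n + ?b" by (rule posp_split)
  have 1: "[L f g = L' (reflect (posp (- col B' k)) k f) (reflect (posp (- col B' k)) k g)] (mod int l)"
    if fg: "f \<in> Zvec n" "g \<in> Zvec n" for f g
  proof -
    have rr: "reflect ?n k (reflect ?p k f) = f + smul (f k) ?b" for f
      unfolding pn using zk by (auto simp: fun_eq_iff reflect_apply algebra_simps)
    have "[L' (reflect ?p k f) (reflect ?p k g) = L (f + smul (f k) ?b) (g + smul (g k) ?b)] (mod int l)"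
      using mutates_cong[OF m, of "reflect ?p k f" "reflect ?p k g"] fg Z k by (simp add: rr)
    moreover have "[L (f + smul (f k) ?b) (g + smul (g k) ?b) = L f g] (mod int l)"
      using shift_col[OF seed_frame[OF S] ds seed_compat[OF S] k fg, of "f k" "g k"] by simp
    ultimately show ?thesis by (simp add: cb) (meson cong_sym cong_trans)
  qed
  have 2: "M ?e = M' (- ?e + posp (col B' k)) + M' (- ?e + posp (- col B' k))"
  proof -
    let ?x = "M' ?e"
    have L'e: "[L' ?e (- ?e + w) = L (- ?e + ?n) (?e - ?n + w)] (mod int l)" if "w \<in> Zvec n" "w k = 0" for w
      using mutates_cong[OF m, of ?e "- ?e + w"] that Z
      by (simp add: reflect_uvec reflect_add reflect_diff reflect_uminus reflect_fix algebra_simps)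
    have x: "?x = M (- ?e + ?p) + M (- ?e + ?n)" using m by (rule mutates_exchange)
    have Mp: "M' w = M w" if "w \<in> Zvec n" "w k = 0" for w
      using mutates_agree[OF S k m pf'] that by simp
    have L: "?x * M' (- ?e + w) = qp (L (- ?e + ?n) (?e - ?n + w)) * M w" if "w \<in> Zvec n" "w k = 0" for w
    proof -
      have "?x * M' (- ?e + w) = qp (L' ?e (- ?e + w)) * M' w"
        using pframe_mult[OF pf', of ?e "- ?e + w"] that Z by simp
      then show ?thesis using qp_cong[OF L'e[OF that]] Mp[OF that] by simp
    qed
    \<comment> \<open>Both sides are \<open>d k\<close> mod \<open>l\<close>. This adjusts the power
      of \<open>q\<close> at \<open>M ?p\<close>, so that both terms acquire the common right factor
      \<open>M ?e\<close>.\<close>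
    have bb: "[L (- ?e + ?n) ?b = L (- ?e + ?p) ?e - L (- ?e + ?n) ?e] (mod int l)"
    proof -
      have 1: "[L (- ?e + ?n) ?b = - L ?b (- ?e + ?n)] (mod int l)"
        using frame_skew[OF seed_frame[OF S], of "- ?e + ?n" ?b] Z by simp
      have 2: "[L ?b (- ?e + ?n) = - d k] (mod int l)"
        using compatD[OF seed_compat[OF S] k, of "- ?e + ?n"] Z zk by simp
      have 3: "[L ?b ?e = d k] (mod int l)"
        using compatD[OF seed_compat[OF S] k Z(2)] by simp
      have 4: "L (- ?e + ?p) ?e - L (- ?e + ?n) ?e = L ?b ?e"
        using pn by (simp add: biaddD[OF bi])
      have "[- L ?b (- ?e + ?n) = d k] (mod int l)"
        using 2 cong_minus_minus_iff[of "L ?b (- ?e + ?n)" "- d k"] by simp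
      then show ?thesis using cong_trans[OF 1] cong_sym[OF 3] cong_trans unfolding 4 by blast
    qed
    have "?x * (M' (- ?e + ?p) + M' (- ?e + ?n)) = qp (L (- ?e + ?n) (?e - ?n + ?p)) * M ?p + qp (L (- ?e + ?n) (?e - ?n + ?n)) * M ?n"
      using L Z zk by (simp only: distrib_left)
    also have "qp (L (- ?e + ?n) (?e - ?n + ?n)) = qp (L (- ?e + ?n) ?e)" by simp
    also have "qp (L (- ?e + ?n) (?e - ?n + ?p)) = qp (L (- ?e + ?p) ?e)"
    proof (rule qp_cong)
      have "?e - ?n + ?p = ?e + ?b" using pn by (simp add: algebra_simps)
      then have "L (- ?e + ?n) (?e - ?n + ?p) = L (- ?e + ?n) ?e + L (- ?e + ?n) ?b"
        by (simp only: biaddD(2)[OF bi])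
      then show "[L (- ?e + ?n) (?e - ?n + ?p) = L (- ?e + ?p) ?e] (mod int l)"
        using cong_add[OF cong_refl bb, of "L (- ?e + ?n) ?e"] by simp
    qed
    also have "qp (L (- ?e + ?p) ?e) * M ?p = M (- ?e + ?p) * M ?e"
      using pframe_mult[OF pf, of "- ?e + ?p" ?e] Z by simp
    also have "qp (L (- ?e + ?n) ?e) * M ?n = M (- ?e + ?n) * M ?e"
      using pframe_mult[OF pf, of "- ?e + ?n" ?e] Z by simp
    finally have "?x * (M' (- ?e + ?p) + M' (- ?e + ?n)) = ?x * M ?e"
      by (simp only: x distrib_right)
    moreover have "?x \<noteq> 0" using pframe_nz[OF pf' Z(2)] .
    ultimately show ?thesis by (simp add: cb add.commute)
  qed
  show ?thesis
    unfolding mutates_def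
    using 1 2 mutates_other[OF m] mutB_mutB[OF ds k] B' by metis
qed

end

section \<open>Divisibility in quantum tori\<close>

context central_scalars
begin

lemma aspan_empty: "y \<in> aspan M {} \<Longrightarrow> y = 0"
  by (auto simp: aspan_def)

lemma aspan_bound:
  fixes \<phi> :: "(nat \<Rightarrow> int) \<Rightarrow> int"
  assumes "y \<in> aspan M X"
  obtains K :: nat where "y \<in> aspan M {f\<in>X. \<bar>\<phi> f\<bar> \<le> int K}"
proof -
  obtain S c where S: "finite S" "S \<subseteq> X" "\<And>f. f \<in> S \<Longrightarrow> c f \<in> A" "y = (\<Sum>f\<in>S. c f * M f)"
    using assms(1) by (rule aspanE) blast
  define K where "K = nat (\<Sum>f\<in>S. \<bar>\<phi> f\<bar>)"
  have K: "\<bar>\<phi> f\<bar> \<le> int K" if "f \<in> S" for f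
    using member_le_sum[OF that, of "\<lambda>f. \<bar>\<phi> f\<bar>"] S(1) by (simp add: K_def sum_nonneg)
  have "y \<in> aspan M {f\<in>X. \<bar>\<phi> f\<bar> \<le> int K}"
    unfolding S(4) by (rule aspanI) (use S K in blast)+
  then show thesis by (rule that)
qed

lemma aspan_split:
  assumes "y \<in> aspan M {f\<in>X. P f}"
    and "\<And>f. f \<in> X \<Longrightarrow> P f \<Longrightarrow> Q f \<or> R f"
  obtains y1 y2 where "y = y1 + y2" "y1 \<in> aspan M {f\<in>X. Q f}" "y2 \<in> aspan M {f\<in>X. R f}"
proof -
  obtain y1 y2 where y: "y = y1 + y2" "y1 \<in> aspan M ({f\<in>X. P f} \<inter> {f. Q f})" "y2 \<in> aspan M ({f\<in>X. P f} \<inter> {f. \<not> Q f})"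
    using assms(1) by (rule aspan_union)
  have "y1 \<in> aspan M {f\<in>X. Q f}" by (rule aspan_mono[OF _ y(2)]) blast
  moreover have "y2 \<in> aspan M {f\<in>X. R f}" by (rule aspan_mono[OF _ y(3)]) (use assms(2) in blast)
  ultimately show thesis using that y(1) by blast
qed

lemma aspan_filter_mono:
  "y \<in> aspan M {f\<in>X. P f} \<Longrightarrow> (\<And>f. f \<in> X \<Longrightarrow> P f \<Longrightarrow> Q f) \<Longrightarrow> y \<in> aspan M {f\<in>X. Q f}"
  by (erule aspan_mono[rotated]) blast

lemma aspan_filter_all: "y \<in> aspan M {f\<in>X. P f} \<Longrightarrow> y \<in> aspan M X"
  by (erule aspan_mono[rotated]) blast

lemma aspan_filter_mult:
  assumes "pframe n L M" "x \<in> aspan M {f\<in>Zvec n. P f}" "y \<in> aspan M {f\<in>Zvec n. Q f}"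
    "\<And>f g. f \<in> Zvec n \<Longrightarrow> g \<in> Zvec n \<Longrightarrow> P f \<Longrightarrow> Q g \<Longrightarrow> R (f + g)"
  shows "x * y \<in> aspan M {f\<in>Zvec n. R f}"
  by (rule aspan_mult[OF assms(1-3)]) (use assms(4) in auto)

lemma aspan_all_mult:
  assumes "pframe n L M" "x \<in> aspan M (Zvec n)" "y \<in> aspan M (Zvec n)"
  shows "x * y \<in> aspan M (Zvec n)"
  by (rule aspan_mult[OF assms]) auto

lemma aspan_pow:
  assumes "pframe n L M" "x \<in> aspan M {f\<in>Zvec n. P f}"
    and "Q 0 0" "\<And>f g m. f \<in> Zvec n \<Longrightarrow> g \<in> Zvec n \<Longrightarrow> P f \<Longrightarrow> Q m g \<Longrightarrow> Q (Suc m) (f + g)"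
  shows "x ^ m \<in> aspan M {f\<in>Zvec n. Q m f}"
proof (induction m)
  case 0
  have "M 0 \<in> aspan M {f\<in>Zvec n. Q 0 f}" by (intro aspan_base CollectI conjI Zvec_zero assms(3))
  then show ?case using pframe_0[OF assms(1)] by simp
next
  case (Suc m)
  have "x * x ^ m \<in> aspan M {f\<in>Zvec n. Q (Suc m) f}"
    by (rule aspan_filter_mult[OF assms(1,2) Suc]) (use assms(4) in blast)
  then show ?case by simp
qed

lemma aspan_all_pow:
  assumes "pframe n L M" "x \<in> aspan M (Zvec n)"
  shows "x ^ m \<in> aspan M (Zvec n)"
  using aspan_pow[OF assms(1), of x "\<lambda>_. True" "\<lambda>_ _. True" m] assms(2) by simp

text \<open>A substitute for the binomial expansion without commutativity: only the lowest component
  \<open>\<beta> ^ m\<close> is identified, and the rest has positive degree.\<close>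

lemma aspan_pow_diff:
  assumes F: "pframe n L M" and \<delta>: "zlinear \<delta>"
    and \<beta>: "\<beta> \<in> aspan M {f\<in>Zvec n. \<delta> f = 0}" and r: "r \<in> aspan M {f\<in>Zvec n. \<delta> f > 0}"
  shows "(\<beta> + r) ^ m - \<beta> ^ m \<in> aspan M {f\<in>Zvec n. \<delta> f > 0}"
proof (induction m)
  case (Suc m)
  have \<beta>m: "\<beta> ^ m \<in> aspan M {f\<in>Zvec n. \<delta> f = 0}"
    by (rule aspan_pow[OF F \<beta>, of "\<lambda>_ f. \<delta> f = 0"]) (simp_all add: zlinearD[OF \<delta>])
  have "\<beta> + r \<in> aspan M {f\<in>Zvec n. \<delta> f \<ge> 0}"
    using \<beta> r by (intro aspan_add) (erule aspan_filter_mono, simp)+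
  from aspan_filter_mult[OF F Suc this]
  have "((\<beta> + r) ^ m - \<beta> ^ m) * (\<beta> + r) \<in> aspan M {f\<in>Zvec n. \<delta> f > 0}"
    by (simp add: zlinearD[OF \<delta>])
  moreover have "\<beta> ^ m * r \<in> aspan M {f\<in>Zvec n. \<delta> f > 0}"
    by (rule aspan_filter_mult[OF F \<beta>m r]) (simp add: zlinearD[OF \<delta>])
  moreover have "(\<beta> + r) ^ Suc m - \<beta> ^ Suc m = ((\<beta> + r) ^ m - \<beta> ^ m) * (\<beta> + r) + \<beta> ^ m * r"
    by (simp add: power_Suc2 algebra_simps del: power_Suc)
  ultimately show ?case by (simp only: aspan_add)
qed simp

text \<open>Converts membership in a span into a condition on the exponents that really occur, so
  that conditions from several spans can be intersected.\<close>

lemma aspan_support: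
  assumes fr: "free_on M X" and S: "finite S" "S \<subseteq> X" "\<And>f. f \<in> S \<Longrightarrow> c f \<in> A" "\<And>f. f \<in> S \<Longrightarrow> c f \<noteq> 0"
    and y: "(\<Sum>f\<in>S. c f * M f) \<in> aspan M Y" and Y: "Y \<subseteq> X"
  shows "S \<subseteq> Y"
proof -
  let ?y = "\<Sum>f\<in>S. c f * M f"
  have e: "?y = (\<Sum>f\<in>S \<inter> Y. c f * M f) + (\<Sum>f\<in>S - Y. c f * M f)"
    using sum.Int_Diff[OF S(1)] by simp
  have "(\<Sum>f\<in>S \<inter> Y. c f * M f) \<in> aspan M Y" by (rule aspanI) (use S in auto)
  from aspan_diff[OF y this] have 1: "(\<Sum>f\<in>S - Y. c f * M f) \<in> aspan M Y"
    unfolding e by simp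
  have 2: "(\<Sum>f\<in>S - Y. c f * M f) \<in> aspan M (S - Y)" by (rule aspanI) (use S in auto)
  have 3: "(\<Sum>f\<in>S - Y. c f * M f) = 0"
    by (rule free_on_disjoint[OF fr _ _ _ 1 2]) (use S Y in auto)
  have "c f = 0" if "f \<in> S - Y" for f
    by (rule free_onD[OF fr _ _ _ 3 that]) (use S in auto)
  then show ?thesis using S(4) by blast
qed

lemma aspan_reduced:
  assumes "y \<in> aspan M X"
  obtains S c where "finite S" "S \<subseteq> X" "\<And>f. f \<in> S \<Longrightarrow> c f \<in> A" "\<And>f. f \<in> S \<Longrightarrow> c f \<noteq> 0" "y = (\<Sum>f\<in>S. c f * M f)"
proof -
  obtain S c where S: "finite S" "S \<subseteq> X" "\<And>f. f \<in> S \<Longrightarrow> c f \<in> A" "y = (\<Sum>f\<in>S. c f * M f)"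
    using assms(1) by (rule aspanE) blast
  have "(\<Sum>f\<in>S. c f * M f) = (\<Sum>f\<in>{f\<in>S. c f \<noteq> 0}. c f * M f)"
    using S(1) by (intro sum.mono_neutral_right) auto
  then have y: "y = (\<Sum>f\<in>{f\<in>S. c f \<noteq> 0}. c f * M f)" by (simp only: S(4))
  have S': "finite {f\<in>S. c f \<noteq> 0}" "{f\<in>S. c f \<noteq> 0} \<subseteq> X" using S(1,2) by auto
  show thesis by (rule that[OF S' _ _ y]) (use S(3) in blast)+
qed

text \<open>\<open>u\<close> is homogeneous for \<open>\<delta>\<close> and the leading term of \<open>x\<close> is a unit, so \<open>u\<close>-divisibility can
  be peeled off one homogeneous component at a time.\<close>
lemma regular_step:
  assumes F: "frame n L M" and ad: "zlinear \<delta>"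
    and u: "u \<in> aspan M {f\<in>Zvec n. \<delta> f = e}" and h: "h \<in> Zvec n"
    and x': "x - qp s * M h \<in> aspan M {f\<in>Zvec n. \<delta> f < \<delta> h}"
  shows "a \<in> aspan M {f\<in>Zvec n. D \<le> \<delta> f \<and> \<delta> f < D + int k} \<Longrightarrow> t \<in> aspan M (Zvec n) \<Longrightarrow>
    a * x = u * t \<Longrightarrow> \<exists>t'\<in>aspan M (Zvec n). a = u * t'"
proof (induction k arbitrary: a t)
  case 0
  have "a \<in> aspan M {f\<in>Zvec n. False}" by (rule aspan_filter_mono[OF 0(1)]) auto
  then have "a = 0" using aspan_empty by simp
  then show ?case by (intro bexI[of _ 0]) simp_all
next
  case (Suc k)
  note pf = frame_pframe[OF F] and fr = frame_free[OF F]
  obtain a1 a0 where a: "a = a1 + a0" "a1 \<in> aspan M {f\<in>Zvec n. \<delta> f = D + int k}"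
      "a0 \<in> aspan M {f\<in>Zvec n. D \<le> \<delta> f \<and> \<delta> f < D + int k}"
    by (rule aspan_split[OF Suc.prems(1), of "\<lambda>f. \<delta> f = D + int k" "\<lambda>f. D \<le> \<delta> f \<and> \<delta> f < D + int k"]) auto
  \<comment> \<open>\<open>E\<close> is the highest degree that can occur in \<open>a * x\<close>.
    As \<open>u\<close> has degree \<open>e\<close>, the matching part of \<open>t\<close> has
    degree \<open>E - e\<close>.\<close>
  define E where "E = D + int k + \<delta> h"
  have "t \<in> aspan M {f\<in>Zvec n. True}" using Suc.prems(2) by simp
  then obtain t1 t0 where t: "t = t1 + t0" "t1 \<in> aspan M {f\<in>Zvec n. \<delta> f = E - e}" "t0 \<in> aspan M {f\<in>Zvec n. \<delta> f \<noteq> E - e}"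
    by (rule aspan_split[of t M "Zvec n" "\<lambda>_. True" "\<lambda>f. \<delta> f = E - e" "\<lambda>f. \<delta> f \<noteq> E - e"]) auto
  define x' where "x' = x - qp s * M h"
  have x: "x = qp s * M h + x'" by (simp add: x'_def)
  have x'in: "x' \<in> aspan M {f\<in>Zvec n. \<delta> f < \<delta> h}" using x' by (simp add: x'_def)
  have Mh: "qp s * M h \<in> aspan M {f\<in>Zvec n. \<delta> f = \<delta> h}" using h by (intro aspan_qterm) simp
  have xin: "x \<in> aspan M {f\<in>Zvec n. \<delta> f \<le> \<delta> h}"
    unfolding x using Mh x'in by (intro aspan_add) (erule aspan_filter_mono, simp)+
  have 1: "a1 * (qp s * M h) - u * t1 = u * t0 - (a1 * x' + a0 * x)"
    using Suc.prems(3) unfolding a(1) t(1) x by (simp add: algebra_simps)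
  have 2: "a1 * (qp s * M h) - u * t1 \<in> aspan M {f\<in>Zvec n. \<delta> f = E}"
    by (rule aspan_diff[OF aspan_filter_mult[OF pf a(2) Mh] aspan_filter_mult[OF pf u t(2)]])
      (simp_all add: E_def zlinearD[OF ad])
  have "a1 * x' \<in> aspan M {f\<in>Zvec n. \<delta> f \<noteq> E}"
    by (rule aspan_filter_mult[OF pf a(2) x'in]) (simp add: E_def zlinearD[OF ad])
  moreover have "a0 * x \<in> aspan M {f\<in>Zvec n. \<delta> f \<noteq> E}"
    by (rule aspan_filter_mult[OF pf a(3) xin]) (simp add: E_def zlinearD[OF ad])
  moreover have "u * t0 \<in> aspan M {f\<in>Zvec n. \<delta> f \<noteq> E}"
    by (rule aspan_filter_mult[OF pf u t(3)]) (simp add: zlinearD[OF ad])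
  ultimately have 3: "a1 * (qp s * M h) - u * t1 \<in> aspan M {f\<in>Zvec n. \<delta> f \<noteq> E}"
    unfolding 1 by (intro aspan_diff aspan_add)
  have "a1 * (qp s * M h) - u * t1 = 0"
    by (rule free_on_disjoint[OF fr _ _ _ 2 3]) auto
  then have e1: "a1 * (qp s * M h) = u * t1" by simp
  \<comment> \<open>Division by the unit \<open>qp s * M h\<close>: the exponent
    \<open>L h h - s\<close> compensates \<open>M h * M (- h) = qp (- L h h)\<close>.\<close>
  define t1' where "t1' = qp (L h h - s) * (t1 * M (- h))"
  have t1'in: "t1' \<in> aspan M (Zvec n)"
    unfolding t1'_def
    by (rule aspan_scale[OF qp_in aspan_all_mult[OF pf aspan_filter_all[OF t(2)] aspan_base[OF Zvec_uminus[OF h]]]])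
  have "u * t1' = qp (L h h - s) * (u * t1 * M (- h))"
    by (simp add: t1'_def qp_left_comm mult.assoc)
  also have "\<dots> = qp (L h h - s) * (a1 * (qp s * (M h * M (- h))))"
    by (simp add: e1[symmetric] mult.assoc)
  also have "\<dots> = a1"
    by (simp add: pframe_uminus(2)[OF pf h] qp_simps)
  finally have a1: "a1 = u * t1'" by simp
  have "a0 * x = u * (t - t1' * x)"
    using Suc.prems(3) unfolding a(1) a1 by (simp add: algebra_simps)
  moreover have "t - t1' * x \<in> aspan M (Zvec n)"
    by (intro aspan_diff Suc.prems(2) aspan_all_mult[OF pf] t1'in aspan_filter_all[OF xin])
  ultimately obtain t0' where t0': "t0' \<in> aspan M (Zvec n)" "a0 = u * t0'" using Suc.IH[OF a(3)] by blast
  have "a = u * (t1' + t0')" unfolding a(1) a1 t0'(2) by (simp add: distrib_left)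
  then show ?case using aspan_add[OF t1'in t0'(1)] by blast
qed

text \<open>Right multiplication by \<open>x\<close> on the quotient of \<open>T\<close> by the
  right ideal \<open>u T\<close> has zero kernel.\<close>

definition regular_mod :: "'k set \<Rightarrow> 'k \<Rightarrow> 'k \<Rightarrow> bool" where
  "regular_mod T u x \<longleftrightarrow> (\<forall>a\<in>T. \<forall>t\<in>T. a * x = u * t \<longrightarrow> (\<exists>t'\<in>T. a = u * t'))"

lemma regular_mod_lead:
  assumes F: "frame n L M" and ad: "zlinear \<delta>"
    and u: "u \<in> aspan M {f\<in>Zvec n. \<delta> f = e}" and h: "h \<in> Zvec n"
    and x': "x - qp s * M h \<in> aspan M {f\<in>Zvec n. \<delta> f < \<delta> h}"
  shows "regular_mod (aspan M (Zvec n)) u x"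
  unfolding regular_mod_def
proof (intro ballI impI)
  fix a t assume a: "a \<in> aspan M (Zvec n)" and t: "t \<in> aspan M (Zvec n)" "a * x = u * t"
  obtain K where "a \<in> aspan M {f\<in>Zvec n. \<bar>\<delta> f\<bar> \<le> int K}" using a by (rule aspan_bound)
  \<comment> \<open>The upper bound of the window is strict, hence the width
    \<open>2 * K + 1\<close>.\<close>
  then have "a \<in> aspan M {f\<in>Zvec n. - int K \<le> \<delta> f \<and> \<delta> f < - int K + int (2 * K + 1)}"
    by (rule aspan_filter_mono) auto
  from regular_step[OF F ad u h x' this t] show "\<exists>t'\<in>aspan M (Zvec n). a = u * t'" .
qed

lemma regular_mod_mult:
  assumes "regular_mod T u x" "regular_mod T u y" "\<And>a. a \<in> T \<Longrightarrow> a * x \<in> T"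
  shows "regular_mod T u (x * y)"
  using assms unfolding regular_mod_def by (metis mult.assoc)

lemma regular_mod_one: "regular_mod T u 1"
  unfolding regular_mod_def by auto

lemma regular_mod_pow:
  assumes "regular_mod T u x" "\<And>a. a \<in> T \<Longrightarrow> a * x \<in> T"
  shows "regular_mod T u (x ^ m)"
  by (induction m) (auto intro: regular_mod_mult regular_mod_one assms)

text \<open>One factor \<open>u\<close> is removed at a time:
  \<open>y * u ^ Suc m * v = u * (y * v * u ^ m)\<close>, so regularity of \<open>v\<close> makes
  \<open>y * u ^ Suc m\<close> divisible by \<open>u\<close> within \<open>T\<close>.\<close>

lemma regular_mod_div:
  assumes u: "u \<noteq> 0" "\<And>t. t \<in> T \<Longrightarrow> u * t = t * u" and v: "v \<in> T" and r: "regular_mod T u v"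
    and T: "\<And>a b. a \<in> T \<Longrightarrow> b \<in> T \<Longrightarrow> a * b \<in> T" "u \<in> T" "1 \<in> T"
    and yv: "y * v \<in> T"
  shows "y * u ^ m \<in> T \<Longrightarrow> y \<in> T"
proof (induction m)
  case (Suc m)
  have uc: "u ^ i * t = t * u ^ i" if "t \<in> T" for t i
    using u(2)[OF that] by (metis power_commuting_commutes)
  have um: "u ^ i \<in> T" for i by (induction i) (auto intro: T)
  have "y * u ^ Suc m * v = (y * v) * u ^ Suc m" using uc[OF v, of "Suc m"] by (simp only: mult.assoc)
  also have "\<dots> = u * (y * v * u ^ m)"
    using u(2)[OF yv] by (simp add: mult.assoc[symmetric])
  finally obtain t' where t': "t' \<in> T" "y * u ^ Suc m = u * t'"
    using r Suc.prems T(1)[OF yv um] unfolding regular_mod_def by blast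
  have "y * u ^ m * u = t' * u" using t'(2) u(2)[OF t'(1)] by (simp add: mult.assoc power_commutes)
  then have "y * u ^ m = t'" using u(1) by simp
  then show ?case using Suc.IH t'(1) by simp
qed simp

text \<open>If \<open>y\<close> had a component of lowest negative degree, its product with
  \<open>w0\<close> would be a component of \<open>y * w\<close> in that degree and would have to
  vanish; in a division ring \<open>w0 \<noteq> 0\<close> then forces that component to be
  0.\<close>

lemma aspan_nonneg_div:
  assumes F: "frame n L M" and ad: "zlinear \<delta>"
    and w0: "w0 \<in> aspan M {f\<in>Zvec n. \<delta> f = 0}" "w0 \<noteq> 0" and w1: "w - w0 \<in> aspan M {f\<in>Zvec n. \<delta> f > 0}"
    and yw: "y * w \<in> aspan M {f\<in>Zvec n. \<delta> f \<ge> 0}"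
  shows "y \<in> aspan M {f\<in>Zvec n. \<delta> f \<ge> - int k} \<Longrightarrow> y \<in> aspan M {f\<in>Zvec n. \<delta> f \<ge> 0}"
proof (induction k)
  case (Suc k)
  note pf = frame_pframe[OF F] and fr = frame_free[OF F]
  obtain y0 y1 where y: "y = y0 + y1" "y0 \<in> aspan M {f\<in>Zvec n. \<delta> f = - int (Suc k)}" "y1 \<in> aspan M {f\<in>Zvec n. \<delta> f \<ge> - int k}"
    by (rule aspan_split[OF Suc.prems, of "\<lambda>f. \<delta> f = - int (Suc k)" "\<lambda>f. \<delta> f \<ge> - int k"]) auto
  define w1 where "w1 = w - w0"
  have w: "w = w0 + w1" by (simp add: w1_def)
  have w1in: "w1 \<in> aspan M {f\<in>Zvec n. \<delta> f > 0}" using w1 by (simp add: w1_def)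
  have win: "w \<in> aspan M {f\<in>Zvec n. \<delta> f \<ge> 0}"
    unfolding w using w0(1) w1in by (intro aspan_add) (erule aspan_filter_mono, simp)+
  have e: "y0 * w0 = y * w - (y0 * w1 + y1 * w)"
    unfolding y(1) w by (simp add: algebra_simps)
  have "y0 * w1 \<in> aspan M {f\<in>Zvec n. \<delta> f \<ge> - int k}"
    by (rule aspan_filter_mult[OF pf y(2) w1in]) (simp add: zlinearD[OF ad])
  moreover have "y1 * w \<in> aspan M {f\<in>Zvec n. \<delta> f \<ge> - int k}"
    by (rule aspan_filter_mult[OF pf y(3) win]) (simp add: zlinearD[OF ad])
  moreover have "y * w \<in> aspan M {f\<in>Zvec n. \<delta> f \<ge> - int k}"
    by (rule aspan_filter_mono[OF yw]) simp
  ultimately have 1: "y0 * w0 \<in> aspan M {f\<in>Zvec n. \<delta> f \<ge> - int k}"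
    unfolding e by (intro aspan_diff aspan_add)
  have 2: "y0 * w0 \<in> aspan M {f\<in>Zvec n. \<delta> f = - int (Suc k)}"
    by (rule aspan_filter_mult[OF pf y(2) w0(1)]) (simp add: zlinearD[OF ad])
  have "y0 * w0 = 0" by (rule free_on_disjoint[OF fr _ _ _ 1 2]) auto
  then have "y = y1" using w0(2) y(1) by simp
  then show ?case using Suc.IH y(3) by simp
qed simp

end

section \<open>Existence of mutations\<close>

lemma half_add: "(a + b) * (a + b - 1) div 2 = a * (a - 1) div 2 + b * (b - 1) div 2 + a * b" for a b :: int
proof -
  have ev: "2 * (x * (x - 1) div 2) = x * (x - 1)" for x :: int
    by (rule dvd_mult_div_cancel) simp
  have "2 * ((a + b) * (a + b - 1) div 2) = 2 * (a * (a - 1) div 2 + b * (b - 1) div 2 + a * b)"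
    unfolding distrib_left ev by (simp add: algebra_simps)
  then show ?thesis by (simp only: mult_cancel_left) simp
qed

context central_scalars
begin

text \<open>The leading coefficient is required to be a power of \<open>q\<close>, which makes the
  leading term a unit of the torus.\<close>

definition lead :: "nat \<Rightarrow> ((nat \<Rightarrow> int) \<Rightarrow> 'k) \<Rightarrow> ((nat \<Rightarrow> int) \<Rightarrow> int) \<Rightarrow> 'k \<Rightarrow> (nat \<Rightarrow> int) \<Rightarrow> bool" where
  "lead n M \<delta> x h \<longleftrightarrow> h \<in> Zvec n \<and> (\<exists>s. x - qp s * M h \<in> aspan M {f\<in>Zvec n. \<delta> f < \<delta> h})"

lemma leadI: "h \<in> Zvec n \<Longrightarrow> x - qp s * M h \<in> aspan M {f\<in>Zvec n. \<delta> f < \<delta> h} \<Longrightarrow> lead n M \<delta> x h"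
  unfolding lead_def by blast

lemma leadE:
  assumes "lead n M \<delta> x h"
  obtains s x' where "h \<in> Zvec n" "x = qp s * M h + x'" "x' \<in> aspan M {f\<in>Zvec n. \<delta> f < \<delta> h}"
proof -
  obtain s where s: "h \<in> Zvec n" "x - qp s * M h \<in> aspan M {f\<in>Zvec n. \<delta> f < \<delta> h}"
    using assms unfolding lead_def by blast
  show thesis by (rule that[of s "x - qp s * M h", OF s(1) _ s(2)]) simp
qed

lemma lead_base: "h \<in> Zvec n \<Longrightarrow> lead n M \<delta> (M h) h"
  by (rule leadI[where s = 0]) simp_all

lemma lead_mult:
  assumes pf: "pframe n L M" and ad: "zlinear \<delta>" and x: "lead n M \<delta> x h" and y: "lead n M \<delta> y g"
  shows "lead n M \<delta> (x * y) (h + g)"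
proof -
  obtain s x' where X: "h \<in> Zvec n" "x = qp s * M h + x'" "x' \<in> aspan M {f\<in>Zvec n. \<delta> f < \<delta> h}"
    using x by (rule leadE)
  obtain t y' where Y: "g \<in> Zvec n" "y = qp t * M g + y'" "y' \<in> aspan M {f\<in>Zvec n. \<delta> f < \<delta> g}"
    using y by (rule leadE)
  have h: "qp s * M h \<in> aspan M {f\<in>Zvec n. \<delta> f = \<delta> h}" using X(1) by (intro aspan_qterm) simp
  have g: "qp t * M g \<in> aspan M {f\<in>Zvec n. \<delta> f = \<delta> g}" using Y(1) by (intro aspan_qterm) simp
  have "qp s * M h * (qp t * M g) = qp (s + t + L h g) * M (h + g)"
    using pframe_mult[OF pf X(1) Y(1)] by (simp add: qp_simps algebra_simps)
  then have e: "x * y - qp (s + t + L h g) * M (h + g) = qp s * M h * y' + x' * (qp t * M g) + x' * y'"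
    unfolding X(2) Y(2) by (simp add: distrib_left distrib_right)
  show ?thesis
  proof (rule leadI)
    show "h + g \<in> Zvec n" using X Y by simp
    show "x * y - qp (s + t + L h g) * M (h + g) \<in> aspan M {f\<in>Zvec n. \<delta> f < \<delta> (h + g)}"
      unfolding e
      by (intro aspan_add aspan_filter_mult[OF pf h Y(3)] aspan_filter_mult[OF pf X(3) g] aspan_filter_mult[OF pf X(3) Y(3)])
        (simp_all add: zlinearD[OF ad])
  qed
qed

lemma lead_qp: 
  assumes "lead n M \<delta> x h"
  shows "lead n M \<delta> (qp t * x) h"
proof -
  obtain s x' where X: "h \<in> Zvec n" "x = qp s * M h + x'" "x' \<in> aspan M {f\<in>Zvec n. \<delta> f < \<delta> h}"
    using assms by (rule leadE)
  show ?thesis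
    by (rule leadI[OF X(1), of _ "t + s"]) (use X aspan_scale[OF qp_in X(3), of t] in \<open>simp add: distrib_left qp_merge\<close>)
qed

lemma lead_add:
  assumes "lead n M \<delta> x h" "y \<in> aspan M {f\<in>Zvec n. \<delta> f < \<delta> h}"
  shows "lead n M \<delta> (x + y) h"
proof -
  obtain s x' where X: "h \<in> Zvec n" "x = qp s * M h + x'" "x' \<in> aspan M {f\<in>Zvec n. \<delta> f < \<delta> h}"
    using assms by (elim leadE)
  show ?thesis
    by (rule leadI[OF X(1), of _ s]) (use X aspan_add[OF X(3) assms(2)] in \<open>simp add: add.assoc\<close>)
qed

lemma lead_pow:
  assumes pf: "pframe n L M" and ad: "zlinear \<delta>" and x: "lead n M \<delta> x h"
  shows "lead n M \<delta> (x ^ m) (smul (int m) h)"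
proof (induction m)
  case 0
  have "smul (int 0) h = 0" by (rule ext) simp
  moreover have "lead n M \<delta> (M 0) 0" by (rule lead_base) simp
  ultimately show ?case by (simp only: pframe_0[OF pf] power_0)
next
  case (Suc m)
  have "smul (int (Suc m)) h = h + smul (int m) h" by (rule ext) (simp add: algebra_simps)
  then show ?case using lead_mult[OF pf ad x Suc] by (simp only: power_Suc)
qed

lemma lead_nz:
  assumes F: "frame n L M" and x: "lead n M \<delta> x h"
  shows "x \<noteq> 0"
proof
  assume x0: "x = 0"
  obtain s x' where X: "h \<in> Zvec n" "x = qp s * M h + x'" "x' \<in> aspan M {f\<in>Zvec n. \<delta> f < \<delta> h}"
    using x by (rule leadE)
  have "qp s * M h = - x'" using x0 X(2) by (simp add: eq_neg_iff_add_eq_0)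
  then have 1: "qp s * M h \<in> aspan M {f\<in>Zvec n. \<delta> f < \<delta> h}" using aspan_uminus[OF X(3)] by simp
  have 2: "qp s * M h \<in> aspan M {f\<in>Zvec n. \<delta> f = \<delta> h}" using X(1) by (intro aspan_qterm) simp
  have "qp s * M h = 0" by (rule free_on_disjoint[OF frame_free[OF F] _ _ _ 1 2]) auto
  then show False using pframe_nz[OF frame_pframe[OF F] X(1)] by simp
qed

lemma regular_mod_lead':
  assumes "frame n L M" "zlinear \<delta>" "u \<in> aspan M {f\<in>Zvec n. \<delta> f = e}" "lead n M \<delta> x h"
  shows "regular_mod (aspan M (Zvec n)) u x"
  using assms(4) regular_mod_lead[OF assms(1-3)] unfolding lead_def by blast

text \<open>In the highest degree reached by some \<open>\<tau> f\<close>, the sum is a combination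
  of pairwise distinct monomials, because \<open>\<tau>\<close> is injective; independence would
  make its coefficients vanish.\<close>

lemma lead_sum_zero:
  assumes F: "frame n L M" and S: "finite S" "S \<noteq> {}" and c: "\<And>f. f \<in> S \<Longrightarrow> c f \<in> A" "\<And>f. f \<in> S \<Longrightarrow> c f \<noteq> 0"
    and y: "\<And>f. f \<in> S \<Longrightarrow> lead n M \<delta> (y f) (\<tau> f)" and inj: "inj_on \<tau> S"
  shows "(\<Sum>f\<in>S. c f * y f) \<noteq> 0"
proof
  assume z: "(\<Sum>f\<in>S. c f * y f) = 0"
  have "\<forall>f\<in>S. \<exists>s. y f - qp s * M (\<tau> f) \<in> aspan M {g\<in>Zvec n. \<delta> g < \<delta> (\<tau> f)}"
    using y unfolding lead_def by blast
  then obtain s where s: "\<And>f. f \<in> S \<Longrightarrow> y f - qp (s f) * M (\<tau> f) \<in> aspan M {g\<in>Zvec n. \<delta> g < \<delta> (\<tau> f)}"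
    by metis
  have \<tau>Z: "\<tau> f \<in> Zvec n" if "f \<in> S" for f using y[OF that] unfolding lead_def by blast
  define D where "D = Max ((\<lambda>f. \<delta> (\<tau> f)) ` S)"
  have D: "\<delta> (\<tau> f) \<le> D" if "f \<in> S" for f unfolding D_def using S that by (intro Max_ge) auto
  have "D \<in> (\<lambda>f. \<delta> (\<tau> f)) ` S" unfolding D_def using S by (intro Max_in) auto
  then obtain f0 where f0: "f0 \<in> S" "\<delta> (\<tau> f0) = D" by blast
  define S2 where "S2 = {f\<in>S. \<delta> (\<tau> f) = D}"
  define r where "r f = y f - qp (s f) * M (\<tau> f)" for f
  have yr: "y f = qp (s f) * M (\<tau> f) + r f" for f by (simp add: r_def)
  have rin: "r f \<in> aspan M {g\<in>Zvec n. \<delta> g < D}" if "f \<in> S" for f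
    by (rule aspan_filter_mono[OF s[OF that, folded r_def]]) (use D[OF that] in simp)
  let ?t = "\<lambda>f. c f * (qp (s f) * M (\<tau> f))"
  have tin: "?t f \<in> aspan M {g\<in>Zvec n. \<delta> g < D}" if "f \<in> S - S2" for f
    by (intro aspan_scale aspan_qterm) (use that D[of f] c \<tau>Z in \<open>auto simp: S2_def\<close>)
  have "(\<Sum>f\<in>S. c f * y f) = (\<Sum>f\<in>S. ?t f) + (\<Sum>f\<in>S. c f * r f)"
    by (simp only: yr distrib_left sum.distrib)
  also have "(\<Sum>f\<in>S. ?t f) = (\<Sum>f\<in>S2. ?t f) + (\<Sum>f\<in>S - S2. ?t f)"
    using sum.subset_diff[of S2 S ?t] S(1) by (simp add: S2_def add.commute)
  finally have "(\<Sum>f\<in>S2. ?t f) + ((\<Sum>f\<in>S - S2. ?t f) + (\<Sum>f\<in>S. c f * r f)) = 0"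
    using z by (simp only: add.assoc)
  then have e: "(\<Sum>f\<in>S2. ?t f) = - ((\<Sum>f\<in>S - S2. ?t f) + (\<Sum>f\<in>S. c f * r f))"
    by (rule eq_neg_iff_add_eq_0[THEN iffD2])
  have 1: "(\<Sum>f\<in>S2. ?t f) \<in> aspan M {g\<in>Zvec n. \<delta> g < D}"
    unfolding e using c(1) by (intro aspan_uminus aspan_add aspan_sum tin aspan_scale rin)
  have 2: "(\<Sum>f\<in>S2. ?t f) \<in> aspan M {g\<in>Zvec n. \<delta> g = D}"
    by (intro aspan_sum aspan_scale aspan_qterm) (use c \<tau>Z in \<open>auto simp: S2_def\<close>)
  have z2: "(\<Sum>f\<in>S2. ?t f) = 0"
    by (rule free_on_disjoint[OF frame_free[OF F] _ _ _ 1 2]) auto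
  have inj2: "inj_on \<tau> S2" using inj by (rule inj_on_subset) (auto simp: S2_def)
  define c2 where "c2 g = (let f = the_inv_into S2 \<tau> g in c f * qp (s f))" for g
  have c2: "c2 (\<tau> f) = c f * qp (s f)" if "f \<in> S2" for f
    using the_inv_into_f_f[OF inj2 that] by (simp add: c2_def)
  have "(\<Sum>g\<in>\<tau> ` S2. c2 g * M g) = (\<Sum>f\<in>S2. ?t f)"
    unfolding sum.reindex[OF inj2] by (rule sum.cong) (simp_all add: c2 mult.assoc)
  then have z3: "(\<Sum>g\<in>\<tau> ` S2. c2 g * M g) = 0" using z2 by simp
  have fin2: "finite (\<tau> ` S2)" using S(1) by (simp add: S2_def)
  have "c2 (\<tau> f0) = 0"
  proof (rule free_onD[OF frame_free[OF F] fin2 _ _ z3])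
    show "\<tau> ` S2 \<subseteq> Zvec n" using \<tau>Z by (auto simp: S2_def)
    show "c2 g \<in> A" if "g \<in> \<tau> ` S2" for g using that c2 c(1) by (auto simp: S2_def)
    show "\<tau> f0 \<in> \<tau> ` S2" using f0 by (auto simp: S2_def)
  qed
  moreover have "f0 \<in> S2" using f0 by (simp add: S2_def)
  ultimately show False using c2 c(2)[OF f0(1)] by simp
qed

lemma qcomm_powi_left:
  assumes "x * y = qp s * (y * x)" "x \<noteq> 0"
  shows "x powi a * y = qp (a * s) * (y * x powi a)"
proof (cases "a \<ge> 0")
  case True
  then show ?thesis using qcomm_pow_left[OF assms(1), of "nat a"] by (simp add: power_int_nonneg_exp)
next
  case False
  have "x * (qp (- s) * (y * inverse x)) = qp (- s) * (x * y * inverse x)"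
    by (simp add: qp_simps)
  also have "\<dots> = y" using assms(2) by (simp add: assms(1) qp_simps)
  finally have "inverse x * y = qp (- s) * (y * inverse x)"
    using assms(2) by (metis left_inverse mult.assoc mult_1)
  from qcomm_pow_left[OF this, of "nat (- a)"] show ?thesis
    using False by (simp add: power_int_def)
qed

end

context cluster
begin

section \<open>Full rank and the construction of mutated seeds\<close>

definition full_rank :: "(nat \<Rightarrow> nat \<Rightarrow> int) \<Rightarrow> bool" where
  "full_rank B \<longleftrightarrow> (\<forall>c. (\<forall>i<n. (\<Sum>j\<in>ex. B i j * c j) = 0) \<longrightarrow> (\<forall>j\<in>ex. c j = (0::int)))"

lemma finite_ex [simp]: "finite ex"
  using ex_sub finite_subset by blast

lemma full_rankD: "full_rank B \<Longrightarrow> (\<And>i. i < n \<Longrightarrow> (\<Sum>j\<in>ex. B i j * c j) = 0) \<Longrightarrow> j \<in> ex \<Longrightarrow> c j = 0"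
  unfolding full_rank_def by blast

text \<open>A relation \<open>c\<close> among the mutated columns becomes a relation
  \<open>c'\<close> among the old ones after changing only the coefficient at \<open>k\<close>. Row
  \<open>k\<close> of the given relation removes the term with
  \<open>max 0 (- B i k)\<close>.\<close>

lemma full_rank_mutB:
  assumes ds: "dskew B" and k: "k \<in> ex" and fr: "full_rank B"
  shows "full_rank (mutB B k)"
  unfolding full_rank_def
proof (intro allI impI ballI)
  fix c j assume z: "\<forall>i<n. (\<Sum>j\<in>ex. mutB B k i j * c j) = 0" and j: "j \<in> ex"
  let ?E = "ex - {k}"
  define s where "s = (\<Sum>j\<in>?E. max 0 (B k j) * c j)"
  define c' where "c' j = (if j = k then s - c k else c j)" for j
  have B': "mutB B k i k = - B i k" "mutB B k k i = - B k i" for i by (auto simp: mutB_def)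
  have "0 = (\<Sum>j\<in>ex. mutB B k k j * c j)" using z k by simp
  also have "\<dots> = - B k k * c k + (\<Sum>j\<in>?E. - B k j * c j)"
    by (simp only: sum.remove[OF finite_ex k] B')
  finally have zk: "(\<Sum>j\<in>?E. B k j * c j) = 0"
    using dskew_diag[OF ds k] by (simp add: sum_negf)
  have c'E: "(\<Sum>j\<in>?E. g j * c' j) = (\<Sum>j\<in>?E. g j * c j)" for g :: "nat \<Rightarrow> int"
    by (rule sum.cong) (auto simp: c'_def)
  have z': "(\<Sum>j\<in>ex. B i j * c' j) = 0" if i: "i < n" for i
  proof (cases "i = k")
    case True
    then show ?thesis by (simp only: sum.remove[OF finite_ex k] c'E zk) (simp add: dskew_diag[OF ds k])
  next
    case False
    have m: "mutB B k i j * c j = B i j * c j + B i k * (max 0 (B k j) * c j) + max 0 (- B i k) * (B k j * c j)" if "j \<in> ?E" for j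
      using that False mutB_half(1)[of "B i k" "B k j"] by (simp add: mutB_def algebra_simps)
    have "0 = (\<Sum>j\<in>ex. mutB B k i j * c j)" using z i by simp
    also have "\<dots> = - B i k * c k + (\<Sum>j\<in>?E. mutB B k i j * c j)"
      by (simp only: sum.remove[OF finite_ex k] B')
    also have "(\<Sum>j\<in>?E. mutB B k i j * c j) = (\<Sum>j\<in>?E. B i j * c j + B i k * (max 0 (B k j) * c j) + max 0 (- B i k) * (B k j * c j))"
      by (rule sum.cong[OF refl m])
    also have "\<dots> = (\<Sum>j\<in>?E. B i j * c j) + B i k * s + max 0 (- B i k) * (\<Sum>j\<in>?E. B k j * c j)"
      by (simp only: sum.distrib s_def sum_distrib_left)
    finally have "0 = - B i k * c k + (\<Sum>j\<in>?E. B i j * c j) + B i k * s" using zk by simp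
    then show ?thesis
      by (simp only: sum.remove[OF finite_ex k] c'E) (simp add: c'_def algebra_simps)
  qed
  have c'0: "c' j = 0" if "j \<in> ex" for j by (rule full_rankD[OF fr z' that])
  have cE: "c j = 0" if "j \<in> ?E" for j using c'0[of j] that by (simp add: c'_def)
  then have "s = 0" by (simp add: s_def)
  then have "c k = 0" using c'0[OF k] by (simp add: c'_def)
  then show "c j = 0" using cE j by (cases "j = k") simp_all
qed

lemma full_rank_col:
  assumes "full_rank B" "k \<in> ex"
  shows "\<exists>i<n. B i k \<noteq> 0"
proof (rule ccontr)
  assume "\<not> ?thesis"
  then have "B i k = 0" if "i < n" for i using that by blast
  then have "(\<Sum>j\<in>ex. B i j * (if j = k then 1 else 0)) = 0" if "i < n" for i
    using that by (intro sum.neutral) auto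
  from full_rankD[OF assms(1) this assms(2)] show False by simp
qed

text \<open>\<open>\<delta>\<close> is the 2 by 2 minor in rows \<open>p\<close>, \<open>q\<close>
  of the matrix with columns \<open>col B i\<close> and \<open>f\<close>. If it vanished at
  \<open>col B j\<close> for every \<open>q\<close>, the two columns would be dependent.\<close>

lemma full_rank_separate:
  assumes fr: "full_rank B" and ij: "i \<in> ex" "j \<in> ex" "i \<noteq> j"
  obtains \<delta> where "zlinear \<delta>" "\<delta> (col B i) = 0" "\<delta> (col B j) \<noteq> 0"
proof -
  obtain p where p: "p < n" "B p i \<noteq> 0" using full_rank_col[OF fr ij(1)] by blast
  have "\<exists>q<n. B p i * B q j - B q i * B p j \<noteq> 0"
  proof (rule ccontr)
    assume "\<not> ?thesis"
    then have z: "B p i * B q j - B q i * B p j = 0" if "q < n" for q using that by blast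
    let ?c = "\<lambda>k. if k = j then B p i else if k = i then - B p j else 0"
    have "(\<Sum>k\<in>ex. B q k * ?c k) = 0" if "q < n" for q
    proof -
      have "(\<Sum>k\<in>ex. B q k * ?c k) = (\<Sum>k\<in>{i, j}. B q k * ?c k)"
        by (rule sum.mono_neutral_right) (use ij in auto)
      also have "\<dots> = B p i * B q j - B q i * B p j" using ij by (simp add: algebra_simps)
      finally show ?thesis using z[OF that] by simp
    qed
    from full_rankD[OF fr this ij(2)] show False using p(2) by simp
  qed
  then obtain q where q: "q < n" "B p i * B q j - B q i * B p j \<noteq> 0" by blast
  show thesis
  proof (rule that[of "\<lambda>f. B p i * f q - B q i * f p"])
    show "zlinear (\<lambda>f. B p i * f q - B q i * f p)" by (simp add: zlinear_def algebra_simps)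
  qed (use p q in simp_all)
qed

text \<open>The new variable \<open>x\<close> satisfies the right commutation rules, so ordered
  monomials \<open>M (f(k := 0)) * x powi (f k)\<close>, normalised by \<open>corr\<close>, are
  multiplicative. They are independent because their leading exponents are distinct after clearing
  negative powers of \<open>x\<close>.\<close>

lemma mutates_exists:
  assumes S: "seed M L B" and k: "k \<in> ex" and fr: "full_rank B"
  obtains M' L' B' where "mutates k M L B M' L' B'" "seed M' L' B'"
proof -
  let ?b = "col B k" let ?e = "uvec k" let ?p = "posp ?b" let ?n = "posp (- ?b)"
  note ds = seed_dskew[OF S] and dg = dskew_diag[OF seed_dskew[OF S] k] and bi = seed_biadd[OF S]
    and pf = seed_pframe[OF S] and F = seed_frame[OF S]
  let ?r = "reflect ?n k"
  define L' where "L' f g = L (?r f) (?r g)" for f g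
  have bi': "biadd L'" using biadd_reflect[OF bi, of ?n k] unfolding L'_def by simp
  have zk: "?p k = 0" "?n k = 0" "?b k = 0" using dg k by (simp_all add: posp_apply)
  have Z: "?b \<in> Zvec n" "?e \<in> Zvec n" "?p \<in> Zvec n" "?n \<in> Zvec n" using k by simp_all
  have rZ: "?r f \<in> Zvec n" if "f \<in> Zvec n" for f using that k by simp
  have Le: "L' ?e g = L (- ?e + ?n) g" "L' g ?e = L g (- ?e + ?n)" if "g k = 0" for g
    unfolding L'_def reflect_uvec using reflect_fix[of g k, OF that] by simp_all
  have L0: "L' f g = L f g" if "f k = 0" "g k = 0" for f g
    unfolding L'_def using reflect_fix[of f k, OF that(1)] reflect_fix[of g k, OF that(2)] by simp
  have skew': "[L' f g = - L' g f] (mod int l)" if "f \<in> Zvec n" "g \<in> Zvec n" for f g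
    unfolding L'_def using frame_skew[OF F rZ[OF that(1)] rZ[OF that(2)]] .
  define w where "w = - ?e + ?p"
  define w' where "w' = - ?e + ?n"
  have wZ: "w \<in> Zvec n" "w' \<in> Zvec n" unfolding w_def w'_def using Z by simp_all
  define x where "x = M w + M w'"
  obtain i0 where i0: "i0 < n" "B i0 k \<noteq> 0" using full_rank_col[OF fr k] by blast
  \<comment> \<open>A coordinate at which the column is nonzero, with the sign that makes
    \<open>w\<close> the leading exponent: \<open>\<delta> w - \<delta> w'\<close> is the absolute
    value of \<open>B i0 k\<close>.\<close>
  define \<delta> where "\<delta> f = sgn (B i0 k) * f i0" for f :: "nat \<Rightarrow> int"
  have ad: "zlinear \<delta>" by (simp add: zlinear_def \<delta>_def algebra_simps)
  have "w i0 - w' i0 = B i0 k" using i0 by (simp add: w_def w'_def posp_apply)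
  then have "\<delta> w - \<delta> w' = sgn (B i0 k) * B i0 k" by (simp only: \<delta>_def right_diff_distrib[symmetric])
  moreover have "sgn (B i0 k) * B i0 k > 0" using i0(2) by (metis abs_sgn mult.commute zero_less_abs_iff)
  ultimately have dw: "\<delta> w' < \<delta> w" by linarith
  have lx: "lead n M \<delta> x w"
    unfolding x_def by (rule lead_add[OF lead_base[OF wZ(1)] aspan_base]) (simp add: wZ dw)
  have x0: "x \<noteq> 0" by (rule lead_nz[OF F lx])
  \<comment> \<open>The exponents \<open>w\<close> and \<open>w'\<close> differ by the column, which
    pairs with \<open>g\<close> to 0 when \<open>g k = 0\<close>; so both terms of \<open>x\<close>
    pass \<open>M g\<close> with the same factor.\<close>
  have xc: "x * M g = qp (2 * L' ?e g) * (M g * x)" if g: "g \<in> Zvec n" "g k = 0" for g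
  proof -
    have "[L ?b g = 0] (mod int l)" using compatD[OF seed_compat[OF S] k g(1)] g(2) by simp
    moreover have "L w g = L w' g + L ?b g"
      unfolding w_def w'_def using posp_split[of ?b] by (simp add: biaddD[OF bi])
    ultimately have "[2 * L w g = 2 * L w' g] (mod int l)"
      by (metis cong_add cong_refl cong_scalar_left add.right_neutral)
    then have "qp (2 * L w g) = qp (2 * L w' g)" by (rule qp_cong)
    moreover have "L' ?e g = L w' g" unfolding w'_def by (rule Le(1)[of g, OF g(2)])
    ultimately show ?thesis
      unfolding x_def using frame_comm[OF F wZ(1) g(1)] frame_comm[OF F wZ(2) g(1)]
      by (simp add: distrib_left distrib_right)
  qed
  define M' where "M' f = qp (corr L' (f(k := 0)) k (f k)) * (M (f(k := 0)) * x powi (f k))" for f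
  have M'0: "M' f = M f" if "f k = 0" for f
  proof -
    have "f(k := 0) = f" using that by (intro ext) auto
    then show ?thesis using that by (simp add: M'_def corr_def)
  qed
  have M'e: "M' ?e = x"
  proof -
    have "?e(k := 0) = 0" by (rule ext) (simp add: uvec_def)
    then have "M (?e(k := 0)) = 1" using pframe_0[OF pf] by (simp only:)
    moreover have "corr L' (?e(k := 0)) k (?e k) = 0"
      unfolding \<open>?e(k := 0) = 0\<close> by (simp only: corr_def biaddD(3)[OF bi']) simp
    ultimately show ?thesis by (simp add: M'_def)
  qed
  have M'mult: "M' f * M' g = qp (L' f g) * M' (f + g)" if fg: "f \<in> Zvec n" "g \<in> Zvec n" for f g
  proof -
    define a b f0 g0 where ab: "a = f k" "b = g k" "f0 = f(k := 0)" "g0 = g(k := 0)"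
    have f0: "f0 \<in> Zvec n" "g0 \<in> Zvec n" "f0 k = 0" "g0 k = 0" using fg by (simp_all add: ab)
    have "f = f0 + svec a k" "g = g0 + svec b k"
      unfolding ab by (rule fun_upd_split)+
    then have Lfg: "L' f g = L f0 g0 + b * L' f0 ?e + a * L' ?e g0 + a * b * L' ?e ?e"
      using L0[of f0 g0, OF f0(3,4)] by (simp only: biaddD[OF bi'] biadd_svec[OF bi']) (simp add: algebra_simps)
    let ?\<kappa> = "\<lambda>f a. corr L' f k a"
    \<comment> \<open>Moving \<open>x powi a\<close> past \<open>M g0\<close> costs
      \<open>2 * a * L' ?e g0\<close>, while \<open>L' f g\<close> and \<open>corr\<close>
      contribute \<open>a * L' ?e g0 - a * L' g0 ?e\<close>; skewness mod \<open>l\<close>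
      reconciles them.\<close>
    obtain m where m: "L' g0 ?e = - L' ?e g0 + int l * m"
      using skew'[OF f0(2) Z(2)] unfolding cong_int_iff_ex by blast
    have "?\<kappa> (f0 + g0) (a + b) = ?\<kappa> f0 a + ?\<kappa> g0 b - a * L' g0 ?e - b * L' f0 ?e - a * b * L' ?e ?e"
      unfolding corr_def half_add by (simp add: biaddD[OF bi'] algebra_simps)
    then have "L' f g + ?\<kappa> (f0 + g0) (a + b) = ?\<kappa> f0 a + ?\<kappa> g0 b + 2 * a * L' ?e g0 + L f0 g0 - int l * (a * m)"
      unfolding Lfg m by (simp add: algebra_simps)
    then have cg: "qp (?\<kappa> f0 a + ?\<kappa> g0 b + 2 * a * L' ?e g0 + L f0 g0) = qp (L' f g + ?\<kappa> (f0 + g0) (a + b))"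
      by (intro qp_cong) (auto simp: cong_iff_dvd_diff)
    have xa: "x powi a * M g0 = qp (2 * a * L' ?e g0) * (M g0 * x powi a)"
      using qcomm_powi_left[OF xc[OF f0(2,4)] x0, of a] by (simp add: mult.assoc mult.left_commute)
    have "M' f * M' g = qp (?\<kappa> f0 a) * (M f0 * x powi a) * (qp (?\<kappa> g0 b) * (M g0 * x powi b))"
      by (simp only: M'_def ab)
    also have "\<dots> = qp (?\<kappa> f0 a + ?\<kappa> g0 b) * (M f0 * (x powi a * M g0) * x powi b)"
      by (simp add: qp_simps add.commute)
    also have "\<dots> = qp (?\<kappa> f0 a + ?\<kappa> g0 b + 2 * a * L' ?e g0) * (M f0 * M g0 * (x powi a * x powi b))"
      unfolding xa by (simp add: qp_simps add.commute)
    also have "\<dots> = qp (?\<kappa> f0 a + ?\<kappa> g0 b + 2 * a * L' ?e g0 + L f0 g0) * (M (f0 + g0) * x powi (a + b))"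
      unfolding pframe_mult[OF pf f0(1,2)] power_int_add[OF disjI1[OF x0]] by (simp add: qp_simps add.commute)
    also have "\<dots> = qp (L' f g) * (qp (?\<kappa> (f0 + g0) (a + b)) * (M (f0 + g0) * x powi (a + b)))"
      unfolding cg by (simp only: qp_merge)
    also have "qp (?\<kappa> (f0 + g0) (a + b)) * (M (f0 + g0) * x powi (a + b)) = M' (f + g)"
      by (simp only: M'_def ab fun_upd_zero_add plus_fun_apply)
    finally show ?thesis .
  qed
  have M'00: "M' 0 = 1"
  proof -
    have "M' 0 = M 0" using M'0[of 0] by simp
    then show ?thesis by (simp only: pframe_0[OF pf])
  qed
  have pf': "pframe n L' M'"
    unfolding pframe_def using bi' M'00 M'mult by blast
  have free': "free_on M' (Zvec n)"
    unfolding free_on_def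
  proof (intro allI impI)
    fix S c assume S: "finite S" "S \<subseteq> Zvec n" and c: "\<forall>f\<in>S. c f \<in> A" and z: "(\<Sum>f\<in>S. c f * M' f) = 0"
    show "\<forall>f\<in>S. c f = 0"
    proof (rule ccontr)
      assume nz: "\<not> (\<forall>f\<in>S. c f = 0)"
      define S1 where "S1 = {f\<in>S. c f \<noteq> 0}"
      have S1: "finite S1" "S1 \<noteq> {}" "S1 \<subseteq> Zvec n"
        using S nz by (auto simp: S1_def)
      \<comment> \<open>After multiplication by \<open>x ^ K\<close> only nonnegative powers of
        \<open>x\<close> remain, and these have leading terms.\<close>
      define K where "K = nat (\<Sum>f\<in>S1. \<bar>f k\<bar>)"
      have K: "f k + int K \<ge> 0" if "f \<in> S1" for f
        using member_le_sum[OF that, of "\<lambda>f. \<bar>f k\<bar>"] S1(1) by (simp add: K_def sum_nonneg)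
      define \<tau> where "\<tau> f = f(k := 0) + smul (f k + int K) w" for f
      have ld: "lead n M \<delta> (M' f * x ^ K) (\<tau> f)" if f: "f \<in> S1" for f
      proof -
        have "x powi (f k) * x ^ K = x ^ nat (f k + int K)"
          using K[OF f] power_int_add[OF disjI1[OF x0], of "f k" "int K"] by (simp add: power_int_nonneg_exp)
        then have "M' f * x ^ K = qp (corr L' (f(k := 0)) k (f k)) * (M (f(k := 0)) * x ^ nat (f k + int K))"
          by (simp add: M'_def mult.assoc)
        moreover have "lead n M \<delta> (M (f(k := 0)) * x ^ nat (f k + int K)) (f(k := 0) + smul (int (nat (f k + int K))) w)"
          by (rule lead_mult[OF pf ad lead_base lead_pow[OF pf ad lx]]) (use f S1 in auto)
        ultimately show ?thesis using lead_qp K[OF f] by (simp add: \<tau>_def)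
      qed
      \<comment> \<open>Coordinate \<open>k\<close> of the leading exponent recovers
        \<open>f k\<close>, which yields injectivity of \<open>\<tau>\<close>.\<close>
      have wk: "w k = -1" using zk by (simp add: w_def)
      have inj: "inj_on \<tau> S1"
      proof (rule inj_onI)
        fix f g assume fg: "\<tau> f = \<tau> g"
        have "\<tau> f k = - (f k + int K)" "\<tau> g k = - (g k + int K)" by (simp_all add: \<tau>_def wk)
        then have k: "f k = g k" using fg by simp
        then have "f(k := 0) = g(k := 0)" using fg unfolding \<tau>_def by (simp only: k add_right_cancel)
        then show "f = g" using k by (metis fun_upd_triv fun_upd_upd)
      qed
      have "(\<Sum>f\<in>S1. c f * (M' f * x ^ K)) = (\<Sum>f\<in>S1. c f * M' f) * x ^ K"
        by (simp only: sum_distrib_right mult.assoc)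
      also have "(\<Sum>f\<in>S1. c f * M' f) = (\<Sum>f\<in>S. c f * M' f)"
        using S(1) by (intro sum.mono_neutral_left) (auto simp: S1_def)
      finally have "(\<Sum>f\<in>S1. c f * (M' f * x ^ K)) = 0" using z by simp
      moreover have "(\<Sum>f\<in>S1. c f * (M' f * x ^ K)) \<noteq> 0"
        by (rule lead_sum_zero[OF F S1(1,2) _ _ ld inj]) (use c in \<open>auto simp: S1_def\<close>)
      ultimately show False by simp
    qed
  qed
  have F': "frame n L' M'" unfolding frame_def using pf' skew' free' by blast
  have m: "mutates k M L B M' L' (mutB B k)"
    unfolding mutates_def
  proof (intro conjI)
    show "\<forall>j<n. j \<noteq> k \<longrightarrow> M' (uvec j) = M (uvec j)" using M'0 by simp
    show "M' ?e = M (- ?e + ?p) + M (- ?e + ?n)" unfolding M'e x_def w_def w'_def ..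
  qed (simp_all add: L'_def)
  show thesis by (rule that[OF m seed_mutates[OF S k m F']])
qed

end

section \<open>Leading terms of mutated variables\<close>

context central_scalars
begin

lemma lead_in: "lead n M \<delta> x h \<Longrightarrow> x \<in> aspan M (Zvec n)"
proof (elim leadE)
  fix s x' assume "h \<in> Zvec n" and x: "x = qp s * M h + x'" "x' \<in> aspan M {f\<in>Zvec n. \<delta> f < \<delta> h}"
  then show "x \<in> aspan M (Zvec n)"
    unfolding x(1) by (intro aspan_add aspan_qterm aspan_filter_all[OF x(2)])
qed

lemma aspan_mult_right:
  assumes "y \<in> aspan M X" "\<And>f. f \<in> X \<Longrightarrow> M f * v \<in> aspan M' Y"
  shows "y * v \<in> aspan M' Y"
proof -
  obtain S c where S: "finite S" "S \<subseteq> X" "\<And>f. f \<in> S \<Longrightarrow> c f \<in> A" "y = (\<Sum>f\<in>S. c f * M f)"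
    using assms(1) by (rule aspanE) blast
  have "y * v = (\<Sum>f\<in>S. c f * (M f * v))" by (simp only: S(4) sum_distrib_right mult.assoc)
  also have "\<dots> \<in> aspan M' Y"
    by (intro aspan_sum aspan_scale S(3) assms(2)) (use S(2) in auto)
  finally show ?thesis .
qed

lemma aspan_filter_base: "f \<in> X \<Longrightarrow> P f \<Longrightarrow> M f \<in> aspan M {g\<in>X. P g}"
  by (rule aspan_base) blast

lemma pframe_shift:
  assumes "pframe n L M" "f \<in> Zvec n" "k < n"
  obtains s where "M f * M (uvec k) ^ m = qp s * M (f + svec (int m) k)"
proof -
  have "M f * M (uvec k) ^ m = qp (- corr L f k (int m)) * M (f + svec (int m) k)"
    unfolding pframe_split[OF assms] by (simp add: qp_merge)
  then show thesis by (rule that)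
qed

lemma commute_inverse: "x * y = y * x \<Longrightarrow> x * inverse y = inverse y * x" for x y :: 'k
  by (cases "y = 0") (simp_all, metis left_inverse mult.assoc mult.right_neutral mult_1 right_inverse)

end

context cluster
begin

text \<open>New monomials with nonnegative exponent at \<open>k\<close> need no inverse of the new
  variable, so they can be expanded in the old torus.\<close>

lemma mutated_pos:
  assumes S: "seed M L B" and k: "k \<in> ex" and m: "mutates k M L B M' L' B'" and S': "seed M' L' B'"
    and f: "f \<in> Zvec n" "f k \<ge> 0"
  obtains s where "M' f = qp s * (M (f(k := 0)) * M' (uvec k) ^ nat (f k))"
proof -
  have "f = f(k := 0) + svec (int (nat (f k))) k" using fun_upd_split[of f k] f(2) by simp
  then have "M' f = M' (f(k := 0) + svec (int (nat (f k))) k)" by (rule arg_cong)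
  also have "\<dots> = qp (corr L' (f(k := 0)) k (int (nat (f k)))) * (M' (f(k := 0)) * M' (uvec k) ^ nat (f k))"
    by (rule pframe_split[OF seed_pframe[OF S'] Zvec_upd[OF f(1)] ex_less[OF k]])
  also have "M' (f(k := 0)) = M (f(k := 0))"
    by (rule mutates_agree[OF S k m seed_pframe[OF S'] Zvec_upd[OF f(1)]]) simp
  finally show thesis by (rule that)
qed

lemma exchange_in:
  assumes S: "seed M L B" and k: "k \<in> ex" and m: "mutates k M L B M' L' B'"
    and P: "P (- uvec k + posp (col B k))" "P (- uvec k + posp (- col B k))"
  shows "M' (uvec k) \<in> aspan M {f\<in>Zvec n. P f}"
proof -
  have Z: "- uvec k + posp (col B k) \<in> Zvec n" "- uvec k + posp (- col B k) \<in> Zvec n" using k by simp_all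
  show ?thesis
    unfolding mutates_exchange[OF m]
    by (intro aspan_add aspan_base CollectI conjI Z P)
qed

lemma exchange_degree:
  assumes S: "seed M L B" and k: "k \<in> ex" and m: "mutates k M L B M' L' B'"
  shows "M' (uvec k) \<in> aspan M {f\<in>Zvec n. f k = -1}"
  by (rule exchange_in[OF S k m]) (use dskew_diag[OF seed_dskew[OF S] k] k in \<open>simp_all add: posp_apply\<close>)

lemma exchange_pow_degree:
  assumes S: "seed M L B" and k: "k \<in> ex" and m: "mutates k M L B M' L' B'"
  shows "M' (uvec k) ^ j \<in> aspan M {f\<in>Zvec n. f k = - int j}"
  by (rule aspan_pow[OF seed_pframe[OF S] exchange_degree[OF S k m], of "\<lambda>j f. f k = - int j"]) simp_all

lemma mutated_degree:
  assumes S: "seed M L B" and k: "k \<in> ex" and m: "mutates k M L B M' L' B'" and S': "seed M' L' B'"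
    and f: "f \<in> Zvec n" "f k \<ge> 0"
  shows "M' f \<in> aspan M {g\<in>Zvec n. g k = - f k}"
proof -
  obtain s where s: "M' f = qp s * (M (f(k := 0)) * M' (uvec k) ^ nat (f k))"
    using mutated_pos[OF S k m S' f] .
  have "M (f(k := 0)) \<in> aspan M {g\<in>Zvec n. g k = 0}"
    by (rule aspan_filter_base[of "f(k := 0)", OF Zvec_upd[OF f(1)]]) simp
  from aspan_filter_mult[OF seed_pframe[OF S] this exchange_pow_degree[OF S k m]]
  have "M (f(k := 0)) * M' (uvec k) ^ nat (f k) \<in> aspan M {g\<in>Zvec n. g k = - f k}"
    using f(2) by simp
  then show ?thesis unfolding s by (rule aspan_scale[OF qp_in])
qed

text \<open>\<open>J\<close> lists the indices of invertible variables; in the end it is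
  \<open>ex \<union> invs\<close>.\<close>

definition pos_off :: "nat set \<Rightarrow> (nat \<Rightarrow> int) \<Rightarrow> bool" where
  "pos_off J f \<longleftrightarrow> (\<forall>a<n. a \<notin> J \<longrightarrow> f a \<ge> 0)"

lemma exchange_pos_off:
  assumes S: "seed M L B" and k: "k \<in> ex" and m: "mutates k M L B M' L' B'" and J: "ex \<subseteq> J"
  shows "M' (uvec k) \<in> aspan M {f\<in>Zvec n. pos_off J f}"
proof (rule exchange_in[OF S k m])
  have "a \<noteq> k" if "a \<notin> J" for a using that J k by blast
  then show "pos_off J (- uvec k + posp (col B k))" "pos_off J (- uvec k + posp (- col B k))"
    by (simp_all add: pos_off_def posp_apply)
qed

lemma mutated_pos_off:
  assumes S: "seed M L B" and k: "k \<in> ex" and m: "mutates k M L B M' L' B'" and S': "seed M' L' B'" and J: "ex \<subseteq> J"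
    and f: "f \<in> Zvec n" "f k \<ge> 0" "pos_off J f"
  shows "M' f \<in> aspan M {g\<in>Zvec n. pos_off J g}"
proof -
  obtain s where s: "M' f = qp s * (M (f(k := 0)) * M' (uvec k) ^ nat (f k))"
    using mutated_pos[OF S k m S' f(1,2)] .
  have "pos_off J (f(k := 0))" using f(3) by (simp add: pos_off_def)
  then have 1: "M (f(k := 0)) \<in> aspan M {g\<in>Zvec n. pos_off J g}"
    by (rule aspan_filter_base[of "f(k := 0)", OF Zvec_upd[OF f(1)]])
  have 2: "M' (uvec k) ^ nat (f k) \<in> aspan M {g\<in>Zvec n. pos_off J g}"
    by (rule aspan_pow[OF seed_pframe[OF S] exchange_pos_off[OF S k m J], of "\<lambda>_. pos_off J"]) (simp_all add: pos_off_def)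
  have "M (f(k := 0)) * M' (uvec k) ^ nat (f k) \<in> aspan M {g\<in>Zvec n. pos_off J g}"
    by (rule aspan_filter_mult[OF seed_pframe[OF S] 1 2]) (simp add: pos_off_def)
  then show ?thesis unfolding s by (rule aspan_scale[OF qp_in])
qed

text \<open>The power commutes with all monomials of the new frame, its commutation factors being
  \<open>l\<close>-th powers of powers of \<open>q\<close>. The old variables are new ones, except
  the \<open>k\<close>-th, which the reversed exchange relation writes as a sum of two new
  monomials.\<close>

lemma exchange_pow_central:
  assumes S: "seed M L B" and k: "k \<in> ex" and m: "mutates k M L B M' L' B'" and S': "seed M' L' B'"
    and t: "t \<in> aspan M (Zvec n)"
  shows "M' (uvec k) ^ l * t = t * M' (uvec k) ^ l"
proof -
  let ?u = "M' (uvec k) ^ l"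
  have c': "?u * M' f = M' f * ?u" if "f \<in> Zvec n" for f
    by (rule frame_pow_l_comm[OF seed_frame[OF S'] _ that]) (use k in simp)
  have Z: "f \<in> Zvec n" if "\<forall>i. i \<notin> {..<n} \<longrightarrow> f i = 0" for f
    using that by (simp add: Zvec_def)
  have c: "?u * M f = M f * ?u" if f: "f \<in> Zvec n" for f
  proof -
    have "finite {..<n}" "\<forall>i. i \<notin> {..<n} \<longrightarrow> f i = 0" using f by (simp_all add: Zvec_def)
    then show ?thesis
    proof (induction f rule: support_induct)
      case zero
      show ?case by (simp only: pframe_0[OF seed_pframe[OF S]] mult_1 mult_1_right)
    next
      case (add f g)
      have "?u * (M f * M g) = M f * M g * ?u" by (metis add(3,4) mult.assoc)
      then show ?case
        unfolding pframe_add[OF seed_pframe[OF S] Z[OF add(1)] Z[OF add(2)]] by (simp add: qp_simps)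
    next
      case (uminus f)
      show ?case
        unfolding pframe_uminus'[OF seed_pframe[OF S] Z[OF uminus(1)]]
        using commute_inverse[OF uminus(2)] by (simp add: qp_simps)
    next
      case (gen a)
      then have a: "a < n" by simp
      show ?case
      proof (cases "a = k")
        case True
        have Z1: "- uvec k + posp (col B' k) \<in> Zvec n" "- uvec k + posp (- col B' k) \<in> Zvec n" using k by simp_all
        show ?thesis
          unfolding True mutates_exchange[OF mutates_sym[OF S k m S']]
          by (simp only: distrib_left distrib_right c'[OF Z1(1)] c'[OF Z1(2)])
      next
        case False
        show ?thesis using c'[of "uvec a"] mutates_other[OF m a False] a by simp
      qed
    qed
  qed
  obtain S0 c0 where S0: "finite S0" "S0 \<subseteq> Zvec n" "\<And>f. f \<in> S0 \<Longrightarrow> c0 f \<in> A" "t = (\<Sum>f\<in>S0. c0 f * M f)"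
    using t by (rule aspanE) blast
  have "?u * (c0 f * M f) = c0 f * M f * ?u" if "f \<in> S0" for f
    using c[of f] A_comm[OF S0(3)[OF that], of ?u] S0(2) that by (metis mult.assoc subsetD)
  then show ?thesis unfolding S0(4) by (simp add: sum_distrib_left sum_distrib_right)
qed

text \<open>Needed when a path backtracks: two mutations in the same direction return to the
  original frame.\<close>

lemma mutates_unique:
  assumes S: "seed M L B" and m: "mutates k M L B M1 L1 B1" "mutates k M L B M2 L2 B2"
    and S12: "seed M1 L1 B1" "seed M2 L2 B2" and f: "f \<in> Zvec n"
  shows "M1 f = M2 f"
proof (rule pframe_agree[OF seed_pframe[OF S12(1)] seed_pframe[OF S12(2)], of "{..<n}"])
  fix f g :: "nat \<Rightarrow> int"
  assume "\<forall>i. i \<notin> {..<n} \<longrightarrow> f i = 0" "\<forall>i. i \<notin> {..<n} \<longrightarrow> g i = 0"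
  then have "f \<in> Zvec n" "g \<in> Zvec n" by (simp_all add: Zvec_def)
  then show "[L1 f g = L2 f g] (mod int l)"
    using mutates_cong[OF m(1)] mutates_cong[OF m(2)] cong_sym cong_trans by blast
next
  fix i assume "i \<in> {..<n}"
  then show "M1 (uvec i) = M2 (uvec i)"
    using mutates_other[OF m(1)] mutates_other[OF m(2)] mutates_exchange[OF m(1)] mutates_exchange[OF m(2)]
    by (cases "i = k") simp_all
next
  show "\<forall>i. i \<notin> {..<n} \<longrightarrow> f i = 0" using f by (simp add: Zvec_def)
qed simp

lemma corr_cong:
  assumes "[L1 f (uvec k) = L2 f (uvec k)] (mod int l)" "[L1 (uvec k) (uvec k) = L2 (uvec k) (uvec k)] (mod int l)"
  shows "qp (corr L1 f k m) = qp (corr L2 f k m)"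
  unfolding corr_def by (intro qp_cong cong_diff cong_scalar_left assms)

text \<open>Here \<open>M2 (e j) = \<beta> + r\<close> where only the monomial \<open>r\<close> involves the \<open>i\<close>-th variable of \<open>M1\<close>. Replacing
  \<open>M2 (e j)\<close> by \<open>\<beta>\<close> turns \<open>M2\<close> into a monomial change of \<open>M1\<close>, under which the \<open>i\<close>-th column of \<open>B2\<close>
  becomes that of \<open>B1\<close>; hence \<open>M3 (e i)\<close> is a monomial times \<open>M0 (e i)\<close> up to lower terms.\<close>

lemma connected_leads:
  assumes S1: "seed M1 L1 B1" and ij: "i \<in> ex" "j \<in> ex" "i \<noteq> j"
    and m0: "mutates i M1 L1 B1 M0 L0 B0" and S0: "seed M0 L0 B0"
    and m2: "mutates j M1 L1 B1 M2 L2 B2" and S2: "seed M2 L2 B2"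
    and m3: "mutates i M2 L2 B2 M3 L3 B3"
    and c: "B1 i j \<noteq> 0"
  obtains h h' where "lead n M0 (\<lambda>f. f i) (M2 (uvec j)) h" "lead n M0 (\<lambda>f. f i) (M3 (uvec i)) h'"
proof -
  note ds1 = seed_dskew[OF S1] and pf1 = seed_pframe[OF S1] and pf0 = seed_pframe[OF S0] and pf2 = seed_pframe[OF S2]
  note m1 = mutates_sym[OF S1 ij(1) m0 S0]
  have n: "i < n" "j < n" using ij by simp_all
  have B2: "B2 = mutB B1 j" by (rule mutates_B[OF m2])
  have ds2: "dskew B2" by (rule seed_dskew[OF S2])
  let ?a = "col B1 j" let ?b1 = "col B1 i" let ?b2 = "col B2 i"
  have diag: "B1 i i = 0" "B1 j j = 0" "B2 i i = 0"
    using dskew_diag[OF ds1 ij(1)] dskew_diag[OF ds1 ij(2)] dskew_diag[OF ds2 ij(1)] by simp_all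
  have sgn1: "B1 i j > 0 \<longleftrightarrow> B1 j i < 0" "B1 j i > 0 \<longleftrightarrow> B1 i j < 0"
    using dskew_pos_iff[OF ds1 ij(1,2)] dskew_pos_iff[OF ds1 ij(2,1)] by simp_all
  \<comment> \<open>\<open>q0\<close> is the half of column \<open>j\<close> that vanishes at
    \<open>i\<close>. With this sign the correction coefficient in \<open>col_mutB\<close> is 0, so
    \<open>reflect q0 j\<close> carries column \<open>i\<close> of \<open>B1\<close> to that of
    \<open>B2\<close>.\<close>
  define q0 where "q0 = (if B1 i j > 0 then posp (- ?a) else posp ?a)"
  define q1 where "q1 = (if B1 i j > 0 then posp ?a else posp (- ?a))"
  have qZ: "q0 \<in> Zvec n" "q1 \<in> Zvec n" by (simp_all add: q0_def q1_def)
  have q0i: "q0 i = 0" and q0j: "q0 j = 0" and q1i: "q1 i > 0"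
    using c n diag by (auto simp: q0_def q1_def posp_apply)
  let ?E = "reflect q0 j"
  have Econg: "[L2 f g = L1 (?E f) (?E g)] (mod int l)" if "f \<in> Zvec n" "g \<in> Zvec n" for f g
    using mutates_cong[OF m2 that] mutates_cong'[OF S1 ij(2) m2 that] by (simp add: q0_def)
  have b2: "?b2 = ?E ?b1"
  proof (cases "B1 i j > 0")
    case True
    then have "max 0 (B1 j i) = 0" using sgn1 by simp
    moreover have "?b1 + smul 0 ?a = ?b1" by (rule ext) simp
    ultimately show ?thesis
      using col_mutB(1)[OF ds1 ij(2,3)] True by (simp only: B2 q0_def if_True)
  next
    case False
    then have "max 0 (- B1 j i) = 0" using sgn1 c by simp
    moreover have "?b1 + smul 0 ?a = ?b1" by (rule ext) simp
    ultimately show ?thesis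
      using col_mutB(2)[OF ds1 ij(2,3)] False by (simp only: B2 q0_def if_False)
  qed
  have Eb2: "?E ?b2 = ?b1" unfolding b2 by (rule reflect_reflect[of q0 j, OF q0j])
  define \<beta> where "\<beta> = M1 (- uvec j + q0)"
  define r where "r = M1 (- uvec j + q1)"
  have x2: "M2 (uvec j) = \<beta> + r"
    unfolding mutates_exchange[OF m2] \<beta>_def r_def by (simp add: q0_def q1_def add.commute)
  have \<beta>Z: "- uvec j + q0 \<in> Zvec n" "- uvec j + q1 \<in> Zvec n" using qZ n by simp_all
  have \<beta>in: "\<beta> \<in> aspan M1 {g\<in>Zvec n. g i = 0}"
    unfolding \<beta>_def by (rule aspan_filter_base[of "- uvec j + q0", OF \<beta>Z(1)]) (use q0i ij in simp)
  have rin: "r \<in> aspan M1 {g\<in>Zvec n. g i > 0}"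
    unfolding r_def by (rule aspan_filter_base[of "- uvec j + q1", OF \<beta>Z(2)]) (use q1i ij in simp)
  \<comment> \<open>The degree in the \<open>i\<close>-th variable changes sign between
    \<open>M1\<close> and \<open>M0\<close>. For \<open>e\<close> equal to 0 or 1 the exponents are
    nonnegative, as \<open>mutated_degree\<close> requires.\<close>
  have lower: "y \<in> aspan M0 {g\<in>Zvec n. g i < e}"
    if y: "y \<in> aspan M1 {g\<in>Zvec n. g i > - e}" and e: "e \<in> {0, 1}" for y e
  proof (rule aspan_subset[OF y])
    fix f assume "f \<in> {g\<in>Zvec n. g i > - e}"
    then have f: "f \<in> Zvec n" "f i > - e" "f i \<ge> 0" using e by auto
    show "M1 f \<in> aspan M0 {g\<in>Zvec n. g i < e}"
      by (rule aspan_filter_mono[OF mutated_degree[OF S0 ij(1) m1 S1 f(1,3)]]) (use f(2) in simp)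
  qed
  have agree0: "M1 f = M0 f" if "f \<in> Zvec n" "f i = 0" for f
    by (rule mutates_agree[OF S0 ij(1) m1 pf1 that])
  have l1: "lead n M0 (\<lambda>f. f i) (M2 (uvec j)) (- uvec j + q0)"
  proof -
    have 0: "(- uvec j + q0) i = 0" using q0i ij by simp
    have "\<beta> = M0 (- uvec j + q0)" unfolding \<beta>_def by (rule agree0[OF \<beta>Z(1) 0])
    moreover have "r \<in> aspan M0 {g\<in>Zvec n. g i < 0}" by (rule lower) (use rin in simp_all)
    ultimately show ?thesis
      unfolding x2 by (simp only:) (rule lead_add[OF lead_base[OF \<beta>Z(1)]], simp only: 0)
  qed
  \<comment> \<open>\<open>Qm\<close> is the half of column \<open>i\<close> of \<open>B2\<close>
    without the index \<open>j\<close>; only \<open>Qp\<close> can involve the variable that is a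
    binomial in \<open>M1\<close>.\<close>
  define Qp where "Qp = (if ?b2 j > 0 then posp ?b2 else posp (- ?b2))"
  define Qm where "Qm = (if ?b2 j > 0 then posp (- ?b2) else posp ?b2)"
  have x3: "M3 (uvec i) = M2 (- uvec i + Qp) + M2 (- uvec i + Qm)"
    unfolding mutates_exchange[OF m3] by (simp add: Qp_def Qm_def add.commute)
  have QZ: "Qp \<in> Zvec n" "Qm \<in> Zvec n" by (simp_all add: Qp_def Qm_def)
  have Qi: "Qp i = 0" "Qm i = 0" using diag n by (simp_all add: Qp_def Qm_def posp_apply)
  have Qmj: "Qm j = 0" by (simp add: Qm_def posp_apply)
  have Qpj: "Qp j \<ge> 0" by (simp add: Qp_def posp_apply)
  have fZ: "- uvec i + Qp \<in> Zvec n" "- uvec i + Qm \<in> Zvec n" using QZ n by simp_all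
  define f where "f = (- uvec i + Qp)(j := 0)"
  define m where "m = nat (Qp j)"
  have fz: "f \<in> Zvec n" "f j = 0" unfolding f_def by (rule Zvec_upd[OF fZ(1)], simp)
  have fi: "f i = -1" using ij Qi by (simp add: f_def)
  have split: "- uvec i + Qp = f + svec (int m) j"
    using fun_upd_split[of "- uvec i + Qp" j] Qpj ij by (simp add: f_def m_def)
  have t1: "M2 (- uvec i + Qp) = qp (corr L2 f j (int m)) * (M1 f * (\<beta> + r) ^ m)"
    using pframe_split[OF pf2 fz(1) n(2), of m] mutates_agree[OF S1 ij(2) m2 pf2 fz]
    by (simp only: split x2)
  let ?L = "\<lambda>f g. L1 (?E f) (?E g)"
  have EZ: "?E f \<in> Zvec n" if "f \<in> Zvec n" for f using that qZ(1) n by simp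
  have pfE: "pframe n ?L (\<lambda>f. M1 (?E f))"
    unfolding pframe_def
    using biadd_reflect[OF seed_biadd[OF S1]] pframe_0[OF pf1] pframe_mult[OF pf1 EZ EZ] 
    by (simp only: reflect_0 reflect_add) blast
  have Ef: "?E f = f" by (rule reflect_fix[of f j, OF fz(2)])
  have t2: "M1 (?E (- uvec i + Qp)) = qp (corr ?L f j (int m)) * (M1 f * \<beta> ^ m)"
    using pframe_split[OF pfE fz(1) n(2), of m] by (simp only: split Ef reflect_uvec \<beta>_def)
  have cc: "qp (corr ?L f j (int m)) = qp (corr L2 f j (int m))"
    by (rule corr_cong; rule cong_sym; rule Econg) (use fz n in simp_all)
  define R where "R = qp (corr L2 f j (int m)) * (M1 f * ((\<beta> + r) ^ m - \<beta> ^ m))"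
  have t3: "M2 (- uvec i + Qp) = M1 (?E (- uvec i + Qp)) + R"
    unfolding t1 t2 cc R_def by (simp add: algebra_simps)
  \<comment> \<open>The factor \<open>M1 f\<close> has degree -1 at \<open>i\<close>, the difference
    of powers has degree at least 1.\<close>
  have Rin: "R \<in> aspan M1 {g\<in>Zvec n. g i \<ge> 0}"
    unfolding R_def
  proof (rule aspan_scale[OF qp_in])
    have "M1 f \<in> aspan M1 {g\<in>Zvec n. g i = -1}" by (rule aspan_filter_base[of f, OF fz(1)]) (rule fi)
    from aspan_filter_mult[OF pf1 this aspan_pow_diff[OF pf1 zlinear_coord \<beta>in rin]]
    show "M1 f * ((\<beta> + r) ^ m - \<beta> ^ m) \<in> aspan M1 {g\<in>Zvec n. g i \<ge> 0}" by simp
  qed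
  let ?P1 = "posp ?b1" let ?N1 = "posp (- ?b1)"
  \<comment> \<open>After the change \<open>?E\<close> the two exponents of the binomial for
    \<open>M3 (uvec i)\<close> differ by column \<open>i\<close> of \<open>B1\<close> up to sign. So
    they are the exponents of the binomial for \<open>M0 (uvec i)\<close>, shifted by a common
    vector \<open>h\<close>.\<close>
  define h where "h = (if ?b2 j > 0 then Qm - ?N1 else Qm - ?P1)"
  have hZ: "h \<in> Zvec n" using QZ by (simp add: h_def)
  have hi: "h i = 0" using Qi diag n by (simp add: h_def posp_apply)
  have EQ: "?E (- uvec i + Qp) = - uvec i + (Qm + (if ?b2 j > 0 then ?b1 else - ?b1))"
  proof -
    have "Qp = Qm + (if ?b2 j > 0 then ?b2 else - ?b2)"
      using posp_split[of ?b2] posp_split[of "- ?b2"] by (simp add: Qp_def Qm_def)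
    moreover have "?E (- uvec i) = - uvec i" by (rule reflect_fix) (use ij in simp)
    moreover have "?E Qm = Qm" by (rule reflect_fix[of Qm j, OF Qmj])
    ultimately show ?thesis using Eb2
      by (cases "?b2 j > 0") (simp_all only: if_True if_False reflect_add reflect_uminus)
  qed
  have sum: "M1 (?E (- uvec i + Qp)) + M1 (- uvec i + Qm) = M1 (h + (- uvec i + ?P1)) + M1 (h + (- uvec i + ?N1))"
  proof (cases "?b2 j > 0")
    case True
    have e: "- uvec i + (Qm + ?b1) = h + (- uvec i + ?P1)" "- uvec i + Qm = h + (- uvec i + ?N1)"
      using True posp_split[of ?b1] by (simp_all add: h_def algebra_simps)
    show ?thesis unfolding EQ by (simp only: True if_True e)
  next
    case False
    have e: "- uvec i + (Qm + - ?b1) = h + (- uvec i + ?N1)" "- uvec i + Qm = h + (- uvec i + ?P1)"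
      using False posp_split[of "- ?b1"] by (simp_all add: h_def algebra_simps)
    show ?thesis unfolding EQ by (simp only: False if_False e) (rule add.commute)
  qed
  have PZ: "- uvec i + ?P1 \<in> Zvec n" "- uvec i + ?N1 \<in> Zvec n" using n by simp_all
  \<comment> \<open>Because \<open>h i = 0\<close>, factoring out \<open>M1 h\<close> costs the same
    power of \<open>q\<close> in both terms.\<close>
  have "[L1 h ?b1 = 0] (mod int l)"
  proof -
    have "[L1 h ?b1 = - L1 ?b1 h] (mod int l)" by (rule frame_skew[OF seed_frame[OF S1] hZ]) simp
    moreover have "[L1 ?b1 h = 0] (mod int l)" using compatD[OF seed_compat[OF S1] ij(1) hZ] hi by simp
    ultimately show ?thesis by (metis cong_minus_minus_iff cong_trans minus_zero)
  qed
  moreover have "L1 h (- uvec i + ?P1) = L1 h (- uvec i + ?N1) + L1 h ?b1"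
    using arg_cong[OF posp_split[of ?b1], of "L1 h"] by (simp only: biaddD[OF seed_biadd[OF S1]])
  ultimately have Lh: "[- L1 h (- uvec i + ?P1) = - L1 h (- uvec i + ?N1)] (mod int l)"
    by (metis add.right_neutral cong_add cong_minus_minus_iff cong_refl)
  have "M1 (h + (- uvec i + ?P1)) + M1 (h + (- uvec i + ?N1))
      = qp (- L1 h (- uvec i + ?N1)) * (M1 h * (M1 (- uvec i + ?P1) + M1 (- uvec i + ?N1)))"
    unfolding pframe_add[OF pf1 hZ PZ(1)] pframe_add[OF pf1 hZ PZ(2)] qp_cong[OF Lh]
    by (simp only: distrib_left)
  also have "M1 (- uvec i + ?P1) + M1 (- uvec i + ?N1) = M0 (uvec i)"
    using mutates_exchange[OF m0] by simp
  also have "M1 h = M0 h" by (rule agree0[OF hZ hi])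
  finally have sum2: "M1 (h + (- uvec i + ?P1)) + M1 (h + (- uvec i + ?N1))
      = qp (- L1 h (- uvec i + ?N1)) * (M0 h * M0 (uvec i))" .
  have "M2 (- uvec i + Qm) = M1 (- uvec i + Qm)"
    by (rule mutates_agree[OF S1 ij(2) m2 pf2 fZ(2)]) (use Qmj ij in simp)
  then have x3': "M3 (uvec i) = qp (- L1 h (- uvec i + ?N1)) * (M0 h * M0 (uvec i)) + R"
    unfolding x3 t3 sum2[symmetric] sum[symmetric] by (simp add: algebra_simps)
  have "lead n M0 (\<lambda>f. f i) (M0 h * M0 (uvec i)) (h + uvec i)"
    by (rule lead_mult[OF pf0 zlinear_coord lead_base[OF hZ] lead_base[OF Zvec_uvec[OF n(1)]]])
  moreover have "R \<in> aspan M0 {g\<in>Zvec n. g i < 1}"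
    by (rule lower) (use aspan_filter_mono[OF Rin, of "\<lambda>g. g i > - 1"] in simp_all)
  moreover have "(h + uvec i) i = 1" using hi by simp
  ultimately have "lead n M0 (\<lambda>f. f i) (M3 (uvec i)) (h + uvec i)"
    unfolding x3' by (intro lead_add lead_qp) simp_all
  with l1 show thesis by (rule that)
qed

text \<open>Mutation at \<open>j\<close> leaves column \<open>i\<close> unchanged, so
  \<open>M3 (uvec i)\<close> is the monomial \<open>M0 (uvec i)\<close>. The variable
  \<open>M2 (uvec j)\<close> is a binomial in \<open>M0\<close> whose terms have degrees differing
  by \<open>\<delta> (col B1 j)\<close>, so one of them leads.\<close>

lemma disconnected_leads:
  assumes S1: "seed M1 L1 B1" and ij: "i \<in> ex" "j \<in> ex" "i \<noteq> j"
    and m0: "mutates i M1 L1 B1 M0 L0 B0" and S0: "seed M0 L0 B0"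
    and m2: "mutates j M1 L1 B1 M2 L2 B2" and S2: "seed M2 L2 B2"
    and m3: "mutates i M2 L2 B2 M3 L3 B3"
    and c: "B1 i j = 0" and ad: "zlinear \<delta>" and \<delta>: "\<delta> (col B1 j) \<noteq> 0"
  obtains h h' where "lead n M0 \<delta> (M2 (uvec j)) h" "lead n M0 \<delta> (M3 (uvec i)) h'"
proof -
  note ds1 = seed_dskew[OF S1] and pf1 = seed_pframe[OF S1] and pf2 = seed_pframe[OF S2]
  note m1 = mutates_sym[OF S1 ij(1) m0 S0]
  have n: "i < n" "j < n" using ij by simp_all
  have c': "B1 j i = 0" using c dskewD[OF ds1 ij(1,2)] d_pos[OF ij(2)] by simp
  let ?a = "col B1 j"
  have "col B2 i = reflect (posp (- ?a)) j (col B1 i + smul (max 0 (B1 j i)) ?a)"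
    unfolding mutates_B[OF m2] by (rule col_mutB(1)[OF ds1 ij(2,3)])
  also have "col B1 i + smul (max 0 (B1 j i)) ?a = col B1 i" by (rule ext) (simp add: c')
  also have "reflect (posp (- ?a)) j (col B1 i) = col B1 i" by (rule reflect_fix) (use n c' in simp)
  finally have b2: "col B2 i = col B1 i" .
  have "M2 f = M1 f" if "f \<in> Zvec n" "f j = 0" for f
    by (rule mutates_agree[OF S1 ij(2) m2 pf2 that])
  then have "M2 (- uvec i + posp (col B1 i)) = M1 (- uvec i + posp (col B1 i))"
    "M2 (- uvec i + posp (- col B1 i)) = M1 (- uvec i + posp (- col B1 i))"
    using n ij c' by (simp_all add: posp_apply)
  then have "M3 (uvec i) = M0 (uvec i)"
    unfolding mutates_exchange[OF m3] b2 mutates_exchange[OF m0] by simp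
  then have l3: "lead n M0 \<delta> (M3 (uvec i)) (uvec i)" using n by (simp add: lead_base)
  let ?w = "- uvec j + posp ?a" let ?w' = "- uvec j + posp (- ?a)"
  have wZ: "?w \<in> Zvec n" "?w' \<in> Zvec n" using n by simp_all
  have "M1 ?w = M0 ?w" "M1 ?w' = M0 ?w'"
    by (rule mutates_agree[OF S0 ij(1) m1 pf1], use wZ n ij c in \<open>simp_all add: posp_apply\<close>)+
  then have x2: "M2 (uvec j) = M0 ?w + M0 ?w'" unfolding mutates_exchange[OF m2] by simp
  have "\<delta> ?w = \<delta> ?w' + \<delta> ?a"
    using arg_cong[OF posp_split[of ?a], of \<delta>] by (simp only: zlinearD[OF ad])
  then consider "\<delta> ?w' < \<delta> ?w" | "\<delta> ?w < \<delta> ?w'" using \<delta> by linarith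
  then have "\<exists>h. lead n M0 \<delta> (M2 (uvec j)) h"
  proof cases
    case 1
    have "lead n M0 \<delta> (M0 ?w + M0 ?w') ?w"
      by (rule lead_add[OF lead_base[OF wZ(1)] aspan_filter_base[of ?w' _ "\<lambda>f. \<delta> f < \<delta> ?w", OF wZ(2) 1]])
    then show ?thesis unfolding x2 by blast
  next
    case 2
    have "lead n M0 \<delta> (M0 ?w' + M0 ?w) ?w'"
      by (rule lead_add[OF lead_base[OF wZ(2)] aspan_filter_base[of ?w _ "\<lambda>f. \<delta> f < \<delta> ?w'", OF wZ(1) 2]])
    then show ?thesis unfolding x2 by (subst add.commute) blast
  qed
  then show thesis using that l3 by blast
qed

text \<open>The condition on \<open>col B0 i\<close> gives both terms of the exchange binomial in
  direction \<open>i\<close> the same degree; this is the homogeneity of \<open>u\<close>.\<close>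

lemma chain_leads:
  assumes S1: "seed M1 L1 B1" and ij: "i \<in> ex" "j \<in> ex" "i \<noteq> j" and fr: "full_rank B1"
    and m0: "mutates i M1 L1 B1 M0 L0 B0" and S0: "seed M0 L0 B0"
    and m2: "mutates j M1 L1 B1 M2 L2 B2" and S2: "seed M2 L2 B2"
    and m3: "mutates i M2 L2 B2 M3 L3 B3"
  obtains \<delta> h h' where "zlinear \<delta>" "\<delta> (col B0 i) = 0" "lead n M0 \<delta> (M2 (uvec j)) h" "lead n M0 \<delta> (M3 (uvec i)) h'"
proof (cases "B1 i j = 0")
  case True
  obtain \<delta> where \<delta>: "zlinear \<delta>" "\<delta> (col B1 i) = 0" "\<delta> (col B1 j) \<noteq> 0"
    using full_rank_separate[OF fr ij] .
  have "col B0 i = - col B1 i"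
    unfolding mutates_B[OF m0] by (rule col_mutB_same[OF seed_dskew[OF S1] ij(1)])
  then have "\<delta> (col B0 i) = 0" using \<delta>(2) by (simp add: zlinearD[OF \<delta>(1)])
  then show thesis
    using disconnected_leads[OF S1 ij m0 S0 m2 S2 m3 True \<delta>(1,3)] that[OF \<delta>(1)] by metis
next
  case False
  have "col B0 i i = 0" using dskew_diag[OF seed_dskew[OF S0] ij(1)] ij by simp
  then show thesis
    using connected_leads[OF S1 ij m0 S0 m2 S2 m3 False] that[OF zlinear_coord[of i]] by metis
qed

end

section \<open>The Laurent phenomenon for exchange matrices of full rank\<close>

context cluster
begin

text \<open>A high enough power of the new variable clears the negative exponents at
  \<open>k\<close>. It is taken as a power of the \<open>l\<close>-th power, which is central.
  \<open>P\<close> is trivial in \<open>laurent_chain\<close> and a sign condition in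
  \<open>pos_off_descend\<close>.\<close>

lemma shift_pow_in:
  assumes S: "seed M L B" and k: "k \<in> ex" and m: "mutates k M L B M' L' B'" and S': "seed M' L' B'"
    and Y: "\<And>g. g \<in> Zvec n \<Longrightarrow> g k \<ge> 0 \<Longrightarrow> P g \<Longrightarrow> M' g \<in> aspan M Y"
    and P: "\<And>g c. P g \<Longrightarrow> P (g + svec c k)"
    and y: "y \<in> aspan M' {f\<in>Zvec n. P f}"
  obtains K where "y * (M' (uvec k) ^ l) ^ K \<in> aspan M Y"
proof -
  obtain K where K: "y \<in> aspan M' {f\<in>{f\<in>Zvec n. P f}. \<bar>f k\<bar> \<le> int K}"
    using y by (rule aspan_bound)
  have "y * M' (uvec k) ^ (l * K) \<in> aspan M Y"
  proof (rule aspan_mult_right[OF K])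
    fix f assume "f \<in> {f\<in>{f\<in>Zvec n. P f}. \<bar>f k\<bar> \<le> int K}"
    then have f: "f \<in> Zvec n" "P f" "\<bar>f k\<bar> \<le> int K" by blast+
    let ?g = "f + svec (int (l * K)) k"
    obtain s where s: "M' f * M' (uvec k) ^ (l * K) = qp s * M' ?g"
      using pframe_shift[OF seed_pframe[OF S'] f(1) ex_less[OF k]] .
    have "K \<le> l * K" using l_pos by simp
    then have "int K \<le> int (l * K)" by (simp only: of_nat_le_iff)
    moreover have "?g k = f k + int (l * K)" by (simp only: plus_fun_apply svec_same)
    ultimately have "?g k \<ge> 0" using f(3) by linarith
    moreover have "?g \<in> Zvec n" using f(1) k by simp
    ultimately have "M' ?g \<in> aspan M Y" using Y[of ?g] P[OF f(2)] by blast
    then show "M' f * M' (uvec k) ^ (l * K) \<in> aspan M Y"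
      unfolding s by (rule aspan_scale[OF qp_in])
  qed
  then show thesis using that[of K] by (simp add: power_mult)
qed

lemma laurent_chain:
  assumes S1: "seed M1 L1 B1" and ij: "i \<in> ex" "j \<in> ex" "i \<noteq> j" and fr: "full_rank B1"
    and m0: "mutates i M1 L1 B1 M0 L0 B0" and S0: "seed M0 L0 B0"
    and m2: "mutates j M1 L1 B1 M2 L2 B2" and S2: "seed M2 L2 B2"
    and m3: "mutates i M2 L2 B2 M3 L3 B3" and S3: "seed M3 L3 B3"
    and y1: "y \<in> aspan M1 (Zvec n)" and y3: "y \<in> aspan M3 (Zvec n)"
  shows "y \<in> aspan M0 (Zvec n)"
proof -
  note m1 = mutates_sym[OF S1 ij(1) m0 S0] and pf0 = seed_pframe[OF S0] and F0 = seed_frame[OF S0]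
  have n: "i < n" "j < n" using ij by simp_all
  let ?T = "aspan M0 (Zvec n)"
  let ?x = "M1 (uvec i)" let ?x2 = "M2 (uvec j)" let ?x3 = "M3 (uvec i)"
  let ?u = "?x ^ l"
  obtain \<delta> h h' where \<delta>: "zlinear \<delta>" "\<delta> (col B0 i) = 0"
    and l2: "lead n M0 \<delta> ?x2 h" and l3: "lead n M0 \<delta> ?x3 h'"
    using chain_leads[OF S1 ij fr m0 S0 m2 S2 m3] .
  define e where "e = \<delta> (- uvec i + posp (- col B0 i))"
  have "\<delta> (- uvec i + posp (col B0 i)) = e"
    using arg_cong[OF posp_split[of "col B0 i"], of \<delta>] \<delta>(2) unfolding e_def by (simp only: zlinearD[OF \<delta>(1)])
  then have xe: "?x \<in> aspan M0 {f\<in>Zvec n. \<delta> f = e}"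
    by (rule exchange_in[OF S0 ij(1) m1, of "\<lambda>f. \<delta> f = e"]) (rule e_def[symmetric])
  have ue: "?u \<in> aspan M0 {f\<in>Zvec n. \<delta> f = int l * e}"
    by (rule aspan_pow[OF pf0 xe, of "\<lambda>m f. \<delta> f = int m * e"]) (simp_all add: zlinearD[OF \<delta>(1)] algebra_simps)
  note uT = aspan_filter_all[OF ue]
  have u0: "?u \<noteq> 0" using pframe_nz[OF seed_pframe[OF S1] Zvec_uvec[OF n(1)]] by simp
  have uc: "?u * t = t * ?u" if "t \<in> ?T" for t
    by (rule exchange_pow_central[OF S0 ij(1) m1 S1 that])
  have in1: "M1 g \<in> ?T" if "g \<in> Zvec n" "g i \<ge> 0" for g
    by (rule aspan_filter_all[OF mutated_degree[OF S0 ij(1) m1 S1 that]])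
  have "y \<in> aspan M1 {f\<in>Zvec n. True}" using y1 by simp
  then obtain K where K: "y * ?u ^ K \<in> ?T"
    by (rule shift_pow_in[OF S0 ij(1) m1 S1, where P = "\<lambda>_. True" and Y = "Zvec n", rotated 2]) (use in1 in simp_all)
  have x2T: "?x2 \<in> ?T" by (rule lead_in[OF l2])
  have x3T: "?x3 \<in> ?T" by (rule lead_in[OF l3])
  note mult = aspan_all_mult[OF pf0] and pow = aspan_all_pow[OF pf0]
  \<comment> \<open>The powers of \<open>?x3\<close> and \<open>?x2\<close> are split off in turn;
    what is left is a monomial of \<open>M1\<close> with exponent 0 at \<open>i\<close>.\<close>
  have in3: "M3 g \<in> ?T" if g: "g \<in> Zvec n" "g i \<ge> 0" "g j \<ge> 0" for g
  proof -
    let ?g = "g(i := 0)"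
    have g': "?g \<in> Zvec n" "?g j \<ge> 0" using g ij by simp_all
    have g'': "?g(j := 0) \<in> Zvec n" "(?g(j := 0)) i = 0" using g ij by (simp, simp)
    obtain s where s: "M3 g = qp s * (M2 ?g * ?x3 ^ nat (g i))"
      using mutated_pos[OF S2 ij(1) m3 S3 g(1,2)] .
    obtain t where t: "M2 ?g = qp t * (M1 (?g(j := 0)) * ?x2 ^ nat (?g j))"
      using mutated_pos[OF S1 ij(2) m2 S2 g'] .
    have "M1 (?g(j := 0)) \<in> ?T" by (rule in1[OF g''(1)]) (simp only: g''(2))
    then have "M2 ?g \<in> ?T" unfolding t by (intro aspan_scale[OF qp_in] mult pow x2T)
    then show ?thesis unfolding s by (intro aspan_scale[OF qp_in] mult pow x3T)
  qed
  \<comment> \<open>A single bound for both exponents, so that the same power of each of the two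
    variables clears denominators.\<close>
  obtain K' where K': "y \<in> aspan M3 {f\<in>Zvec n. \<bar>\<bar>f i\<bar> + \<bar>f j\<bar>\<bar> \<le> int K'}"
    using y3 by (rule aspan_bound[where \<phi> = "\<lambda>f. \<bar>f i\<bar> + \<bar>f j\<bar>"])
  let ?v = "?x2 ^ K' * ?x3 ^ K'"
  have x23: "?x2 = M3 (uvec j)" using mutates_other[OF m3 n(2)] ij by simp
  have yv: "y * ?v \<in> ?T"
  proof (rule aspan_mult_right[OF K'])
    fix f assume "f \<in> {f\<in>Zvec n. \<bar>\<bar>f i\<bar> + \<bar>f j\<bar>\<bar> \<le> int K'}"
    then have f: "f \<in> Zvec n" "\<bar>f i\<bar> + \<bar>f j\<bar> \<le> int K'" by simp_all
    let ?f = "f + svec (int K') j" let ?g = "?f + svec (int K') i"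
    have fZ: "?f \<in> Zvec n" "?g \<in> Zvec n" using f(1) n by simp_all
    have gi: "?g i \<ge> 0" "?g j \<ge> 0" using f(2) ij by simp_all
    obtain s where s: "M3 f * M3 (uvec j) ^ K' = qp s * M3 ?f"
      using pframe_shift[OF seed_pframe[OF S3] f(1) n(2)] .
    obtain t where t: "M3 ?f * ?x3 ^ K' = qp t * M3 ?g"
      using pframe_shift[OF seed_pframe[OF S3] fZ(1) n(1)] .
    have "M3 f * ?v = M3 f * M3 (uvec j) ^ K' * ?x3 ^ K'" by (simp only: x23 mult.assoc)
    also have "\<dots> = qp s * (qp t * M3 ?g)" by (simp only: s mult.assoc t)
    finally show "M3 f * ?v \<in> ?T"
      by (simp only:) (intro aspan_scale[OF qp_in] in3[OF fZ(2) gi])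
  qed
  have rg: "regular_mod ?T ?u ?v"
    by (intro regular_mod_mult regular_mod_pow mult pow x2T x3T
        regular_mod_lead'[OF F0 \<delta>(1) ue l2] regular_mod_lead'[OF F0 \<delta>(1) ue l3])
  have one: "1 \<in> ?T" using aspan_base[OF Zvec_zero, of M0 n] by (simp only: pframe_0[OF pf0])
  have vT: "?v \<in> ?T" by (intro mult pow x2T x3T)
  show ?thesis
    by (rule regular_mod_div[OF u0 uc vT rg mult uT one yv K])
qed

text \<open>The positive and negative halves of a column have disjoint supports. So at
  \<open>a\<close> at least one exchange monomial has degree 0, and the lowest component is that
  monomial or, if the entry is 0, the whole binomial.\<close>

lemma exchange_lowest:
  assumes S: "seed M L B" and k: "k \<in> ex" and m: "mutates k M L B M' L' B'" and S': "seed M' L' B'"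
    and a: "a \<noteq> k"
  obtains w0 where "w0 \<in> aspan M {f\<in>Zvec n. f a = 0}" "w0 \<noteq> 0"
    "M' (uvec k) ^ N - w0 \<in> aspan M {f\<in>Zvec n. f a > 0}"
proof -
  let ?b = "col B k" let ?p = "- uvec k + posp ?b" let ?q = "- uvec k + posp (- ?b)"
  note pf = seed_pframe[OF S]
  have Z: "?p \<in> Zvec n" "?q \<in> Zvec n" using k by simp_all
  have pa: "?p a = max 0 (?b a)" "?q a = max 0 (- ?b a)" using a by (simp_all add: posp_apply)
  have x: "M' (uvec k) = M ?p + M ?q" by (rule mutates_exchange[OF m])
  have "\<exists>\<beta> r. M' (uvec k) = \<beta> + r \<and> \<beta> \<noteq> 0 \<and> \<beta> \<in> aspan M {f\<in>Zvec n. f a = 0} \<and> r \<in> aspan M {f\<in>Zvec n. f a > 0}"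
  proof -
    consider "?b a = 0" | "?b a > 0" | "?b a < 0" by linarith
    then show ?thesis
    proof cases
      case 1
      have "M' (uvec k) \<in> aspan M {f\<in>Zvec n. f a = 0}"
        by (rule exchange_in[OF S k m]) (use pa 1 in simp_all)
      moreover have "M' (uvec k) \<noteq> 0" by (rule pframe_nz[OF seed_pframe[OF S'] Zvec_uvec[OF ex_less[OF k]]])
      ultimately show ?thesis by (intro exI[of _ "M' (uvec k)"] exI[of _ 0]) simp
    next
      case 2
      have "M ?q \<in> aspan M {f\<in>Zvec n. f a = 0}"
        by (rule aspan_filter_base[of ?q, OF Z(2)]) (use pa 2 in simp)
      moreover have "M ?p \<in> aspan M {f\<in>Zvec n. f a > 0}"
        by (rule aspan_filter_base[of ?p, OF Z(1)]) (use pa 2 in simp)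
      moreover have "M' (uvec k) = M ?q + M ?p" unfolding x by (rule add.commute)
      ultimately show ?thesis using pframe_nz[OF pf Z(2)] by blast
    next
      case 3
      have "M ?p \<in> aspan M {f\<in>Zvec n. f a = 0}"
        by (rule aspan_filter_base[of ?p, OF Z(1)]) (use pa 3 in simp)
      moreover have "M ?q \<in> aspan M {f\<in>Zvec n. f a > 0}"
        by (rule aspan_filter_base[of ?q, OF Z(2)]) (use pa 3 in simp)
      ultimately show ?thesis using pframe_nz[OF pf Z(1)] x by blast
    qed
  qed
  then obtain \<beta> r where \<beta>: "M' (uvec k) = \<beta> + r" "\<beta> \<noteq> 0" "\<beta> \<in> aspan M {f\<in>Zvec n. f a = 0}" "r \<in> aspan M {f\<in>Zvec n. f a > 0}"
    by blast
  show thesis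
  proof (rule that)
    show "\<beta> ^ N \<in> aspan M {f\<in>Zvec n. f a = 0}"
      by (rule aspan_pow[OF pf \<beta>(3), of "\<lambda>_ f. f a = 0"]) simp_all
    show "\<beta> ^ N \<noteq> 0" using \<beta>(2) by simp
    show "M' (uvec k) ^ N - \<beta> ^ N \<in> aspan M {f\<in>Zvec n. f a > 0}"
      unfolding \<beta>(1) by (rule aspan_pow_diff[OF pf zlinear_coord \<beta>(3,4)])
  qed
qed

text \<open>For each index outside \<open>J\<close> separately: a power of the new variable times
  \<open>y\<close> has nonnegative degree, and that power has a nonzero component of degree 0, so
  \<open>aspan_nonneg_div\<close> applies to \<open>y\<close>. The exponents of a reduced expansion
  of \<open>y\<close> then satisfy all conditions at once.\<close>

lemma pos_off_descend:
  assumes S: "seed M L B" and k: "k \<in> ex" and m: "mutates k M L B M' L' B'" and S': "seed M' L' B'" and J: "ex \<subseteq> J"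
    and y: "y \<in> aspan M (Zvec n)" and y': "y \<in> aspan M' {f\<in>Zvec n. pos_off J f}"
  shows "y \<in> aspan M {f\<in>Zvec n. pos_off J f}"
proof -
  have P: "pos_off J (g + svec c k)" if "pos_off J g" for g c
    using that J k by (auto simp: pos_off_def svec_def)
  obtain K where K: "y * (M' (uvec k) ^ l) ^ K \<in> aspan M {f\<in>Zvec n. pos_off J f}"
    by (rule shift_pow_in[OF S k m S' mutated_pos_off[OF S k m S' J] P y'])
  obtain S0 c where S0: "finite S0" "S0 \<subseteq> Zvec n" "\<And>f. f \<in> S0 \<Longrightarrow> c f \<in> A" "\<And>f. f \<in> S0 \<Longrightarrow> c f \<noteq> 0"
    "y = (\<Sum>f\<in>S0. c f * M f)"
    using y by (rule aspan_reduced) blast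
  have "pos_off J f" if f: "f \<in> S0" for f
    unfolding pos_off_def
  proof (intro allI impI)
    fix a assume a: "a < n" "a \<notin> J"
    then have ak: "a \<noteq> k" using J k by blast
    obtain w0 where w0: "w0 \<in> aspan M {f\<in>Zvec n. f a = 0}" "w0 \<noteq> 0"
      "M' (uvec k) ^ (l * K) - w0 \<in> aspan M {f\<in>Zvec n. f a > 0}"
      by (rule exchange_lowest[OF S k m S' ak])
    obtain N where N: "y \<in> aspan M {f\<in>Zvec n. \<bar>f a\<bar> \<le> int N}" using y by (rule aspan_bound)
    have h1: "y \<in> aspan M {f\<in>Zvec n. f a \<ge> - int N}" by (rule aspan_filter_mono[OF N]) simp
    have h2: "y * M' (uvec k) ^ (l * K) \<in> aspan M {f\<in>Zvec n. f a \<ge> 0}"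
      using aspan_filter_mono[OF K, of "\<lambda>f. f a \<ge> 0"] a by (simp add: pos_off_def power_mult)
    have h3: "y \<in> aspan M {f\<in>Zvec n. f a \<ge> 0}"
      by (rule aspan_nonneg_div[OF seed_frame[OF S] zlinear_coord w0 h2 h1])
    have "S0 \<subseteq> {f\<in>Zvec n. f a \<ge> 0}"
      by (rule aspan_support[OF frame_free[OF seed_frame[OF S]] S0(1-4) h3[unfolded S0(5)]]) blast+
    then show "f a \<ge> 0" using f by blast
  qed
  then show ?thesis unfolding S0(5) by (intro aspanI S0) (use S0(2) in auto)
qed

fun mpath where
  "mpath [] (M, L, B) M' L' B' \<longleftrightarrow> M' = M \<and> L' = L \<and> B' = B"
| "mpath (k # ks) (M, L, B) M' L' B' \<longleftrightarrow> k \<in> ex \<and>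
    (\<exists>M1 L1 B1. mutates k M L B M1 L1 B1 \<and> seed M1 L1 B1 \<and> mpath ks (M1, L1, B1) M' L' B')"

text \<open>For a path \<open>i # j # ks2\<close> the induction hypothesis applies to
  \<open>j # ks2\<close> from \<open>M1\<close> and to \<open>i # ks2\<close> from the auxiliary
  seed \<open>M3\<close>, both shorter by one; \<open>laurent_chain\<close> joins the two
  expansions.\<close>

theorem laurent_full_rank:
  assumes "seed M L B" "full_rank B" "mpath ks (M, L, B) M' L' B'" "ex \<subseteq> J" "a < n"
  shows "M' (uvec a) \<in> aspan M {f\<in>Zvec n. pos_off J f}"
  using assms
proof (induction "length ks" arbitrary: ks M L B rule: less_induct)
  case less
  note S0 = less.prems(1) and fr0 = less.prems(2) and J = less.prems(4) and a = less.prems(5)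
  have base: "M (uvec a) \<in> aspan M {f\<in>Zvec n. pos_off J f}"
    by (rule aspan_filter_base[of "uvec a", OF Zvec_uvec[OF a]]) (simp add: pos_off_def uvec_def)
  show ?case
  proof (cases ks)
    case Nil
    then show ?thesis using less.prems(3) base by simp
  next
    case (Cons i ks1)
    then obtain M1 L1 B1 where i: "i \<in> ex" and m1: "mutates i M L B M1 L1 B1" and S1: "seed M1 L1 B1"
      and p1: "mpath ks1 (M1, L1, B1) M' L' B'"
      using less.prems(3) by auto
    have fr1: "full_rank B1"
      unfolding mutates_B[OF m1] by (rule full_rank_mutB[OF seed_dskew[OF S0] i fr0])
    note m0 = mutates_sym[OF S0 i m1 S1]
    have y1: "M' (uvec a) \<in> aspan M1 {f\<in>Zvec n. pos_off J f}"
      by (rule less.hyps[OF _ S1 fr1 p1 J a]) (simp add: Cons)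
    show ?thesis
    proof (cases ks1)
      case Nil
      then have M': "M' = M1" using p1 by simp
      show ?thesis
      proof (cases "a = i")
        case True
        show ?thesis unfolding True M' by (rule exchange_pos_off[OF S0 i m1 J])
      next
        case False
        show ?thesis unfolding M' mutates_other[OF m1 a False] by (rule base)
      qed
    next
      case C2: (Cons j ks2)
      then obtain M2 L2 B2 where j: "j \<in> ex" and m2: "mutates j M1 L1 B1 M2 L2 B2" and S2: "seed M2 L2 B2"
        and p2: "mpath ks2 (M2, L2, B2) M' L' B'"
        using p1 by auto
      have fr2: "full_rank B2"
        unfolding mutates_B[OF m2] by (rule full_rank_mutB[OF seed_dskew[OF S1] j fr1])
      show ?thesis
      proof (cases "i = j")
        \<comment> \<open>The path backtracks, so \<open>M2\<close> is the initial frame again and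
          the rest is shorter by two.\<close>
        case True
        have "M' (uvec a) \<in> aspan M2 {f\<in>Zvec n. pos_off J f}"
          by (rule less.hyps[OF _ S2 fr2 p2 J a]) (simp add: Cons C2)
        then show ?thesis
        proof (rule aspan_subset)
          fix f assume "f \<in> {f\<in>Zvec n. pos_off J f}"
          then have f: "f \<in> Zvec n" "pos_off J f" by blast+
          have "M2 f = M f"
            by (rule mutates_unique[OF S1 m2[folded True] m0 S2 S0 f(1)])
          then show "M2 f \<in> aspan M {f\<in>Zvec n. pos_off J f}"
            using aspan_filter_base[of f "Zvec n" "pos_off J" M, OF f] by simp
        qed
      next
        case False
        \<comment> \<open>This seed is not on the path; reversing its mutation leads back to
          \<open>M2\<close>, from where \<open>ks2\<close> continues.\<close>
        obtain M3 L3 B3 where m3: "mutates i M2 L2 B2 M3 L3 B3" and S3: "seed M3 L3 B3"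
          by (rule mutates_exists[OF S2 i fr2])
        have fr3: "full_rank B3"
          unfolding mutates_B[OF m3] by (rule full_rank_mutB[OF seed_dskew[OF S2] i fr2])
        have p3: "mpath (i # ks2) (M3, L3, B3) M' L' B'"
          using i mutates_sym[OF S2 i m3 S3] S2 p2 by auto
        have y3: "M' (uvec a) \<in> aspan M3 {f\<in>Zvec n. pos_off J f}"
          by (rule less.hyps[OF _ S3 fr3 p3 J a]) (simp add: Cons C2)
        have "M' (uvec a) \<in> aspan M (Zvec n)"
          by (rule laurent_chain[OF S1 i j False fr1 m0 S0 m2 S2 m3 S3 aspan_filter_all[OF y1] aspan_filter_all[OF y3]])
        then show ?thesis by (rule pos_off_descend[OF S0 i m1 S1 J _ y1])
      qed
    qed
  qed
qed

end

section \<open>Series with real exponents\<close>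

text \<open>Finiteness of the support below every bound makes each coefficient of a product a finite
  sum and lets geometric series be summed.\<close>

typedef (overloaded) 'a novikov = "{c :: real \<Rightarrow> 'a::zero. \<forall>r. finite {s. s \<le> r \<and> c s \<noteq> 0}}"
  morphisms ncoeff Novikov
  by (rule exI[of _ "\<lambda>_. 0"]) simp

lemma ncoeff_finite: "finite {s. s \<le> r \<and> ncoeff x s \<noteq> 0}"
  using ncoeff[of x] by simp

lemma novikov_eqI: "(\<And>r. ncoeff x r = ncoeff y r) \<Longrightarrow> x = y"
  by (metis ext ncoeff_inject)

lemma ncoeff_Novikov: "(\<And>r. finite {s. s \<le> r \<and> c s \<noteq> 0}) \<Longrightarrow> ncoeff (Novikov c) = c"
  by (rule Novikov_inverse) simp

text \<open>A lower bound instead of the valuation itself, so that \<open>0\<close> is no special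
  case.\<close>

definition vge :: "'a::zero novikov \<Rightarrow> real \<Rightarrow> bool" where
  "vge x r \<longleftrightarrow> (\<forall>s<r. ncoeff x s = 0)"

lemma vgeD: "vge x r \<Longrightarrow> ncoeff x s \<noteq> 0 \<Longrightarrow> r \<le> s"
  unfolding vge_def by (meson linorder_not_less)

lemma vge_exists: "\<exists>r. vge x r"
proof -
  let ?S = "{s. s \<le> 0 \<and> ncoeff x s \<noteq> 0}"
  have fin: "finite (insert 0 ?S)" using ncoeff_finite[of 0 x] by simp
  have "ncoeff x s = 0" if "s < Min (insert 0 ?S)" for s
  proof (rule ccontr)
    assume "ncoeff x s \<noteq> 0"
    moreover have "s < 0" using that Min_le[OF fin, of 0] by simp
    ultimately have "s \<in> insert 0 ?S" by simp
    then show False using that Min_le[OF fin] by fastforce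
  qed
  then show ?thesis unfolding vge_def by blast
qed

lemma ncoeff_finite_pairs: "finite {s. ncoeff x s \<noteq> 0 \<and> ncoeff y (r - s) \<noteq> 0}"
proof -
  obtain b where b: "vge y b" using vge_exists by blast
  have "{s. ncoeff x s \<noteq> 0 \<and> ncoeff y (r - s) \<noteq> 0} \<subseteq> {s. s \<le> r - b \<and> ncoeff x s \<noteq> 0}"
    using vgeD[OF b] by fastforce
  then show ?thesis using ncoeff_finite finite_subset by blast
qed

instantiation novikov :: (division_ring) "{zero, one, plus, minus, uminus, times}"
begin

definition "0 = Novikov (\<lambda>_. 0)"
definition "1 = Novikov (\<lambda>r. if r = 0 then 1 else 0)"
definition "x + y = Novikov (\<lambda>r. ncoeff x r + ncoeff y r)"
definition "x - y = Novikov (\<lambda>r. ncoeff x r - ncoeff y r)"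
definition "- x = Novikov (\<lambda>r. - ncoeff x r)"
definition "x * y = Novikov (\<lambda>r. \<Sum>s | ncoeff x s \<noteq> 0 \<and> ncoeff y (r - s) \<noteq> 0. ncoeff x s * ncoeff y (r - s))"

instance ..
end

definition nmonom :: "'a::division_ring \<Rightarrow> real \<Rightarrow> 'a novikov" where
  "nmonom a s = Novikov (\<lambda>r. if r = s then a else 0)"

lemma ncoeff_monom: "ncoeff (nmonom a s) r = (if r = s then a else 0)"
proof -
  have "finite {t. t \<le> r \<and> (if t = s then a else 0) \<noteq> 0}" for r
    by (rule finite_subset[of _ "{s}"]) auto
  then show ?thesis unfolding nmonom_def by (simp add: ncoeff_Novikov)
qed

lemma ncoeff_0 [simp]: "ncoeff 0 r = (0 :: 'a::division_ring)"
  unfolding zero_novikov_def by (simp add: ncoeff_Novikov)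

lemma one_nmonom: "1 = nmonom 1 0"
  by (simp add: one_novikov_def nmonom_def)

lemma ncoeff_1: "ncoeff (1 :: 'a::division_ring novikov) r = (if r = 0 then 1 else 0)"
  by (simp add: one_nmonom ncoeff_monom)

lemma ncoeff_add [simp]: "ncoeff (x + y) r = ncoeff x r + ncoeff (y :: 'a::division_ring novikov) r"
proof -
  have "finite {s. s \<le> r \<and> ncoeff x s + ncoeff y s \<noteq> 0}" for r
    by (rule finite_subset[OF _ finite_UnI[OF ncoeff_finite[of r x] ncoeff_finite[of r y]]]) auto
  then show ?thesis unfolding plus_novikov_def by (simp add: ncoeff_Novikov)
qed

lemma ncoeff_uminus [simp]: "ncoeff (- x) r = - ncoeff (x :: 'a::division_ring novikov) r"
  unfolding uminus_novikov_def using ncoeff_finite[of _ x] by (simp add: ncoeff_Novikov)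

lemma ncoeff_diff [simp]: "ncoeff (x - y) r = ncoeff x r - ncoeff (y :: 'a::division_ring novikov) r"
proof -
  have "finite {s. s \<le> r \<and> ncoeff x s - ncoeff y s \<noteq> 0}" for r
    by (rule finite_subset[OF _ finite_UnI[OF ncoeff_finite[of r x] ncoeff_finite[of r y]]]) auto
  then show ?thesis unfolding minus_novikov_def by (simp add: ncoeff_Novikov)
qed

text \<open>The freedom in \<open>S\<close> allows several products to be summed over a common index
  set. The product is well formed because below \<open>r\<close> only finitely many pairs of
  exponents can contribute.\<close>

lemma ncoeff_mult:
  fixes x y :: "'a::division_ring novikov"
  assumes "finite S" "\<And>s. ncoeff x s \<noteq> 0 \<Longrightarrow> ncoeff y (r - s) \<noteq> 0 \<Longrightarrow> s \<in> S"
  shows "ncoeff (x * y) r = (\<Sum>s\<in>S. ncoeff x s * ncoeff y (r - s))"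
proof -
  let ?c = "\<lambda>r. \<Sum>s | ncoeff x s \<noteq> 0 \<and> ncoeff y (r - s) \<noteq> 0. ncoeff x s * ncoeff y (r - s)"
  obtain a b where ab: "vge x a" "vge y b" using vge_exists by blast
  have "finite {s. s \<le> r \<and> ?c s \<noteq> 0}" for r
  proof (rule finite_subset)
    let ?X = "{s. s \<le> r - b \<and> ncoeff x s \<noteq> 0}" and ?Y = "{s. s \<le> r - a \<and> ncoeff y s \<noteq> 0}"
    show "finite ((\<lambda>(s, t). s + t) ` (?X \<times> ?Y))" using ncoeff_finite by (intro finite_imageI finite_cartesian_product)
    show "{s. s \<le> r \<and> ?c s \<noteq> 0} \<subseteq> (\<lambda>(s, t). s + t) ` (?X \<times> ?Y)"
    proof
      fix t assume "t \<in> {s. s \<le> r \<and> ?c s \<noteq> 0}"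
      then have t: "t \<le> r" "?c t \<noteq> 0" by simp_all
      have "\<exists>s. ncoeff x s \<noteq> 0 \<and> ncoeff y (t - s) \<noteq> 0"
      proof (rule ccontr)
        assume "\<not> ?thesis"
        then have "{s. ncoeff x s \<noteq> 0 \<and> ncoeff y (t - s) \<noteq> 0} = {}" by blast
        then have "?c t = 0" by (simp only: sum.empty)
        then show False using t(2) by blast
      qed
      then obtain s where s: "ncoeff x s \<noteq> 0" "ncoeff y (t - s) \<noteq> 0" by blast
      then have "a \<le> s" "b \<le> t - s" using vgeD ab by blast+
      then have "(s, t - s) \<in> ?X \<times> ?Y" using s t(1) by simp
      then show "t \<in> (\<lambda>(s, t). s + t) ` (?X \<times> ?Y)" by (rule rev_image_eqI) simp
    qed
  qed
  then have "ncoeff (x * y) r = ?c r" unfolding times_novikov_def by (simp add: ncoeff_Novikov)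
  also have "\<dots> = (\<Sum>s\<in>S. ncoeff x s * ncoeff y (r - s))"
    using assms by (intro sum.mono_neutral_left) auto
  finally show ?thesis .
qed

lemma ncoeff_monom_mult: "ncoeff (nmonom a s * x) r = a * ncoeff x (r - s)"
  by (subst ncoeff_mult[of "{s}"]) (auto simp: ncoeff_monom split: if_splits)

lemma ncoeff_mult_monom: "ncoeff (x * nmonom a s) r = ncoeff x (r - s) * a"
  by (subst ncoeff_mult[of "{r - s}"]) (auto simp: ncoeff_monom split: if_splits)

lemma vge_mult:
  assumes "vge x a" "vge (y :: 'a::division_ring novikov) b"
  shows "vge (x * y) (a + b)"
  unfolding vge_def
proof (intro allI impI)
  fix s assume s: "s < a + b"
  have "ncoeff (x * y) s = (\<Sum>t\<in>{}. ncoeff x t * ncoeff y (s - t))"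
    by (rule ncoeff_mult) (use vgeD[OF assms(1)] vgeD[OF assms(2)] s in fastforce)+
  then show "ncoeff (x * y) s = 0" by simp
qed

lemma novikov_mult_assoc: "x * y * z = x * (y * z)" for x y z :: "'a::division_ring novikov"
proof (rule novikov_eqI)
  fix r
  obtain a b c where v: "vge x a" "vge y b" "vge z c" using vge_exists by metis
  \<comment> \<open>With supports bounded below by \<open>a\<close>, \<open>b\<close>,
    \<open>c\<close>, larger exponents cannot contribute to the coefficient at \<open>r\<close>;
    these cutoffs make all sums finite and interchangeable.\<close>
  let ?S = "{s. s \<le> r - b - c \<and> ncoeff x s \<noteq> 0}" and ?U = "{t. t \<le> r - a - c \<and> ncoeff y t \<noteq> 0}"
  have fin: "finite ?S" "finite ?U" by (rule ncoeff_finite)+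
  define V where "V = (\<lambda>(s, t). s + t) ` (?S \<times> ?U)"
  have finV: "finite V" unfolding V_def using fin by (intro finite_imageI finite_cartesian_product)
  have VI: "s + t \<in> V" if "s \<in> ?S" "t \<in> ?U" for s t unfolding V_def using that by force
  have vyz: "vge (y * z) (b + c)" by (rule vge_mult[OF v(2,3)])
  have xy: "ncoeff (x * y) w = (\<Sum>s\<in>?S. ncoeff x s * ncoeff y (w - s))" if "w \<le> r - c" for w
  proof (rule ncoeff_mult[OF fin(1)])
    fix s assume s: "ncoeff x s \<noteq> 0" "ncoeff y (w - s) \<noteq> 0"
    then have "b \<le> w - s" using vgeD[OF v(2)] by blast
    then show "s \<in> ?S" using s that by simp
  qed
  have V: "w \<in> V" if w: "ncoeff (x * y) w \<noteq> 0" "ncoeff z (r - w) \<noteq> 0" for w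
  proof -
    have wr: "w \<le> r - c" using vgeD[OF v(3) w(2)] by simp
    obtain s where s: "s \<in> ?S" "ncoeff y (w - s) \<noteq> 0"
      using w(1) unfolding xy[OF wr] by (metis (no_types, lifting) mult_zero_right sum.neutral)
    have "a \<le> s" using s vgeD[OF v(1)] by blast
    then have "w - s \<in> ?U" using s wr by simp
    from VI[OF s(1) this] show ?thesis by simp
  qed
  have "ncoeff (x * y * z) r = (\<Sum>w\<in>V. ncoeff (x * y) w * ncoeff z (r - w))"
    by (rule ncoeff_mult[OF finV V])
  also have "\<dots> = (\<Sum>w\<in>V. (\<Sum>s\<in>?S. ncoeff x s * ncoeff y (w - s)) * ncoeff z (r - w))"
  proof (rule sum.cong[OF refl])
    fix w
    show "ncoeff (x * y) w * ncoeff z (r - w) = (\<Sum>s\<in>?S. ncoeff x s * ncoeff y (w - s)) * ncoeff z (r - w)"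
    proof (cases "ncoeff z (r - w) = 0")
      case False
      then have "w \<le> r - c" using vgeD[OF v(3)] by fastforce
      then show ?thesis by (simp only: xy)
    qed (simp only: mult_zero_right)
  qed
  also have "\<dots> = (\<Sum>w\<in>V. \<Sum>s\<in>?S. ncoeff x s * (ncoeff y (w - s) * ncoeff z (r - w)))"
    by (simp only: sum_distrib_right mult.assoc)
  also have "\<dots> = (\<Sum>s\<in>?S. \<Sum>w\<in>V. ncoeff x s * (ncoeff y (w - s) * ncoeff z (r - w)))"
    by (rule sum.swap)
  also have "\<dots> = (\<Sum>s\<in>?S. ncoeff x s * ncoeff (y * z) (r - s))"
  proof (rule sum.cong[OF refl])
    fix s assume s: "s \<in> ?S"
    then have as: "a \<le> s" using vgeD[OF v(1)] by blast
    have "ncoeff (y * z) (r - s) = (\<Sum>t\<in>(\<lambda>w. w - s) ` V. ncoeff y t * ncoeff z (r - s - t))"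
    proof (rule ncoeff_mult)
      fix t assume t: "ncoeff y t \<noteq> 0" "ncoeff z (r - s - t) \<noteq> 0"
      then have "c \<le> r - s - t" using vgeD[OF v(3)] by blast
      then have "s + t \<in> V" using as s t by (intro VI) simp_all
      then show "t \<in> (\<lambda>w. w - s) ` V" by (rule rev_image_eqI) simp
    qed (use finV in simp)
    also have "\<dots> = (\<Sum>w\<in>V. ncoeff y (w - s) * ncoeff z (r - w))"
      by (subst sum.reindex) (simp_all add: inj_on_def)
    finally show "(\<Sum>w\<in>V. ncoeff x s * (ncoeff y (w - s) * ncoeff z (r - w))) = ncoeff x s * ncoeff (y * z) (r - s)"
      by (simp only: sum_distrib_left)
  qed
  also have "\<dots> = ncoeff (x * (y * z)) r"
  proof (rule ncoeff_mult[OF fin(1), symmetric])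
    fix s assume s: "ncoeff x s \<noteq> 0" "ncoeff (y * z) (r - s) \<noteq> 0"
    then have "b + c \<le> r - s" using vgeD[OF vyz] by blast
    then show "s \<in> ?S" using s by simp
  qed
  finally show "ncoeff (x * y * z) r = ncoeff (x * (y * z)) r" .
qed

lemma novikov_distrib_left: "x * (y + z) = x * y + x * z" for x y z :: "'a::division_ring novikov"
proof (rule novikov_eqI)
  fix r
  let ?S = "{s. ncoeff x s \<noteq> 0 \<and> ncoeff y (r - s) \<noteq> 0} \<union> {s. ncoeff x s \<noteq> 0 \<and> ncoeff z (r - s) \<noteq> 0}"
  have fin: "finite ?S" using ncoeff_finite_pairs by blast
  have "ncoeff (x * y) r = (\<Sum>s\<in>?S. ncoeff x s * ncoeff y (r - s))"
    "ncoeff (x * z) r = (\<Sum>s\<in>?S. ncoeff x s * ncoeff z (r - s))"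
    "ncoeff (x * (y + z)) r = (\<Sum>s\<in>?S. ncoeff x s * ncoeff (y + z) (r - s))"
    by (rule ncoeff_mult[OF fin]; auto)+
  then show "ncoeff (x * (y + z)) r = ncoeff (x * y + x * z) r"
    by (simp add: distrib_left sum.distrib)
qed

lemma novikov_distrib_right: "(x + y) * z = x * z + y * z" for x y z :: "'a::division_ring novikov"
proof (rule novikov_eqI)
  fix r
  let ?S = "{s. ncoeff x s \<noteq> 0 \<and> ncoeff z (r - s) \<noteq> 0} \<union> {s. ncoeff y s \<noteq> 0 \<and> ncoeff z (r - s) \<noteq> 0}"
  have fin: "finite ?S" using ncoeff_finite_pairs by blast
  have "ncoeff (x * z) r = (\<Sum>s\<in>?S. ncoeff x s * ncoeff z (r - s))"
    "ncoeff (y * z) r = (\<Sum>s\<in>?S. ncoeff y s * ncoeff z (r - s))"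
    "ncoeff ((x + y) * z) r = (\<Sum>s\<in>?S. ncoeff (x + y) s * ncoeff z (r - s))"
    by (rule ncoeff_mult[OF fin]; auto)+
  then show "ncoeff ((x + y) * z) r = ncoeff (x * z + y * z) r"
    by (simp add: distrib_right sum.distrib)
qed

instance novikov :: (division_ring) ring_1
proof
  fix x y z :: "'a novikov"
  show "x * y * z = x * (y * z)" by (rule novikov_mult_assoc)
  show "(x + y) * z = x * z + y * z" by (rule novikov_distrib_right)
  show "x * (y + z) = x * y + x * z" by (rule novikov_distrib_left)
  show "1 * x = x" by (rule novikov_eqI) (simp add: one_nmonom ncoeff_monom_mult)
  show "x * 1 = x" by (rule novikov_eqI) (simp add: one_nmonom ncoeff_mult_monom)
  show "(0 :: 'a novikov) \<noteq> 1"
  proof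
    assume "(0 :: 'a novikov) = 1"
    then have "ncoeff (0 :: 'a novikov) 0 = ncoeff 1 0" by (rule arg_cong)
    then show False by (simp add: ncoeff_1)
  qed
qed (rule novikov_eqI, simp add: algebra_simps)+

lemma ncoeff_sum: "ncoeff (sum f S) r = (\<Sum>i\<in>S. ncoeff (f i :: 'a::division_ring novikov) r)"
  by (induction S rule: infinite_finite_induct) simp_all

lemma geometric_sum_novikov: "(1 - u) * (\<Sum>i<m. u ^ i) = 1 - u ^ m" for u :: "'a::division_ring novikov"
proof (induction m)
  case (Suc m)
  have "(1 - u) * (\<Sum>i<Suc m. u ^ i) = (1 - u) * (\<Sum>i<m. u ^ i) + (1 - u) * u ^ m"
    by (simp add: distrib_left)
  also have "\<dots> = 1 - u ^ m + (1 - u) * u ^ m" by (simp only: Suc)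
  also have "\<dots> = 1 - u ^ Suc m" by (simp add: left_diff_distrib)
  finally show ?case .
qed simp

lemma vge_power: "vge u e \<Longrightarrow> vge (u ^ m) (real m * e)" for u :: "'a::division_ring novikov"
proof (induction m)
  case 0
  then show ?case by (simp add: vge_def ncoeff_1)
next
  case (Suc m)
  then show ?case using vge_mult[of u e "u ^ m" "real m * e"] by (simp add: algebra_simps)
qed

lemma novikov_geometric:
  fixes u :: "'a::division_ring novikov"
  assumes u: "vge u e" and e: "e > 0"
  shows "\<exists>g. (1 - u) * g = 1"
proof -
  \<comment> \<open>From \<open>N r\<close> on, powers of \<open>u\<close> have no coefficient at
    \<open>r\<close>; the added 1 makes the inequality strict.\<close>
  define N where "N r = nat \<lceil>r / e\<rceil> + 1" for r :: real
  have N: "r < real m * e" if "m \<ge> N r" for m r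
  proof -
    have "r / e < real (N r)" unfolding N_def by linarith
    then have "r / e < real m" using that by linarith
    then show ?thesis using e by (simp add: field_simps)
  qed
  have z: "ncoeff (u ^ m) r = 0" if "m \<ge> N r" for m r
    using vge_power[OF u, of m] N[OF that] unfolding vge_def by blast
  define c where "c r = (\<Sum>m<N r. ncoeff (u ^ m) r)" for r
  define G where "G R = (\<Sum>m<N R. u ^ m)" for R
  have cG: "c r = ncoeff (G R) r" if "r \<le> R" for r R
  proof -
    have "r / e \<le> R / e" using that e by (simp add: divide_right_mono)
    then have "N r \<le> N R" unfolding N_def by (intro add_right_mono nat_mono ceiling_mono)
    then have "(\<Sum>m<N r. ncoeff (u ^ m) r) = (\<Sum>m<N R. ncoeff (u ^ m) r)"
      by (intro sum.mono_neutral_left) (auto simp: z)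
    then show ?thesis by (simp add: c_def G_def ncoeff_sum)
  qed
  have "finite {s. s \<le> r \<and> c s \<noteq> 0}" for r
    by (rule finite_subset[OF _ ncoeff_finite[of r "G r"]]) (use cG in auto)
  then have g: "ncoeff (Novikov c) = c" by (rule ncoeff_Novikov)
  have "(1 - u) * Novikov c = 1"
  proof (rule novikov_eqI)
    fix R
    have v1: "vge (1 - u) 0" using u e by (simp add: vge_def ncoeff_1)
    let ?S = "{s. ncoeff (1 - u) s \<noteq> 0 \<and> ncoeff (Novikov c) (R - s) \<noteq> 0} \<union> {s. ncoeff (1 - u) s \<noteq> 0 \<and> ncoeff (G R) (R - s) \<noteq> 0}"
    have fin: "finite ?S" using ncoeff_finite_pairs by blast
    have "ncoeff ((1 - u) * Novikov c) R = (\<Sum>s\<in>?S. ncoeff (1 - u) s * ncoeff (Novikov c) (R - s))"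
      by (rule ncoeff_mult[OF fin]) blast
    also have "\<dots> = (\<Sum>s\<in>?S. ncoeff (1 - u) s * ncoeff (G R) (R - s))"
    proof (rule sum.cong[OF refl])
      fix s assume "s \<in> ?S"
      then have "0 \<le> s" using vgeD[OF v1] by blast
      then show "ncoeff (1 - u) s * ncoeff (Novikov c) (R - s) = ncoeff (1 - u) s * ncoeff (G R) (R - s)"
        using cG[of "R - s" R] by (simp only: g)
    qed
    also have "\<dots> = ncoeff ((1 - u) * G R) R"
      by (rule ncoeff_mult[OF fin, symmetric]) blast
    also have "(1 - u) * G R = 1 - u ^ N R" unfolding G_def by (rule geometric_sum_novikov)
    also have "ncoeff (1 - u ^ N R) R = ncoeff 1 R" by (simp add: z)
    finally show "ncoeff ((1 - u) * Novikov c) R = ncoeff 1 R" .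
  qed
  then show ?thesis by blast
qed

text \<open>Dividing by the lowest term leaves \<open>1 - u\<close> with all exponents of
  \<open>u\<close> positive. As the support is finite below 1, they stay above some
  \<open>e > 0\<close>, and the geometric series applies.\<close>

lemma novikov_right_inverse:
  fixes x :: "'a::division_ring novikov"
  assumes "x \<noteq> 0"
  shows "\<exists>y. x * y = 1"
proof -
  obtain r where r: "ncoeff x r \<noteq> 0" using assms novikov_eqI[of x 0] by auto
  let ?S = "{s. s \<le> r \<and> ncoeff x s \<noteq> 0}"
  define s0 where "s0 = Min ?S"
  have S: "finite ?S" "?S \<noteq> {}" using r ncoeff_finite by blast+
  have s0: "ncoeff x s0 \<noteq> 0" "s0 \<le> r" using Min_in[OF S] unfolding s0_def by blast+
  have below: "ncoeff x s = 0" if "s < s0" for s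
    using that s0(2) Min_le[OF S(1), of s] unfolding s0_def by fastforce
  define m where "m = nmonom (inverse (ncoeff x s0)) (- s0)"
  define u where "u = 1 - x * m"
  have u: "ncoeff u t = (if t = 0 then 0 else - (ncoeff x (t + s0) * inverse (ncoeff x s0)))" for t
    using s0 by (simp add: u_def m_def ncoeff_mult_monom ncoeff_1)
  \<comment> \<open>Exponents beyond 1 do not affect a lower bound of at most 1; inserting 1 below
    keeps the minimum defined when this set is empty.\<close>
  let ?U = "{t. t \<le> 1 \<and> ncoeff u t \<noteq> 0}"
  have finU: "finite (insert 1 ?U)" using ncoeff_finite[of 1 u] by simp
  define e where "e = Min (insert 1 ?U)"
  have pos: "t > 0" if "t \<in> insert 1 ?U" for t
  proof (rule ccontr)
    assume "\<not> t > 0"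
    then have "ncoeff u t \<noteq> 0" "t \<noteq> 0" using that by (auto simp: u)
    then have "ncoeff x (t + s0) \<noteq> 0" "t < 0" using \<open>\<not> t > 0\<close> by (auto simp: u)
    then show False using below[of "t + s0"] by simp
  qed
  have e: "e > 0" unfolding e_def using Min_in[OF finU] pos by blast
  have "vge u e" unfolding vge_def
  proof (intro allI impI, rule ccontr)
    fix t assume t: "t < e" "ncoeff u t \<noteq> 0"
    have "e \<le> 1" unfolding e_def by (rule Min_le[OF finU]) simp
    then have "t \<in> insert 1 ?U" using t by simp
    then show False using t(1) Min_le[OF finU] unfolding e_def by fastforce
  qed
  then obtain g where "(1 - u) * g = 1" using novikov_geometric e by blast
  moreover have "1 - u = x * m" by (simp add: u_def)
  ultimately show ?thesis by (metis mult.assoc)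
qed

instantiation novikov :: (division_ring) inverse
begin

definition "inverse x = (if x = 0 then 0 else SOME y. x * y = 1)" for x :: "'a novikov"
definition "x div y = x * inverse y" for x y :: "'a novikov"

instance ..
end

instance novikov :: (division_ring) division_ring
proof
  fix x y :: "'a novikov"
  have R: "x * inverse x = 1" if "x \<noteq> 0" for x :: "'a novikov"
    using someI_ex[OF novikov_right_inverse[OF that]] that by (simp add: inverse_novikov_def)
  show "inverse x * x = 1" if x: "x \<noteq> 0"
  proof -
    have "inverse x \<noteq> 0" using R[OF x] by auto
    then have "inverse x * inverse (inverse x) = 1" by (rule R)
    then show ?thesis using R[OF x] by (metis mult.assoc mult.right_neutral mult_1)
  qed
  show "x * inverse x = 1" if "x \<noteq> 0" using R[OF that] .
  show "x / y = x * inverse y" by (rule divide_novikov_def)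
  show "inverse 0 = (0 :: 'a novikov)" by (simp add: inverse_novikov_def)
qed

section \<open>Series of finite support and their value at \<open>t = 1\<close>\<close>

definition nfinite :: "'a::division_ring novikov \<Rightarrow> bool" where
  "nfinite x \<longleftrightarrow> finite {s. ncoeff x s \<noteq> 0}"

text \<open>Specialisation at \<open>t = 1\<close>. For infinite support the sum defaults to 0, so
  every use is accompanied by \<open>nfinite\<close>.\<close>

definition neval :: "'a::division_ring novikov \<Rightarrow> 'a" where
  "neval x = (\<Sum>s | ncoeff x s \<noteq> 0. ncoeff x s)"

lemma neval_superset: "finite S \<Longrightarrow> (\<And>s. ncoeff x s \<noteq> 0 \<Longrightarrow> s \<in> S) \<Longrightarrow> neval x = (\<Sum>s\<in>S. ncoeff x s)"
  unfolding neval_def by (rule sum.mono_neutral_left) auto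

lemma nfinite_superset: "finite S \<Longrightarrow> (\<And>s. ncoeff x s \<noteq> 0 \<Longrightarrow> s \<in> S) \<Longrightarrow> nfinite x"
  unfolding nfinite_def by (rule finite_subset) auto

lemma nfinite_monom: "nfinite (nmonom a s)" and neval_monom: "neval (nmonom a s) = a"
proof -
  have S: "r \<in> {s}" if "ncoeff (nmonom a s) r \<noteq> 0" for r using that by (simp add: ncoeff_monom split: if_splits)
  show "nfinite (nmonom a s)" by (rule nfinite_superset[of "{s}", OF _ S]) simp_all
  have "neval (nmonom a s) = (\<Sum>r\<in>{s}. ncoeff (nmonom a s) r)" by (rule neval_superset[OF _ S]) simp_all
  then show "neval (nmonom a s) = a" by (simp add: ncoeff_monom)
qed

lemma nfinite_add: assumes "nfinite x" "nfinite y" shows "nfinite (x + y)"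
  and neval_add: "neval (x + y) = neval x + neval y"
proof -
  let ?S = "{s. ncoeff x s \<noteq> 0} \<union> {s. ncoeff y s \<noteq> 0}"
  have fin: "finite ?S" using assms by (simp add: nfinite_def)
  have S: "s \<in> ?S" if "ncoeff (x + y) s \<noteq> 0" for s using that by auto
  show "nfinite (x + y)" by (rule nfinite_superset[OF fin S])
  have "neval (x + y) = (\<Sum>s\<in>?S. ncoeff (x + y) s)" by (rule neval_superset[OF fin S])
  also have "\<dots> = (\<Sum>s\<in>?S. ncoeff x s) + (\<Sum>s\<in>?S. ncoeff y s)" by (simp add: sum.distrib)
  also have "(\<Sum>s\<in>?S. ncoeff x s) = neval x" by (rule neval_superset[OF fin, symmetric]) simp
  also have "(\<Sum>s\<in>?S. ncoeff y s) = neval y" by (rule neval_superset[OF fin, symmetric]) simp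
  finally show "neval (x + y) = neval x + neval y" .
qed

lemma nfinite_mult: assumes "nfinite x" "nfinite y" shows "nfinite (x * y)"
  and neval_mult: "neval (x * y) = neval x * neval y"
proof -
  let ?X = "{s. ncoeff x s \<noteq> 0}" and ?Y = "{s. ncoeff y s \<noteq> 0}"
  have fin: "finite ?X" "finite ?Y" using assms by (simp_all add: nfinite_def)
  define V where "V = (\<lambda>(s, t). s + t) ` (?X \<times> ?Y)"
  have finV: "finite V" unfolding V_def using fin by (intro finite_imageI finite_cartesian_product)
  have VI: "s + t \<in> V" if "s \<in> ?X" "t \<in> ?Y" for s t unfolding V_def using that by force
  have c: "ncoeff (x * y) r = (\<Sum>s\<in>?X. ncoeff x s * ncoeff y (r - s))" for r
    by (rule ncoeff_mult[OF fin(1)]) simp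
  have S: "r \<in> V" if r: "ncoeff (x * y) r \<noteq> 0" for r
  proof -
    obtain s where s: "s \<in> ?X" "ncoeff y (r - s) \<noteq> 0"
      using r unfolding c by (metis (no_types, lifting) mult_zero_right sum.neutral)
    have "s + (r - s) \<in> V" by (rule VI) (use s in simp_all)
    then show ?thesis by simp
  qed
  show "nfinite (x * y)" by (rule nfinite_superset[OF finV S])
  have "neval (x * y) = (\<Sum>r\<in>V. ncoeff (x * y) r)" by (rule neval_superset[OF finV S])
  also have "\<dots> = (\<Sum>s\<in>?X. \<Sum>r\<in>V. ncoeff x s * ncoeff y (r - s))"
    unfolding c by (rule sum.swap)
  also have "\<dots> = (\<Sum>s\<in>?X. ncoeff x s * neval y)"
  proof (rule sum.cong[OF refl])
    fix s assume s: "s \<in> ?X"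
    have "neval y = (\<Sum>t\<in>(\<lambda>r. r - s) ` V. ncoeff y t)"
    proof (rule neval_superset)
      fix t assume "ncoeff y t \<noteq> 0"
      then have "s + t \<in> V" using VI[OF s] by simp
      then show "t \<in> (\<lambda>r. r - s) ` V" by (rule rev_image_eqI) simp
    qed (use finV in simp)
    also have "\<dots> = (\<Sum>r\<in>V. ncoeff y (r - s))" by (subst sum.reindex) (simp_all add: inj_on_def)
    finally show "(\<Sum>r\<in>V. ncoeff x s * ncoeff y (r - s)) = ncoeff x s * neval y"
      by (simp only: sum_distrib_left)
  qed
  also have "\<dots> = neval x * neval y" by (simp only: neval_def[of x] sum_distrib_right)
  finally show "neval (x * y) = neval x * neval y" .
qed

lemma nmonom_mult: "nmonom a s * nmonom b t = nmonom (a * b) (s + t)"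
  by (rule novikov_eqI) (auto simp: ncoeff_monom_mult ncoeff_monom)

lemma nmonom_add: "nmonom a s + nmonom b s = nmonom (a + b) s"
  by (rule novikov_eqI) (simp add: ncoeff_monom)

lemma nmonom_uminus: "- nmonom a s = nmonom (- a) s"
  by (rule novikov_eqI) (simp add: ncoeff_monom)

lemma nmonom_0 [simp]: "nmonom 0 s = 0"
  by (rule novikov_eqI) (simp add: ncoeff_monom)

lemma nmonom_central: "(\<And>x. a * x = x * a) \<Longrightarrow> nmonom a s * y = y * nmonom a s"
  by (rule novikov_eqI) (simp add: ncoeff_monom_mult ncoeff_mult_monom)

section \<open>Lifting to full rank\<close>

text \<open>Collecting positive and negative coefficients separately gives two natural numbers with
  equal logarithms; unique factorisation compares their multiplicities at \<open>p\<close>.\<close>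

lemma ln_primes_independent:
  assumes S: "finite S" "\<And>p. p \<in> S \<Longrightarrow> prime (p::nat)"
    and z: "(\<Sum>p\<in>S. of_int (c p) * ln (real p)) = 0" and p: "p \<in> S"
  shows "c p = 0"
proof -
  have pos: "real q > 0" if "q \<in> S" for q using S(2)[OF that] prime_gt_0_nat by simp
  define P where "P c = (\<Prod>p\<in>S. p ^ nat (c p))" for c :: "nat \<Rightarrow> int"
  have P: "P c > 0" for c unfolding P_def using S(2) prime_gt_0_nat by (intro prod_pos) simp
  have lnP: "ln (real (P c)) = (\<Sum>p\<in>S. real (nat (c p)) * ln (real p))" for c
  proof -
    have "ln (real (P c)) = ln (\<Prod>p\<in>S. real p ^ nat (c p))" by (simp add: P_def)
    also have "\<dots> = (\<Sum>p\<in>S. ln (real p ^ nat (c p)))"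
      by (rule ln_prod[OF S(1)]) (use pos in force)
    also have "\<dots> = (\<Sum>p\<in>S. real (nat (c p)) * ln (real p))"
      by (rule sum.cong[OF refl]) (simp add: ln_realpow pos)
    finally show ?thesis .
  qed
  have "ln (real (P c)) - ln (real (P (\<lambda>p. - c p))) = (\<Sum>p\<in>S. of_int (c p) * ln (real p))"
    unfolding lnP sum_subtractf[symmetric]
  proof (rule sum.cong[OF refl])
    fix p
    have "real (nat (c p)) - real (nat (- c p)) = of_int (c p)" by (cases "c p \<ge> 0") simp_all
    then show "real (nat (c p)) * ln (real p) - real (nat (- c p)) * ln (real p) = of_int (c p) * ln (real p)"
      by (simp only: left_diff_distrib[symmetric])
  qed
  then have "ln (real (P c)) = ln (real (P (\<lambda>p. - c p)))" using z by simp
  then have e: "P c = P (\<lambda>p. - c p)" using P[of c] P[of "\<lambda>p. - c p"] by simp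
  have m: "multiplicity p (P c) = nat (c p)" for c
    unfolding P_def using multiplicity_prod_prime_powers[OF S(1) S(2) S(2)[OF p], of "\<lambda>p. nat (c p)"] p by simp
  show ?thesis using m[of c] m[of "\<lambda>p. - c p"] e by simp
qed

definition plog :: "nat \<Rightarrow> real" where
  "plog j = ln (real (enumerate {p. prime p} j))"

lemma plog_independent:
  assumes z: "(\<Sum>j<n. of_int (c j) * plog j) = 0" and j: "j < n"
  shows "c j = 0"
proof -
  let ?e = "enumerate {p::nat. prime p}"
  have inf: "infinite {p::nat. prime p}" by (rule primes_infinite)
  have inj: "inj_on ?e {..<n}"
    using strict_mono_enumerate[OF inf] by (metis inj_on_subset strict_mono_imp_inj_on subset_UNIV)
  define c' where "c' p = c (the_inv_into {..<n} ?e p)" for p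
  have c': "c' (?e i) = c i" if "i < n" for i
    using the_inv_into_f_f[OF inj, of i] that by (simp add: c'_def)
  have "(\<Sum>p\<in>?e ` {..<n}. of_int (c' p) * ln (real p)) = (\<Sum>j<n. of_int (c j) * plog j)"
    unfolding sum.reindex[OF inj] by (rule sum.cong) (simp_all add: c' plog_def)
  then have "c' (?e j) = 0"
    using z j enumerate_in_set[OF inf] by (intro ln_primes_independent[of "?e ` {..<n}" c']) auto
  then show ?thesis using c'[OF j] by simp
qed

definition tr :: "nat \<Rightarrow> (nat \<Rightarrow> int) \<Rightarrow> nat \<Rightarrow> int" where
  "tr n f = (\<lambda>i. if i < n then f i else 0)"

lemma tr_apply: "tr n f i = (if i < n then f i else 0)"
  by (simp add: tr_def)

lemma tr_add: "tr n (f + g) = tr n f + tr n g"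
  by (rule ext) (simp add: tr_apply)

lemma tr_0: "tr n 0 = 0"
  by (rule ext) (simp add: tr_apply)

lemma tr_Zvec [simp]: "tr n f \<in> Zvec n"
  by (simp add: Zvec_def tr_apply)

lemma tr_svec: "k < n \<Longrightarrow> tr n (svec m k) = svec m k"
  by (rule ext) (simp add: tr_apply svec_def)

lemma tr_uvec: "k < n \<Longrightarrow> tr n (uvec k) = uvec k"
  by (simp only: uvec_svec tr_svec)

definition wt :: "nat \<Rightarrow> (nat \<Rightarrow> int) \<Rightarrow> real" where
  "wt n f = (\<Sum>j<n. of_int (f (n + j)) * plog j)"

lemma wt_add: "wt n (f + g) = wt n f + wt n g"
  by (simp add: wt_def distrib_right sum.distrib)

lemma wt_0: "wt n 0 = 0"
  by (simp add: wt_def)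

text \<open>Independence of the prime logarithms lets one real exponent encode all \<open>n\<close>
  new coordinates.\<close>

lemma tr_wt_inj:
  assumes "f \<in> Zvec (2 * n)" "g \<in> Zvec (2 * n)" "tr n f = tr n g" "wt n f = wt n g"
  shows "f = g"
proof (rule ext)
  fix i
  consider "i < n" | j where "j < n" "i = n + j" | "i \<ge> 2 * n"
    by (metis add_diff_inverse_nat linorder_not_less mult_2 nat_add_left_cancel_less)
  then show "f i = g i"
  proof cases
    case 1
    then show ?thesis using fun_cong[OF assms(3), of i] by (simp add: tr_apply)
  next
    case (2 j)
    have "(\<Sum>j<n. of_int (f (n + j) - g (n + j)) * plog j) = wt n f - wt n g"
      by (simp add: wt_def left_diff_distrib sum_subtractf)
    then have "(\<Sum>j<n. of_int (f (n + j) - g (n + j)) * plog j) = 0" using assms(4) by simp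
    from plog_independent[OF this 2(1)] show ?thesis using 2(2) by simp
  next
    case 3
    then show ?thesis using assms(1,2) by (simp add: Zvec_def)
  qed
qed

lemma nmonom_power: "nmonom a 0 ^ m = nmonom (a ^ m) 0"
  by (induction m) (simp_all add: nmonom_mult one_nmonom)

lemma (in central_scalars) qp_mod: "qp a = q ^ nat (a mod int l)"
proof -
  have "qp a = qp (a mod int l)" by (rule qp_cong) (simp add: cong_def)
  then show ?thesis using l_pos by (simp add: qp_def power_int_nonneg_exp)
qed

text \<open>The new row \<open>n + j\<close> is the principal coefficient of the column \<open>j\<close>.\<close>
definition framed :: "nat \<Rightarrow> (nat \<Rightarrow> nat \<Rightarrow> int) \<Rightarrow> nat \<Rightarrow> nat \<Rightarrow> int" where
  "framed n B i j = (if i < n then B i j else if i = n + j then 1 else 0)"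

context cluster
begin

definition hatA :: "'k novikov set" where "hatA = (\<lambda>a. nmonom a 0) ` A"

lemma hatA_monom: "a \<in> A \<Longrightarrow> nmonom a 0 \<in> hatA"
  by (simp add: hatA_def)

lemma hatAE: "x \<in> hatA \<Longrightarrow> (\<And>a. a \<in> A \<Longrightarrow> x = nmonom a 0 \<Longrightarrow> thesis) \<Longrightarrow> thesis"
  by (auto simp: hatA_def)

lemma hat_cluster: "cluster hatA (nmonom q 0) l (2 * n) ex d"
proof
  fix a b x :: "'k novikov"
  show "a * x = x * a" if a: "a \<in> hatA"
    using a by (elim hatAE) (simp add: nmonom_central[OF A_comm])
  show "(0 :: 'k novikov) \<in> hatA" using hatA_monom[OF A_zero] by simp
  show "(1 :: 'k novikov) \<in> hatA" unfolding one_nmonom by (rule hatA_monom) simp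
  show "a + b \<in> hatA" if "a \<in> hatA" "b \<in> hatA"
    using that by (elim hatAE) (simp add: nmonom_add hatA_monom)
  show "a * b \<in> hatA" if "a \<in> hatA" "b \<in> hatA"
    using that by (elim hatAE) (simp add: nmonom_mult hatA_monom)
  show "- a \<in> hatA" if "a \<in> hatA"
    using that by (elim hatAE) (simp add: nmonom_uminus hatA_monom)
  show "nmonom q 0 \<in> hatA" by (rule hatA_monom) simp
  show "nmonom q 0 ^ l = 1" by (simp add: nmonom_power q_pow one_nmonom)
  show "0 < l" by (rule l_pos)
  show "ex \<subseteq> {..<2 * n}"
  proof
    fix k assume "k \<in> ex"
    then have "k < n" by (rule ex_less)
    then show "k \<in> {..<2 * n}" by simp
  qed
  show "0 < d j" if "j \<in> ex" for j by (rule d_pos[OF that])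
qed

interpretation hat: cluster hatA "nmonom q 0" l "2 * n" ex d
  by (rule hat_cluster)

lemma hat_qp: "hat.qp e = nmonom (qp e) 0"
  by (simp only: hat.qp_mod qp_mod nmonom_power)

lemma neval_hat_qp: "nfinite (hat.qp e)" "neval (hat.qp e) = qp e"
  by (simp_all add: hat_qp nfinite_monom neval_monom)

definition hatM :: "((nat \<Rightarrow> int) \<Rightarrow> 'k) \<Rightarrow> (nat \<Rightarrow> int) \<Rightarrow> 'k novikov" where
  "hatM M f = nmonom (M (tr n f)) (wt n f)"

text \<open>The new coordinates are ignored, because powers of \<open>t\<close> are central.\<close>

definition hatL :: "((nat \<Rightarrow> int) \<Rightarrow> (nat \<Rightarrow> int) \<Rightarrow> int) \<Rightarrow> (nat \<Rightarrow> int) \<Rightarrow> (nat \<Rightarrow> int) \<Rightarrow> int" where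
  "hatL L f g = L (tr n f) (tr n g)"

lemma hat_col:
  assumes "\<And>i. i < n \<Longrightarrow> B' i k = B i k"
  shows "tr n (colv (2 * n) B' k) = col B k"
  by (rule ext) (simp add: tr_apply colv_def assms)

lemma hat_seed:
  assumes S: "seed M L B"
  shows "hat.seed (hatM M) (hatL L) (framed n B)"
proof -
  note pf = seed_pframe[OF S] and bi = seed_biadd[OF S] and F = seed_frame[OF S]
  have bi': "biadd (hatL L)" unfolding biadd_def hatL_def tr_add by (simp add: biaddD[OF bi])
  have M0: "hatM M 0 = 1" by (simp only: hatM_def tr_0 wt_0 pframe_0[OF pf] one_nmonom)
  have Mm: "hatM M f * hatM M g = hat.qp (hatL L f g) * hatM M (f + g)" for f g
    unfolding hatM_def nmonom_mult pframe_mult[OF pf tr_Zvec tr_Zvec] tr_add wt_add hat_qp hatL_def by simp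
  have fr: "hat.free_on (hatM M) (Zvec (2 * n))"
    unfolding hat.free_on_def
  proof (intro allI impI ballI)
    fix S c f0 assume S: "finite S" "S \<subseteq> Zvec (2 * n)" and c: "\<forall>f\<in>S. c f \<in> hatA"
      and z: "(\<Sum>f\<in>S. c f * hatM M f) = 0" and f0: "f0 \<in> S"
    have "\<forall>f\<in>S. \<exists>a\<in>A. c f = nmonom a 0" using c by (auto simp: hatA_def)
    then obtain c0 where c0: "\<And>f. f \<in> S \<Longrightarrow> c0 f \<in> A" "\<And>f. f \<in> S \<Longrightarrow> c f = nmonom (c0 f) 0" by metis
    \<comment> \<open>Only exponents with this weight reach the coefficient at
      \<open>wt n f0\<close>. On them \<open>tr n\<close> is injective, so independence of
      \<open>M\<close> applies.\<close>
    define S' where "S' = {f\<in>S. wt n f = wt n f0}"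
    have "0 = ncoeff (\<Sum>f\<in>S. c f * hatM M f) (wt n f0)" by (simp add: z)
    also have "\<dots> = (\<Sum>f\<in>S. if wt n f = wt n f0 then c0 f * M (tr n f) else 0)"
      unfolding ncoeff_sum by (rule sum.cong[OF refl]) (auto simp: c0 hatM_def nmonom_mult ncoeff_monom)
    also have "\<dots> = (\<Sum>f\<in>S'. c0 f * M (tr n f))"
      unfolding S'_def using S(1) by (simp add: sum.inter_filter)
    finally have z': "(\<Sum>f\<in>S'. c0 f * M (tr n f)) = 0" by simp
    have inj: "inj_on (tr n) S'"
    proof (rule inj_onI)
      fix f g assume "f \<in> S'" "g \<in> S'" and t: "tr n f = tr n g"
      then have "f \<in> Zvec (2 * n)" "g \<in> Zvec (2 * n)" "wt n f = wt n g"
        using S(2) by (auto simp: S'_def)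
      then show "f = g" using tr_wt_inj t by blast
    qed
    define c1 where "c1 g = c0 (the_inv_into S' (tr n) g)" for g
    have c1: "c1 (tr n f) = c0 f" if "f \<in> S'" for f
      using the_inv_into_f_f[OF inj that] by (simp add: c1_def)
    have z1: "(\<Sum>g\<in>tr n ` S'. c1 g * M g) = 0"
      unfolding sum.reindex[OF inj] using z' c1 by simp
    have fin: "finite (tr n ` S')" using S(1) by (simp add: S'_def)
    have f0': "f0 \<in> S'" using f0 by (simp add: S'_def)
    have "c1 (tr n f0) = 0"
    proof (rule free_onD[OF frame_free[OF F] fin _ _ z1])
      show "c1 g \<in> A" if "g \<in> tr n ` S'" for g using that c1 c0(1) by (auto simp: S'_def)
    qed (use f0' in auto)
    then show "c f0 = 0" using c1[OF f0'] c0(2)[OF f0] by simp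
  qed
  have fr': "hat.frame (2 * n) (hatL L) (hatM M)"
    unfolding hat.frame_def hat.pframe_def
    using bi' M0 Mm fr frame_skew[OF F tr_Zvec tr_Zvec] by (simp add: hatL_def)
  have ds: "hat.dskew (framed n B)"
    unfolding hat.dskew_def
  proof (intro ballI)
    fix i j assume ij: "i \<in> ex" "j \<in> ex"
    have "framed n B i j = B i j" "framed n B j i = B j i" using ij by (simp_all add: framed_def)
    then show "d i * framed n B i j = - (d j * framed n B j i)"
      using dskewD[OF seed_dskew[OF S] ij] by (simp only:)
  qed
  have co: "hat.compat (hatL L) (framed n B)"
    unfolding hat.compat_def
  proof (intro ballI)
    fix j g assume j: "j \<in> ex" and g: "g \<in> Zvec (2 * n)"
    have "tr n (colv (2 * n) (framed n B) j) = col B j"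
      by (rule hat_col) (simp add: framed_def)
    then show "[hatL L (colv (2 * n) (framed n B) j) g = d j * g j] (mod int l)"
      using compatD[OF seed_compat[OF S] j, of "tr n g"] j by (simp add: hatL_def tr_apply)
  qed
  show ?thesis unfolding hat.seed_def using fr' ds co by blast
qed

lemma hat_full_rank: "hat.full_rank (framed n B)"
  unfolding hat.full_rank_def
proof (intro allI impI ballI)
  fix c :: "nat \<Rightarrow> int" and k assume z: "\<forall>i<2 * n. (\<Sum>j\<in>ex. framed n B i j * c j) = 0" and k: "k \<in> ex"
  have "n + k < 2 * n" using k by simp
  then have "0 = (\<Sum>j\<in>ex. framed n B (n + k) j * c j)" using z by simp
  also have "\<dots> = (\<Sum>j\<in>ex. if j = k then c j else 0)"
    by (rule sum.cong[OF refl]) (auto simp: framed_def)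
  also have "\<dots> = c k" using k by simp
  finally show "c k = 0" by simp
qed

text \<open>Describes a full-rank seed that specialises to \<open>(M, L, B)\<close> at
  \<open>t = 1\<close>. Finiteness is asked of the variables but not of inverses of the old ones,
  which may have infinite support after mutation; the new frozen variables are included with their
  inverses.\<close>

definition lifts where
  "lifts M L B M' L' B' \<longleftrightarrow> hat.seed M' L' B' \<and> hat.full_rank B' \<and> seed M L B \<and>
    (\<forall>i<n. \<forall>j. B' i j = B i j) \<and>
    (\<forall>f\<in>Zvec (2 * n). \<forall>g\<in>Zvec (2 * n). [L' f g = L (tr n f) (tr n g)] (mod int l)) \<and>
    (\<forall>g\<in>Zvec (2 * n). tr n g = 0 \<longrightarrow> nfinite (M' g) \<and> neval (M' g) = 1) \<and>
    (\<forall>a<n. nfinite (M' (uvec a)) \<and> neval (M' (uvec a)) = M (uvec a))"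

lemma lifts_initial:
  assumes S: "seed M L B"
  shows "lifts M L B (hatM M) (hatL L) (framed n B)"
  unfolding lifts_def
proof (intro conjI)
  show "hat.seed (hatM M) (hatL L) (framed n B)" by (rule hat_seed[OF S])
  show "hat.full_rank (framed n B)" by (rule hat_full_rank)
  show "\<forall>g\<in>Zvec (2 * n). tr n g = 0 \<longrightarrow> nfinite (hatM M g) \<and> neval (hatM M g) = 1"
    using pframe_0[OF seed_pframe[OF S]] by (simp add: hatM_def nfinite_monom neval_monom)
qed (use S in \<open>simp_all add: framed_def hatL_def hatM_def nfinite_monom neval_monom tr_uvec\<close>)

text \<open>\<open>neval\<close> is multiplicative on finite series, so monomials can be evaluated
  factor by factor as long as no old variable is inverted; coordinates from \<open>n\<close> on may
  be negative.\<close>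

lemma lifts_nonneg:
  assumes lf: "lifts M L B M' L' B'" and g: "g \<in> Zvec (2 * n)" "\<And>a. a < n \<Longrightarrow> g a \<ge> 0"
  shows "nfinite (M' g) \<and> neval (M' g) = M (tr n g)"
proof -
  have S': "hat.seed M' L' B'" and S: "seed M L B"
    and L: "\<And>f g. f \<in> Zvec (2 * n) \<Longrightarrow> g \<in> Zvec (2 * n) \<Longrightarrow> [L' f g = L (tr n f) (tr n g)] (mod int l)"
    and M0: "\<And>g. g \<in> Zvec (2 * n) \<Longrightarrow> tr n g = 0 \<Longrightarrow> nfinite (M' g) \<and> neval (M' g) = 1"
    and Mu: "\<And>a. a < n \<Longrightarrow> nfinite (M' (uvec a)) \<and> neval (M' (uvec a)) = M (uvec a)"
    using lf unfolding lifts_def by blast+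
  note pf = seed_pframe[OF S] and pf' = hat.seed_pframe[OF S']
  have "m \<le> n \<Longrightarrow> g \<in> Zvec (2 * n) \<Longrightarrow> \<forall>a<n. g a \<ge> 0 \<Longrightarrow> \<forall>a<n. m \<le> a \<longrightarrow> g a = 0 \<Longrightarrow>
    nfinite (M' g) \<and> neval (M' g) = M (tr n g)" for m g
  proof (induction m arbitrary: g)
    case 0
    have "tr n g = 0" by (rule ext) (use 0(4) in \<open>simp add: tr_apply\<close>)
    then show ?case using M0[OF 0(2)] pframe_0[OF pf] by (simp only:)
  next
    case (Suc m)
    let ?f = "g(m := 0)" let ?c = "nat (g m)"
    have m: "m < n" "m < 2 * n" using Suc.prems(1) by simp_all
    have c: "int ?c = g m" using Suc.prems(3) m by simp
    have gs: "g = ?f + svec (int ?c) m" unfolding c by (rule fun_upd_split)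
    have fZ: "?f \<in> Zvec (2 * n)" by (rule Zvec_upd[OF Suc.prems(2)])
    have trg: "tr n g = tr n ?f + svec (int ?c) m"
      using arg_cong[OF gs, of "tr n"] by (simp only: tr_add tr_svec[OF m(1)])
    have ih: "nfinite (M' ?f) \<and> neval (M' ?f) = M (tr n ?f)"
      by (rule Suc.IH[OF _ fZ]) (use Suc.prems(1,3,4) in auto)
    have 1: "M' g = hat.qp (hat.corr L' ?f m (int ?c)) * (M' ?f * M' (uvec m) ^ ?c)"
      using hat.pframe_split[OF pf' fZ m(2), of ?c] by (simp only: gs[symmetric])
    have 2: "M (tr n g) = qp (corr L (tr n ?f) m (int ?c)) * (M (tr n ?f) * M (uvec m) ^ ?c)"
      using pframe_split[OF pf tr_Zvec m(1), of ?f ?c] by (simp only: trg)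
    have u: "[L' f (uvec m) = L (tr n f) (uvec m)] (mod int l)" if "f \<in> Zvec (2 * n)" for f
      using L[OF that Zvec_uvec[OF m(2)]] by (simp only: tr_uvec[OF m(1)])
    have u': "[L' (uvec m) (uvec m) = L (uvec m) (uvec m)] (mod int l)"
      using u[OF Zvec_uvec[OF m(2)]] by (simp only: tr_uvec[OF m(1)])
    have "qp (corr L' ?f m (int ?c)) = qp (corr L (tr n ?f) m (int ?c))"
      unfolding corr_def by (intro qp_cong cong_diff cong_scalar_left u[OF fZ] u')
    moreover have "hat.corr L' ?f m (int ?c) = corr L' ?f m (int ?c)"
      by (simp only: hat.corr_def corr_def)
    moreover have pw: "nfinite (M' (uvec m) ^ i) \<and> neval (M' (uvec m) ^ i) = M (uvec m) ^ i" for i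
      by (induction i) (use Mu[OF m(1)] in \<open>simp_all add: nfinite_mult neval_mult one_nmonom nfinite_monom neval_monom\<close>)
    ultimately show ?case
      unfolding 1 2 using ih neval_hat_qp by (simp add: nfinite_mult neval_mult)
  qed
  from this[of n g] show ?thesis using g by simp
qed

text \<open>Finiteness of the new lifted variable is an assumption, discharged by the Laurent
  theorem for full rank. Its value is found by multiplying the exchange relation with the old
  variable, which removes the negative exponent, and cancelling after evaluation.\<close>

lemma lifts_mutates:
  assumes lf: "lifts M L B M' L' B'" and k: "k \<in> ex" and m: "mutates k M L B M1 L1 B1" and S1: "seed M1 L1 B1"
    and m': "hat.mutates k M' L' B' M1' L1' B1'" and S1': "hat.seed M1' L1' B1'" and fin: "nfinite (M1' (uvec k))"
  shows "lifts M1 L1 B1 M1' L1' B1'"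
proof -
  have S': "hat.seed M' L' B'" and fr': "hat.full_rank B'" and S: "seed M L B"
    and B: "\<And>i j. i < n \<Longrightarrow> B' i j = B i j"
    and L: "\<And>f g. f \<in> Zvec (2 * n) \<Longrightarrow> g \<in> Zvec (2 * n) \<Longrightarrow> [L' f g = L (tr n f) (tr n g)] (mod int l)"
    and M0: "\<And>g. g \<in> Zvec (2 * n) \<Longrightarrow> tr n g = 0 \<Longrightarrow> nfinite (M' g) \<and> neval (M' g) = 1"
    and Mu: "\<And>a. a < n \<Longrightarrow> nfinite (M' (uvec a)) \<and> neval (M' (uvec a)) = M (uvec a)"
    using lf unfolding lifts_def by blast+
  have kn: "k < n" "k < 2 * n" using k by simp_all
  let ?b = "colv (2 * n) B' k"
  have trb: "tr n ?b = col B k" by (rule hat_col) (rule B)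
  have trp: "tr n (posp f) = posp (tr n f)" "tr n (- f) = - tr n f" for f
    by (rule ext, simp add: tr_apply posp_apply)+
  have trr: "tr n (reflect (posp (- ?b)) k f) = reflect (posp (- col B k)) k (tr n f)" for f
  proof (rule ext)
    fix i
    have "posp (- ?b) i = posp (- col B k) i" if "i < n"
      using that B[OF that, of k] by (simp add: posp_apply)
    then show "tr n (reflect (posp (- ?b)) k f) i = reflect (posp (- col B k)) k (tr n f) i"
      using kn by (simp add: tr_apply reflect_apply posp_apply colv_def)
  qed
  have 1: "B1' i j = B1 i j" if "i < n" for i j
    unfolding hat.mutates_B[OF m'] mutates_B[OF m] mutB_def using B[OF that] B[OF kn(1)] by simp
  have 2: "[L1' f g = L1 (tr n f) (tr n g)] (mod int l)" if fg: "f \<in> Zvec (2 * n)" "g \<in> Zvec (2 * n)" for f g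
  proof -
    have a: "[L1' f g = L' (reflect (posp (- ?b)) k f) (reflect (posp (- ?b)) k g)] (mod int l)"
      by (rule hat.mutates_cong[OF m' fg])
    have "[L' (reflect (posp (- ?b)) k f) (reflect (posp (- ?b)) k g)
        = L (tr n (reflect (posp (- ?b)) k f)) (tr n (reflect (posp (- ?b)) k g))] (mod int l)"
      by (rule L) (use fg kn in simp_all)
    then have b: "[L' (reflect (posp (- ?b)) k f) (reflect (posp (- ?b)) k g)
        = L (reflect (posp (- col B k)) k (tr n f)) (reflect (posp (- col B k)) k (tr n g))] (mod int l)"
      unfolding trr .
    have c: "[L (reflect (posp (- col B k)) k (tr n f)) (reflect (posp (- col B k)) k (tr n g)) = L1 (tr n f) (tr n g)] (mod int l)"
      by (rule cong_sym, rule mutates_cong[OF m tr_Zvec tr_Zvec])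
    show ?thesis by (rule cong_trans[OF a cong_trans[OF b c]])
  qed
  have 3: "nfinite (M1' g) \<and> neval (M1' g) = 1" if g: "g \<in> Zvec (2 * n)" "tr n g = 0" for g
  proof -
    have "g k = 0" using fun_cong[OF g(2), of k] kn by (simp add: tr_apply)
    then have "M1' g = M' g" by (rule hat.mutates_agree[OF S' k m' hat.seed_pframe[OF S1'] g(1)])
    then show ?thesis using M0[OF g] by simp
  qed
  have 4: "nfinite (M1' (uvec a)) \<and> neval (M1' (uvec a)) = M1 (uvec a)" if a: "a < n" for a
  proof (cases "a = k")
    case False
    then show ?thesis using hat.mutates_other[OF m'] mutates_other[OF m] a Mu by simp
  next
    case True
    let ?e = "uvec k" let ?w = "- ?e + posp ?b" let ?w' = "- ?e + posp (- ?b)"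
    let ?v = "- ?e + posp (col B k)" let ?v' = "- ?e + posp (- col B k)"
    note pf = seed_pframe[OF S] and pf' = hat.seed_pframe[OF S']
    have e: "?e \<in> Zvec n" "?e \<in> Zvec (2 * n)" using kn by simp_all
    \<comment> \<open>The product is a power of \<open>q\<close> times \<open>M' p\<close> with
      \<open>p\<close> nonnegative, so no inverse is evaluated.\<close>
    have half: "nfinite (M' (- ?e + p) * M' ?e) \<and> neval (M' (- ?e + p) * M' ?e) = M (- ?e + tr n p) * M ?e"
      if p: "p \<in> Zvec (2 * n)" "\<And>a. p a \<ge> 0" for p
    proof -
      have pZ: "- ?e + p \<in> Zvec (2 * n)" using p(1) e(2) by simp
      have trp': "tr n (- ?e + p) = - ?e + tr n p" unfolding tr_add trp(2) tr_uvec[OF kn(1)] ..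
      have "M' (- ?e + p) * M' ?e = hat.qp (L' (- ?e + p) ?e) * M' p"
        using hat.pframe_mult[OF pf' pZ e(2)] by simp
      moreover have "M (- ?e + tr n p) * M ?e = qp (L (- ?e + tr n p) ?e) * M (tr n p)"
        using pframe_mult[OF pf _ e(1), of "- ?e + tr n p"] e(1) by simp
      moreover have "qp (L' (- ?e + p) ?e) = qp (L (- ?e + tr n p) ?e)"
        using L[OF pZ e(2)] unfolding trp' tr_uvec[OF kn(1)] by (rule qp_cong)
      moreover have "nfinite (M' p) \<and> neval (M' p) = M (tr n p)"
        by (rule lifts_nonneg[OF lf p(1)]) (rule p(2))
      ultimately show ?thesis using neval_hat_qp by (simp add: nfinite_mult neval_mult)
    qed
    have hw: "nfinite (M' ?w * M' ?e) \<and> neval (M' ?w * M' ?e) = M ?v * M ?e"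
      using half[of "posp ?b"] by (simp add: trp trb posp_apply)
    have hw': "nfinite (M' ?w' * M' ?e) \<and> neval (M' ?w' * M' ?e) = M ?v' * M ?e"
      using half[of "posp (- ?b)"] by (simp add: trp trb posp_apply)
    have "neval (M1' ?e) * M ?e = neval (M1' ?e * M' ?e)"
      using fin Mu[OF kn(1)] by (simp add: neval_mult)
    also have "\<dots> = M ?v * M ?e + M ?v' * M ?e"
      unfolding hat.mutates_exchange[OF m'] distrib_right using hw hw' by (simp only: neval_add)
    also have "\<dots> = M1 ?e * M ?e" unfolding mutates_exchange[OF m] distrib_right ..
    finally have "neval (M1' ?e) = M1 ?e" using pframe_nz[OF pf e(1)] by simp
    then show ?thesis unfolding True using fin by simp
  qed
  have fr1: "hat.full_rank B1'"
    unfolding hat.mutates_B[OF m'] by (rule hat.full_rank_mutB[OF hat.seed_dskew[OF S'] k fr'])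
  show ?thesis unfolding lifts_def using S1' fr1 S1 1 2 3 4 by blast
qed

text \<open>The set \<open>{n..}\<close> permits negative exponents of the new frozen variables,
  which become 1 at \<open>t = 1\<close>.\<close>

lemma hat_aspan_neval:
  assumes "y \<in> hat.aspan (hatM M) {f\<in>Zvec (2 * n). hat.pos_off (J \<union> {n..}) f}"
  shows "nfinite y \<and> neval y \<in> aspan M {f\<in>Zvec n. pos_off J f}"
proof -
  obtain S c where S: "finite S" "S \<subseteq> {f\<in>Zvec (2 * n). hat.pos_off (J \<union> {n..}) f}" "\<And>f. f \<in> S \<Longrightarrow> c f \<in> hatA"
    "y = (\<Sum>f\<in>S. c f * hatM M f)"
    using assms by (rule hat.aspanE) blast
  have t: "nfinite (c f * hatM M f) \<and> neval (c f * hatM M f) \<in> aspan M {f\<in>Zvec n. pos_off J f}" if f: "f \<in> S" for f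
  proof -
    obtain a where a: "a \<in> A" "c f = nmonom a 0" using S(3)[OF f] by (rule hatAE)
    have "hat.pos_off (J \<union> {n..}) f" using f S(2) by blast
    then have "pos_off J (tr n f)" by (simp add: pos_off_def hat.pos_off_def tr_apply)
    then have "a * M (tr n f) \<in> aspan M {f\<in>Zvec n. pos_off J f}" by (intro aspan_term a(1)) simp
    then show ?thesis by (simp add: a(2) hatM_def nmonom_mult nfinite_monom neval_monom)
  qed
  have "R \<subseteq> S \<Longrightarrow> nfinite (\<Sum>f\<in>R. c f * hatM M f) \<and> neval (\<Sum>f\<in>R. c f * hatM M f) \<in> aspan M {f\<in>Zvec n. pos_off J f}"
    if "finite R" for R
    using that
  proof (induction R rule: finite_induct)
    case empty
    have "nfinite (0 :: 'k novikov)" "neval (0 :: 'k novikov) = 0"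
      using nfinite_monom[of "0 :: 'k" 0] neval_monom[of "0 :: 'k" 0] by simp_all
    then show ?case by (simp only: sum.empty aspan_0 simp_thms)
  next
    case (insert f R)
    then show ?case using t[of f] by (simp add: nfinite_add neval_add aspan_add)
  qed
  then show ?thesis using S(1,4) by blast
qed

lemma hat_mpath_snoc:
  "hat.mpath ks (M, L, B) M1 L1 B1 \<Longrightarrow> k \<in> ex \<Longrightarrow> hat.mutates k M1 L1 B1 M2 L2 B2 \<Longrightarrow> hat.seed M2 L2 B2 \<Longrightarrow>
    hat.mpath (ks @ [k]) (M, L, B) M2 L2 B2"
proof (induction ks arbitrary: M L B)
  case Nil
  then show ?case by auto
next
  case (Cons a ks)
  then show ?case unfolding append_Cons hat.mpath.simps by blast
qed

text \<open>The path from the initial lifted seed is carried along, because each newly mutated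
  variable must be expanded in that seed: there every Laurent expansion has finite support.\<close>

lemma lift_mpath:
  assumes Sh: "hat.seed (hatM M) Lh Bh" and fr: "hat.full_rank Bh"
    and p: "mpath ks (M0, L0, B0) M' L' B'" and lf: "lifts M0 L0 B0 M1 L1 B1" and p1: "hat.mpath ks1 (hatM M, Lh, Bh) M1 L1 B1"
  shows "\<exists>M2 L2 B2 ks2. lifts M' L' B' M2 L2 B2 \<and> hat.mpath ks2 (hatM M, Lh, Bh) M2 L2 B2"
proof -
  define Q where "Q ks \<longleftrightarrow> (\<forall>M0 L0 B0 ks1 M1 L1 B1. mpath ks (M0, L0, B0) M' L' B' \<longrightarrow>
      lifts M0 L0 B0 M1 L1 B1 \<longrightarrow> hat.mpath ks1 (hatM M, Lh, Bh) M1 L1 B1 \<longrightarrow>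
      (\<exists>M2 L2 B2 ks2. lifts M' L' B' M2 L2 B2 \<and> hat.mpath ks2 (hatM M, Lh, Bh) M2 L2 B2))" for ks
  have "Q ks"
  proof (induction ks)
    case Nil
    show ?case unfolding Q_def mpath.simps by blast
  next
    case (Cons k ks)
    show ?case
      unfolding Q_def
    proof (intro allI impI)
      fix M0 L0 B0 ks1 M1 L1 B1
      assume "mpath (k # ks) (M0, L0, B0) M' L' B'"
      then obtain M2 L2 B2 where k: "k \<in> ex" and m: "mutates k M0 L0 B0 M2 L2 B2" and S2: "seed M2 L2 B2"
        and p2: "mpath ks (M2, L2, B2) M' L' B'" by auto
      assume lf: "lifts M0 L0 B0 M1 L1 B1" and p1: "hat.mpath ks1 (hatM M, Lh, Bh) M1 L1 B1"
      have S1: "hat.seed M1 L1 B1" and fr1: "hat.full_rank B1"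
        using lf unfolding lifts_def by blast+
      obtain M3 L3 B3 where m': "hat.mutates k M1 L1 B1 M3 L3 B3" and S3: "hat.seed M3 L3 B3"
        by (rule hat.mutates_exists[OF S1 k fr1])
      have p3: "hat.mpath (ks1 @ [k]) (hatM M, Lh, Bh) M3 L3 B3"
        by (rule hat_mpath_snoc[OF p1 k m' S3])
      have k2: "k < 2 * n" using ex_less[OF k] by linarith
      have "M3 (uvec k) \<in> hat.aspan (hatM M) {f\<in>Zvec (2 * n). hat.pos_off (ex \<union> {n..}) f}"
        by (rule hat.laurent_full_rank[OF Sh fr p3 _ k2]) blast
      then have "nfinite (M3 (uvec k))" using hat_aspan_neval by blast
      from lifts_mutates[OF lf k m S2 m' S3 this] p3 p2 Cons.IH[unfolded Q_def]
      show "\<exists>M2 L2 B2 ks2. lifts M' L' B' M2 L2 B2 \<and> hat.mpath ks2 (hatM M, Lh, Bh) M2 L2 B2" by blast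
    qed
  qed
  then show ?thesis using p lf p1 unfolding Q_def by blast
qed

theorem laurent:
  assumes S: "seed M L B" and p: "mpath ks (M, L, B) M' L' B'" and J: "ex \<subseteq> J" and a: "a < n"
  shows "M' (uvec a) \<in> aspan M {f\<in>Zvec n. pos_off J f}"
proof -
  let ?Mh = "hatM M" let ?Lh = "hatL L" let ?Bh = "framed n B" let ?J = "J \<union> {n..}"
  have Sh: "hat.seed ?Mh ?Lh ?Bh" by (rule hat_seed[OF S])
  have Jh: "ex \<subseteq> ?J" using J by blast
  obtain M2 L2 B2 ks2
    where l2: "lifts M' L' B' M2 L2 B2" and p2: "hat.mpath ks2 (?Mh, ?Lh, ?Bh) M2 L2 B2"
    using lift_mpath[OF Sh hat_full_rank p lifts_initial[OF S], of "[]"] by force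
  have a2: "a < 2 * n" using a by linarith
  have "M2 (uvec a) \<in> hat.aspan ?Mh {f\<in>Zvec (2 * n). hat.pos_off ?J f}"
    by (rule hat.laurent_full_rank[OF Sh hat_full_rank p2 Jh a2])
  then have "neval (M2 (uvec a)) \<in> aspan M {f\<in>Zvec n. pos_off J f}"
    using hat_aspan_neval by blast
  moreover have "neval (M2 (uvec a)) = M' (uvec a)" using l2 a unfolding lifts_def by blast
  ultimately show ?thesis by simp
qed

end

section \<open>The cluster algebra and the upper cluster algebra\<close>

lemma Aring_Qfield: "a \<in> Aring z \<Longrightarrow> a \<in> Qfield z"
  unfolding Aring_def Qfield_def using Ints_subset_Rats by blast

lemma
  shows Aring_0: "0 \<in> Aring z" and Aring_1: "1 \<in> Aring z" and Aring_z: "z \<in> Aring z"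
    and Aring_add: "a \<in> Aring z \<Longrightarrow> b \<in> Aring z \<Longrightarrow> a + b \<in> Aring z"
    and Aring_mult: "a \<in> Aring z \<Longrightarrow> b \<in> Aring z \<Longrightarrow> a * b \<in> Aring z"
    and Aring_uminus: "a \<in> Aring z \<Longrightarrow> - a \<in> Aring z"
proof -
  have I: "poly p z \<in> Aring z" if "\<And>i. coeff p i \<in> \<int>" for p
    using that unfolding Aring_def by blast
  show "0 \<in> Aring z" using I[of 0] by simp
  show "1 \<in> Aring z" using I[of 1] by simp
  show "z \<in> Aring z" using I[of "[:0, 1:]"] by (simp add: coeff_pCons split: nat.splits)
  show "a + b \<in> Aring z" if ab: "a \<in> Aring z" "b \<in> Aring z"
  proof -
    obtain p r where "a = poly p z" "b = poly r z" "\<And>i. coeff p i \<in> \<int>" "\<And>i. coeff r i \<in> \<int>"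
      using ab unfolding Aring_def by blast
    then show ?thesis using I[of "p + r"] by simp
  qed
  show "a * b \<in> Aring z" if ab: "a \<in> Aring z" "b \<in> Aring z"
  proof -
    obtain p r where pr: "a = poly p z" "b = poly r z" "\<And>i. coeff p i \<in> \<int>" "\<And>i. coeff r i \<in> \<int>"
      using ab unfolding Aring_def by blast
    have "coeff (p * r) i \<in> \<int>" for i unfolding coeff_mult by (intro Ints_sum Ints_mult pr)
    then show ?thesis using I[of "p * r"] pr(1,2) by simp
  qed
  show "- a \<in> Aring z" if a: "a \<in> Aring z"
  proof -
    obtain p where "a = poly p z" "\<And>i. coeff p i \<in> \<int>"
      using a unfolding Aring_def by blast
    then show ?thesis using I[of "- p"] by simp
  qed
qed

lemma Aring_power: "a \<in> Aring z \<Longrightarrow> a ^ m \<in> Aring z"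
  by (induction m) (simp_all add: Aring_1 Aring_mult)

lemma biadd_bil: "biadd (bil N lam)"
  unfolding biadd_def bil_def by (simp add: distrib_left distrib_right sum.distrib)

lemma bil_tail: "bil N lam f g = (\<Sum>j<N. (\<Sum>i<N. f i * lam i j) * g j)"
  unfolding bil_def by (subst sum.swap) (simp add: sum_distrib_right)

locale root_data =
  fixes l :: nat and z :: complex and \<iota> :: "complex \<Rightarrow> 'f::division_ring"
  assumes prim: "primitive_root l z" and alg: "division_algebra_over z \<iota>"
begin

lemma \<iota>_1: "\<iota> 1 = 1"
  and \<iota>_add: "a \<in> Aring z \<Longrightarrow> b \<in> Aring z \<Longrightarrow> \<iota> (a + b) = \<iota> a + \<iota> b"
  and \<iota>_mult: "a \<in> Aring z \<Longrightarrow> b \<in> Aring z \<Longrightarrow> \<iota> (a * b) = \<iota> a * \<iota> b"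
  and \<iota>_inj: "a \<in> Aring z \<Longrightarrow> b \<in> Aring z \<Longrightarrow> \<iota> a = \<iota> b \<Longrightarrow> a = b"
  and \<iota>_comm: "a \<in> Aring z \<Longrightarrow> \<iota> a * x = x * \<iota> a"
  using alg Aring_Qfield[of _ z] unfolding division_algebra_over_def inj_on_def by blast+

lemma \<iota>_0: "\<iota> 0 = 0"
  using \<iota>_add[OF Aring_0 Aring_0] by simp

lemma \<iota>_uminus: "a \<in> Aring z \<Longrightarrow> \<iota> (- a) = - \<iota> a"
  using \<iota>_add[OF _ Aring_uminus, of a a] \<iota>_0 by (simp add: eq_neg_iff_add_eq_0 add.commute)

lemma \<iota>_power: "a \<in> Aring z \<Longrightarrow> \<iota> (a ^ m) = \<iota> a ^ m"
  by (induction m) (simp_all add: \<iota>_1 \<iota>_mult Aring_power)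

lemma prim_l: "l > 0" and prim_pow: "z ^ l = 1"
  and prim_min: "0 < m \<Longrightarrow> m < l \<Longrightarrow> z ^ m \<noteq> 1"
  using prim unfolding primitive_root_def by blast+

sublocale central_scalars "\<iota> ` Aring z" "\<iota> z" l
proof
  fix a b x :: 'f
  show "a * x = x * a" if "a \<in> \<iota> ` Aring z" using that \<iota>_comm by blast
  show "0 \<in> \<iota> ` Aring z" using \<iota>_0 Aring_0 by (metis imageI)
  show "1 \<in> \<iota> ` Aring z" using \<iota>_1 Aring_1 by (metis imageI)
  show "a + b \<in> \<iota> ` Aring z" if "a \<in> \<iota> ` Aring z" "b \<in> \<iota> ` Aring z"
    using that \<iota>_add Aring_add by (smt (verit) imageE imageI)
  show "a * b \<in> \<iota> ` Aring z" if "a \<in> \<iota> ` Aring z" "b \<in> \<iota> ` Aring z"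
    using that \<iota>_mult Aring_mult by (smt (verit) imageE imageI)
  show "- a \<in> \<iota> ` Aring z" if "a \<in> \<iota> ` Aring z"
    using that \<iota>_uminus Aring_uminus by (smt (verit) imageE imageI)
  show "\<iota> z \<in> \<iota> ` Aring z" using Aring_z by blast
  show "0 < l" by (rule prim_l)
  show "\<iota> z ^ l = 1" using \<iota>_power[OF Aring_z, of l] prim_pow \<iota>_1 by simp
qed

lemma powi_mod: "z powi e = z ^ nat (e mod int l)"
proof -
  interpret C: central_scalars "UNIV :: complex set" z l
    by standard (use prim_l prim_pow in simp_all)
  show ?thesis using C.qp_mod[of e] by (simp add: C.qp_def)
qed

lemma \<iota>_powi: "\<iota> (z powi e) = qp e"
  unfolding powi_mod qp_mod by (rule \<iota>_power[OF Aring_z])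

text \<open>Primitivity of \<open>z\<close> and injectivity of \<open>\<iota>\<close> enter here,
  with the consequence that a frame determines its form mod \<open>l\<close>.\<close>

lemma qp_inj:
  assumes "qp a = qp b"
  shows "[a = b] (mod int l)"
proof -
  have "qp (a - b) = 1" using assms by (simp add: qp_add[of a "- b", simplified] qp_uminus)
  then have "\<iota> (z ^ nat ((a - b) mod int l)) = \<iota> 1" by (simp only: \<iota>_powi[symmetric] powi_mod \<iota>_1)
  then have e: "z ^ nat ((a - b) mod int l) = 1" by (rule \<iota>_inj[OF Aring_power[OF Aring_z] Aring_1])
  have r: "0 \<le> (a - b) mod int l" "(a - b) mod int l < int l" using prim_l by simp_all
  have "\<not> 0 < nat ((a - b) mod int l)" using prim_min e r by (metis nat_less_iff)
  then have "(a - b) mod int l = 0" using r by simp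
  then show ?thesis by (simp add: cong_iff_dvd_diff dvd_eq_mod_eq_0)
qed

lemma toric_pframe:
  assumes "toric_frame l z \<iota> N lam M"
  shows "pframe N (bil N lam) M"
  using assms unfolding toric_frame_def pframe_def \<iota>_powi by (simp add: biadd_bil)

lemma toric_frame_frame:
  assumes T: "toric_frame l z \<iota> N lam M"
  shows "frame N (bil N lam) M"
  unfolding frame_def
proof (intro conjI ballI)
  show "pframe N (bil N lam) M" by (rule toric_pframe[OF T])
  fix f g
  have "bil N lam f g + bil N lam g f = (\<Sum>i<N. \<Sum>j<N. f i * (lam i j + lam j i) * g j)"
  proof -
    have "bil N lam g f = (\<Sum>i<N. \<Sum>j<N. f i * lam j i * g j)"
      unfolding bil_def by (subst sum.swap) (simp add: mult.commute mult.left_commute)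
    then show ?thesis unfolding bil_def by (simp add: sum.distrib[symmetric] algebra_simps)
  qed
  also have "int l dvd \<dots>"
    using T unfolding toric_frame_def skew_mod_def
    by (intro dvd_sum dvd_mult2 dvd_mult) (simp add: dvd_eq_mod_eq_0)
  finally show "[bil N lam f g = - bil N lam g f] (mod int l)"
    by (simp add: cong_iff_dvd_diff)
next
  show "free_on M (Zvec N)"
    unfolding free_on_def
  proof (intro allI impI ballI)
    fix S c f0 assume S: "finite S" "S \<subseteq> Zvec N" and c: "\<forall>f\<in>S. c f \<in> \<iota> ` Aring z"
      and zero: "(\<Sum>f\<in>S. c f * M f) = 0" and f0: "f0 \<in> S"
    have "\<forall>f\<in>S. \<exists>a. a \<in> Aring z \<and> c f = \<iota> a" using c by blast
    from bchoice[OF this] obtain c1 where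
      c1: "\<And>f. f \<in> S \<Longrightarrow> c1 f \<in> Aring z" "\<And>f. f \<in> S \<Longrightarrow> c f = \<iota> (c1 f)"
      by blast
    define c2 where "c2 f = (if f \<in> S then c1 f else 0)" for f
    have c2S: "{f\<in>Zvec N. c2 f \<noteq> 0} \<subseteq> S" by (auto simp: c2_def)
    have "(\<Sum>f\<in>{f\<in>Zvec N. c2 f \<noteq> 0}. \<iota> (c2 f) * M f) = (\<Sum>f\<in>S. \<iota> (c2 f) * M f)"
      using S c2S by (intro sum.mono_neutral_left) (auto simp: \<iota>_0)
    also have "\<dots> = (\<Sum>f\<in>S. c f * M f)"
      by (rule sum.cong[OF refl]) (simp add: c2_def c1)
    finally have "(\<Sum>f\<in>{f\<in>Zvec N. c2 f \<noteq> 0}. \<iota> (c2 f) * M f) = 0" using zero by simp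
    moreover have "finite {f\<in>Zvec N. c2 f \<noteq> 0}" by (rule finite_subset[OF c2S S(1)])
    moreover have "\<forall>f. c2 f \<in> Aring z" using c1 Aring_0 by (simp add: c2_def)
    ultimately have "\<forall>f\<in>Zvec N. c2 f = 0"
      using T unfolding toric_frame_def by blast
    then have "c2 f0 = 0" using f0 S(2) by blast
    then show "c f0 = 0" using c1(2)[OF f0] f0 by (simp add: c2_def \<iota>_0)
  qed
qed

text \<open>Each mutation step brings its own matrix for the source frame; this identifies it mod
  \<open>l\<close> with the form carried along the path.\<close>

lemma pframe_form_unique:
  assumes "pframe n L M" "pframe n L' M" "f \<in> Zvec n" "g \<in> Zvec n"
  shows "[L f g = L' f g] (mod int l)"
proof (rule qp_inj)
  have "qp (L f g) * M (f + g) = qp (L' f g) * M (f + g)"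
    by (rule trans[OF pframe_mult[OF assms(1,3,4), symmetric] pframe_mult[OF assms(2-4)]])
  then have "M (f + g) = 0 \<or> qp (L f g) = qp (L' f g)" unfolding mult_cancel_right .
  then show "qp (L f g) = qp (L' f g)"
    using pframe_nz[OF assms(1) Zvec_add[OF assms(3,4)]] by blast
qed

end

section \<open>The mutated form in matrix language\<close>

lemma bil_cong: "(\<And>i. i < N \<Longrightarrow> f i = f' i) \<Longrightarrow> (\<And>i. i < N \<Longrightarrow> g i = g' i) \<Longrightarrow> bil N lam f g = bil N lam f' g'"
  unfolding bil_def by (intro sum.cong) simp_all

lemma bil_congruence:
  "bil N (\<lambda>i j. \<Sum>a<N. \<Sum>c<N. E a i * lam a c * E c j) f g
    = bil N lam (\<lambda>a. \<Sum>i<N. E a i * f i) (\<lambda>a. \<Sum>i<N. E a i * g i)"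
proof -
  let ?t = "\<lambda>i j a c. E a i * f i * lam a c * (E c j * g j)"
  have "bil N (\<lambda>i j. \<Sum>a<N. \<Sum>c<N. E a i * lam a c * E c j) f g = (\<Sum>i<N. \<Sum>j<N. \<Sum>a<N. \<Sum>c<N. ?t i j a c)"
    unfolding bil_def by (simp add: sum_distrib_left sum_distrib_right mult_ac)
  also have "\<dots> = (\<Sum>i<N. \<Sum>a<N. \<Sum>j<N. \<Sum>c<N. ?t i j a c)"
    by (rule sum.cong[OF refl]) (rule sum.swap)
  also have "\<dots> = (\<Sum>a<N. \<Sum>i<N. \<Sum>j<N. \<Sum>c<N. ?t i j a c)" by (rule sum.swap)
  also have "\<dots> = (\<Sum>a<N. \<Sum>i<N. \<Sum>c<N. \<Sum>j<N. ?t i j a c)"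
    by (rule sum.cong[OF refl], rule sum.cong[OF refl]) (rule sum.swap)
  also have "\<dots> = (\<Sum>a<N. \<Sum>c<N. \<Sum>i<N. \<Sum>j<N. ?t i j a c)"
    by (rule sum.cong[OF refl]) (rule sum.swap)
  also have "\<dots> = bil N lam (\<lambda>a. \<Sum>i<N. E a i * f i) (\<lambda>a. \<Sum>i<N. E a i * g i)"
    unfolding bil_def
  proof (rule sum.cong[OF refl], rule sum.cong[OF refl])
    fix a c
    show "(\<Sum>i<N. \<Sum>j<N. ?t i j a c) = (\<Sum>i<N. E a i * f i) * lam a c * (\<Sum>i<N. E c i * g i)"
      unfolding sum_distrib_right[of _ _ "lam a c"] sum_product ..
  qed
  finally show ?thesis .
qed

lemma mutE_reflect:
  assumes "k < N" "B k k = 0" "a < N"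
  shows "(\<Sum>i<N. mutE B k a i * f i) = reflect (posp (- colv N B k)) k f a"
proof -
  have "(\<Sum>i<N. mutE B k a i * f i)
      = (\<Sum>i<N. (if i = k then (if a = k then -1 else max 0 (- B a k)) * f k else 0) + (if i = a then (if a = k then 0 else f a) else 0))"
    by (rule sum.cong) (auto simp: mutE_def)
  also have "\<dots> = (if a = k then -1 else max 0 (- B a k)) * f k + (if a = k then 0 else f a)"
    using assms by (simp add: sum.distrib)
  also have "\<dots> = reflect (posp (- colv N B k)) k f a"
    using assms by (simp add: reflect_apply posp_apply)
  finally show ?thesis .
qed

lemma bil_mutLam:
  assumes "k < N" "B k k = 0"
  shows "bil N (mutLam N B k lam) f g
    = bil N lam (reflect (posp (- colv N B k)) k f) (reflect (posp (- colv N B k)) k g)"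
  unfolding mutLam_def bil_congruence by (rule bil_cong) (simp_all add: mutE_reflect[of k N B, OF assms])

lemma gen_alg_minimal: "S \<subseteq> gen_alg z \<iota> S' \<Longrightarrow> gen_alg z \<iota> S \<subseteq> gen_alg z \<iota> S'"
  unfolding gen_alg_def by blast

lemma gen_alg_base: "x \<in> S \<Longrightarrow> x \<in> gen_alg z \<iota> S"
  unfolding gen_alg_def by blast

context cluster
begin

lemma mpath_append:
  "mpath ks (M, L, B) M1 L1 B1 \<Longrightarrow> mpath ks' (M1, L1, B1) M2 L2 B2 \<Longrightarrow> mpath (ks @ ks') (M, L, B) M2 L2 B2"
proof (induction ks arbitrary: M L B)
  case Nil
  then show ?case by simp
next
  case (Cons a ks)
  then show ?case unfolding append_Cons mpath.simps by blast
qed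

text \<open>Up to a power of \<open>q\<close>, such a monomial is an ordered product of variables
  and of inverses of variables with index in \<open>J\<close>.\<close>

lemma aspan_pos_off_subset:
  assumes pf: "pframe n L M" and R: "A \<subseteq> R" "\<And>x y. x \<in> R \<Longrightarrow> y \<in> R \<Longrightarrow> x + y \<in> R" "\<And>x y. x \<in> R \<Longrightarrow> y \<in> R \<Longrightarrow> x * y \<in> R"
    and pos: "\<And>i. i < n \<Longrightarrow> M (uvec i) \<in> R" and neg: "\<And>j. j < n \<Longrightarrow> j \<in> J \<Longrightarrow> inverse (M (uvec j)) \<in> R"
    and y: "y \<in> aspan M {f\<in>Zvec n. pos_off J f}"
  shows "y \<in> R"
proof -
  have R1: "1 \<in> R" "0 \<in> R" and Rq: "qp s \<in> R" for s using R(1) A_one A_zero qp_in by blast+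
  have Rp: "x ^ m \<in> R" if "x \<in> R" for x m by (induction m) (simp_all add: R1 R(3) that)
  \<comment> \<open>Induction on the number \<open>m\<close> of coordinates that may be nonzero; the
    last one is split off, and a negative exponent there forces its index into
    \<open>J\<close>.\<close>
  have mono: "M f \<in> R" if "pos_off J f" "\<forall>a. m \<le> a \<longrightarrow> f a = 0" "m \<le> n" for m f
    using that
  proof (induction m arbitrary: f)
    case 0
    then have "f = 0" by (intro ext) simp
    then show ?case using pframe_0[OF pf] R1 by (simp only:)
  next
    case (Suc m)
    let ?f = "f(m := 0)"
    have m: "m < n" using Suc.prems(3) by simp
    have fZ: "f \<in> Zvec n" using Suc.prems(2,3) by (simp add: Zvec_def)
    have ih: "M ?f \<in> R" 
      by (rule Suc.IH) (use Suc.prems in \<open>auto simp: pos_off_def\<close>)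
    show ?case
    proof (cases "f m \<ge> 0")
      case True
      have "f = ?f + svec (int (nat (f m))) m" using fun_upd_split[of f m] True by simp
      then have "M f = M (?f + svec (int (nat (f m))) m)" by (rule arg_cong)
      also have "\<dots> = qp (corr L ?f m (int (nat (f m)))) * (M ?f * M (uvec m) ^ nat (f m))"
        by (rule pframe_split[OF pf Zvec_upd[OF fZ] m])
      finally show ?thesis using R(3)[OF Rq R(3)[OF ih Rp[OF pos[OF m]]]] by simp
    next
      case False
      then have mJ: "m \<in> J" using Suc.prems(1) m unfolding pos_off_def by blast
      let ?c = "nat (- f m)"
      obtain s where s: "M f * M (uvec m) ^ ?c = qp s * M (f + svec (int ?c) m)"
        using pframe_shift[OF pf fZ m] .
      have "f + svec (int ?c) m = ?f" by (rule ext) (use False in \<open>simp add: svec_def\<close>)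
      then have s': "M f * M (uvec m) ^ ?c = qp s * M ?f" using s by (simp only:)
      have nz: "M (uvec m) ^ ?c \<noteq> 0" using pframe_nz[OF pf Zvec_uvec[OF m]] by simp
      have "M f = M f * M (uvec m) ^ ?c * inverse (M (uvec m) ^ ?c)" using nz by (simp add: mult.assoc)
      also have "\<dots> = qp s * M ?f * inverse (M (uvec m)) ^ ?c" by (simp only: s' power_inverse)
      finally show ?thesis using R(3)[OF R(3)[OF Rq ih] Rp[OF neg[OF m mJ]]] by simp
    qed
  qed
  obtain S c where S: "finite S" "S \<subseteq> {f\<in>Zvec n. pos_off J f}" "\<And>f. f \<in> S \<Longrightarrow> c f \<in> A" "y = (\<Sum>f\<in>S. c f * M f)"
    using y by (rule aspanE) blast
  have t: "c f * M f \<in> R" if f: "f \<in> S" for f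
  proof (rule R(3))
    show "c f \<in> R" using S(3)[OF f] R(1) by blast
    show "M f \<in> R" by (rule mono[of f n]) (use f S(2) in \<open>auto simp: Zvec_def\<close>)
  qed
  have "T \<subseteq> S \<Longrightarrow> (\<Sum>f\<in>T. c f * M f) \<in> R" if "finite T" for T
    using that by (induction T rule: finite_induct) (simp_all add: R1 R(2) t)
  then show ?thesis using S(1,4) by blast
qed

end

theorem theorem3p10:
  fixes l N :: nat and z :: complex and \<iota> :: "complex \<Rightarrow> 'f::division_ring"
    and ex invs :: "nat set" and M :: "(nat \<Rightarrow> int) \<Rightarrow> 'f" and B :: "nat \<Rightarrow> nat \<Rightarrow> int"
  assumes "primitive_root l z"
    and "division_algebra_over z \<iota>"
    and "ex \<subseteq> {..<N}"
    and "quantum_seed l z \<iota> N ex M B"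
    and "invs \<subseteq> {..<N} - ex"
  shows "cluster_alg l z \<iota> N ex M B invs \<subseteq> upper_alg l z \<iota> N ex M B invs"
proof -
  obtain lam d where T: "toric_frame l z \<iota> N lam M" and d: "\<forall>j\<in>ex. d j > (0::int)"
    and ds: "\<forall>i\<in>ex. \<forall>j\<in>ex. d i * B i j = - (d j * B j i)"
    and co: "\<forall>i<N. \<forall>j\<in>ex. ((\<Sum>k<N. B k j * lam k i) - (if i = j then d j else 0)) mod int l = 0"
    using assms(4) unfolding quantum_seed_def l_compatible_def by blast
  interpret root_data l z \<iota> using assms(1,2) by unfold_locales
  interpret cluster "\<iota> ` Aring z" "\<iota> z" l N ex d
    by unfold_locales (use assms(3) d in blast)+
  let ?L = "bil N lam"
  have "compat ?L B"
    unfolding compat_def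
  proof (intro ballI)
    fix j g assume j: "j \<in> ex" and g: "g \<in> Zvec N"
    have "bil N lam (colv N B j) g - d j * g j = (\<Sum>i<N. ((\<Sum>k<N. B k j * lam k i) - (if i = j then d j else 0)) * g i)"
    proof -
      have "(\<Sum>i<N. (if i = j then d j else 0) * g i) = (\<Sum>i<N. if i = j then d j * g j else 0)"
        by (rule sum.cong) auto
      then have "d j * g j = (\<Sum>i<N. (if i = j then d j else 0) * g i)" using ex_less[OF j] by simp
      moreover have "bil N lam (colv N B j) g = (\<Sum>i<N. (\<Sum>k<N. B k j * lam k i) * g i)"
        unfolding bil_tail by simp
      ultimately show ?thesis by (simp only: left_diff_distrib sum_subtractf)
    qed
    also have "int l dvd \<dots>"
      by (intro dvd_sum dvd_mult2) (use co j in \<open>simp add: dvd_eq_mod_eq_0\<close>)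
    finally show "[bil N lam (colv N B j) g = d j * g j] (mod int l)" by (simp add: cong_iff_dvd_diff)
  qed
  moreover have "dskew B" unfolding dskew_def by (rule ds)
  ultimately have S0: "seed M ?L B" unfolding seed_def using toric_frame_frame[OF T] by blast
  \<comment> \<open>Translates a step into \<open>mutates\<close> relative to the form
    \<open>L\<close> already attached to the source seed, although the step may use another matrix
    for it.\<close>
  have mut: "\<exists>k L'. k \<in> ex \<and> mutates k (fst S1) L (snd S1) (fst S2) L' (snd S2) \<and> seed (fst S2) L' (snd S2)"
    if st: "mut_step l z \<iota> N ex S1 S2" and S1: "seed (fst S1) L (snd S1)" for S1 S2 L
  proof -
    obtain k lam' where k: "k \<in> ex" and B2: "snd S2 = mutB (snd S1) k"
      and T1: "toric_frame l z \<iota> N lam' (fst S1)" and T2: "toric_frame l z \<iota> N (mutLam N (snd S1) k lam') (fst S2)"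
      and oth: "\<forall>j<N. j \<noteq> k \<longrightarrow> fst S2 (uvec j) = fst S1 (uvec j)"
      and exch: "fst S2 (uvec k) = fst S1 (- uvec k + posp (colv N (snd S1) k)) + fst S1 (- uvec k - negp (colv N (snd S1) k))"
      using st unfolding mut_step_def by blast
    let ?L' = "bil N (mutLam N (snd S1) k lam')" let ?v = "posp (- colv N (snd S1) k)"
    have kk: "snd S1 k k = 0" by (rule dskew_diag[OF seed_dskew[OF S1] k])
    have Lc: "[?L' f g = L (reflect ?v k f) (reflect ?v k g)] (mod int l)" if "f \<in> Zvec N" "g \<in> Zvec N" for f g
      unfolding bil_mutLam[of k N "snd S1", OF ex_less[OF k] kk]
      by (rule pframe_form_unique[OF toric_pframe[OF T1] seed_pframe[OF S1]]) (use that k in simp_all)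
    have "- uvec k - negp (colv N (snd S1) k) = - uvec k + ?v"
      using negp_posp[of "colv N (snd S1) k"] by (metis diff_conv_add_uminus)
    then have "fst S2 (uvec k) = fst S1 (- uvec k + posp (colv N (snd S1) k)) + fst S1 (- uvec k + ?v)"
      using exch by (simp only:)
    then have m: "mutates k (fst S1) L (snd S1) (fst S2) ?L' (snd S2)"
      unfolding mutates_def using B2 Lc oth by blast
    show ?thesis using k m seed_mutates[OF S1 k m toric_frame_frame[OF T2]] by blast
  qed
  \<comment> \<open>The return path is recorded too: a variable of \<open>S'\<close> is expanded in
    an arbitrary seed \<open>S\<close> along the way back to the initial seed followed by the path
    to \<open>S'\<close>. Frozen variables never change, which handles the inverses indexed by
    \<open>invs\<close>.\<close>
  have reach: "\<exists>L ks ks'. seed (fst S) L (snd S) \<and> mpath ks (M, ?L, B) (fst S) L (snd S) \<and>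
      mpath ks' (fst S, L, snd S) M ?L B \<and> (\<forall>j<N. j \<notin> ex \<longrightarrow> fst S (uvec j) = M (uvec j))"
    if "mut_equiv l z \<iota> N ex (M, B) S" for S
    using that unfolding mut_equiv_def
  proof (induction rule: rtranclp_induct)
    case base
    have "mpath [] (M, ?L, B) M ?L B" by simp
    then show ?case using S0 by (metis fst_conv snd_conv)
  next
    case (step S1 S2)
    obtain L ks ks' where S1: "seed (fst S1) L (snd S1)" and p: "mpath ks (M, ?L, B) (fst S1) L (snd S1)"
      and p': "mpath ks' (fst S1, L, snd S1) M ?L B" and oth: "\<forall>j<N. j \<notin> ex \<longrightarrow> fst S1 (uvec j) = M (uvec j)"
      using step.IH by blast
    obtain k L' where k: "k \<in> ex" and m: "mutates k (fst S1) L (snd S1) (fst S2) L' (snd S2)"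
      and S2: "seed (fst S2) L' (snd S2)"
      using mut[OF step.hyps(2) S1] by blast
    have 1: "mpath [k] (fst S1, L, snd S1) (fst S2) L' (snd S2)" using k m S2 by simp
    have 2: "mpath (k # ks') (fst S2, L', snd S2) M ?L B"
      unfolding mpath.simps using k mutates_sym[OF S1 k m S2] S1 p' by blast
    have "fst S2 (uvec j) = M (uvec j)" if "j < N" "j \<notin> ex" for j
      using mutates_other[OF m that(1)] oth that k by metis
    then show ?case using S2 mpath_append[OF p 1] 2 by blast
  qed
  show ?thesis
    unfolding cluster_alg_def upper_alg_def
  proof (rule INF_greatest)
    fix S assume "S \<in> {S. mut_equiv l z \<iota> N ex (M, B) S}"
    then obtain L ks where S: "seed (fst S) L (snd S)" and p: "mpath ks (fst S, L, snd S) M ?L B"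
      and froz: "\<And>j. j < N \<Longrightarrow> j \<notin> ex \<Longrightarrow> fst S (uvec j) = M (uvec j)"
      using reach by blast
    let ?G = "{fst S (uvec i) | i. i < N} \<union> {inverse (fst S (uvec j)) | j. j \<in> ex \<union> invs}"
    have 1: "fst S' (uvec i) \<in> gen_alg z \<iota> ?G" if S': "mut_equiv l z \<iota> N ex (M, B) S'" and i: "i < N" for S' i
    proof -
      obtain L' ks' where p': "mpath ks' (M, ?L, B) (fst S') L' (snd S')"
        using reach[OF S'] by blast
      have y: "fst S' (uvec i) \<in> aspan (fst S) {f\<in>Zvec N. pos_off (ex \<union> invs) f}"
        by (rule laurent[OF S mpath_append[OF p p'] _ i]) blast
      show ?thesis
        unfolding gen_alg_def
      proof (rule InterI)
        fix R assume "R \<in> {R. \<iota> ` Aring z \<subseteq> R \<and> ?G \<subseteq> R \<and> (\<forall>x\<in>R. \<forall>y\<in>R. x + y \<in> R \<and> x * y \<in> R \<and> - x \<in> R)}"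
        then have R: "\<iota> ` Aring z \<subseteq> R" "?G \<subseteq> R" "\<And>x y. x \<in> R \<Longrightarrow> y \<in> R \<Longrightarrow> x + y \<in> R" "\<And>x y. x \<in> R \<Longrightarrow> y \<in> R \<Longrightarrow> x * y \<in> R"
          by blast+
        show "fst S' (uvec i) \<in> R"
          by (rule aspan_pos_off_subset[OF seed_pframe[OF S] R(1,3,4) _ _ y]) (use R(2) in blast)+
      qed
    qed
    have 2: "inverse (M (uvec j)) \<in> gen_alg z \<iota> ?G" if j: "j \<in> invs" for j
    proof (rule gen_alg_base)
      have "j < N" "j \<notin> ex" using j assms(5) by auto
      then have "inverse (M (uvec j)) = inverse (fst S (uvec j))" using froz by simp
      then show "inverse (M (uvec j)) \<in> ?G" using j by blast
    qed
    show "gen_alg z \<iota> ({fst S (uvec i) | S i. mut_equiv l z \<iota> N ex (M, B) S \<and> i < N} \<union> {inverse (M (uvec j)) | j. j \<in> invs})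
        \<subseteq> gen_alg z \<iota> ?G"
      by (rule gen_alg_minimal) (use 1 2 in blast)
  qed
qed

end
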